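(* Let $(X,\phi)$ be a uniformly Lipschitz flow on a compact metric space $(X,d)$. Then for every $\delta\in(0,1)$, \begin{align*} \overline{\mathrm{mdim}}_M(\phi,X,d)&=\limsup_{\epsilon\to0}\frac{1}{\log\frac1\epsilon}\sup_{\mu\in\mathcal{E}_\phi(X)}\inf_{\mathrm{diam}\,P\le\epsilon}h_\mu(\phi_1,P)\\ &=\limsup_{\epsilon\to0}\frac{1}{\log\frac1\epsilon}\sup_{\mu\in\mathcal{E}_\phi(X)}\inf_{\mathrm{diam}\,\mathcal{U}\le\epsilon}\underline{h}^S_\mu(\phi_1,\mathcal{U},\delta)\\ &=\limsup_{\epsilon\to0}\frac{1}{\log\frac1\epsilon}\sup_{\mu\in\mathcal{E}_\phi(X)}\inf_{\mathrm{diam}\,\mathcal{U}\le\epsilon}\overline{h}^S_\mu(\phi_1,\mathcal{U},\delta)\\ &=\limsup_{\epsilon\to0}\frac{1}{\log\frac1\epsilon}\sup_{\mu\in\mathcal{E}_\phi(X)}\overline{h}^{BK}_\mu(\phi_1,\epsilon)\\ &=\limsup_{\epsilon\to0}\frac{1}{\log\frac1\epsilon}\sup_{\mu\in\mathcal{E}_\phi(X)}\underline{h}^K_\mu(\epsilon,\delta,\phi_1)\\ &=\limsup_{\epsilon\to0}\frac{1}{\log\frac1\epsilon}\sup_{\mu\in\mathcal{E}_\phi(X)}\overline{h}^K_\mu(\epsilon,\delta,\phi_1), \end{align*} where $P$ ranges over finite Borel partitions of $X$ with diameter at most $\epsilon$ and $\mathcal{U}$ over finite open covers of $X$ with diameter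 at most $\epsilon$.
   Context: A flow $(X,\phi)$: $(X,d)$ compact metric, $\phi:X\times\mathbb{R}\to X$ continuous, $\phi_t(x)=\phi(x,t)$, $\phi_0=\mathrm{id}$, $\phi_{t+s}=\phi_t\circ\phi_s$. It is uniformly Lipschitz if for every $t_0>0$ there is $L(t_0)>0$ such that for every $\epsilon>0$ and $x,y\in X$, $d(x,y)\le\epsilon/L(t_0)$ implies $d(\phi_s x,\phi_s y)<\epsilon$ for all $s\in[0,t_0]$. Metric mean dimension: $d_t(x,y)=\max_{s\in[0,t]}d(\phi_sx,\phi_sy)$; $r_t(\phi,X,d,\epsilon)$ is the minimal cardinality of $E\subset X$ with every $x\in X$ within $d_t$-distance $<\epsilon$ of some point of $E$; $r(\phi,X,d,\epsilon)=\limsup_{t\to\infty}\frac1t\log r_t(\phi,X,d,\epsilon)$; $\overline{\mathrm{mdim}}_M(\phi,X,d)=\limsup_{\epsilon\to0}\frac{r(\phi,X,d,\epsilon)}{\log(1/\epsilon)}$. $\mathcal{E}_\phi(X)$ is the set of Borel probability measures $\mu$ that are $\phi_t$-invariant for all $t\in\mathbb{R}$ and ergodic (every Borel set invariant under all $\phi_t$ has measure $0$ or $1$). For a finite Borel partition $P$, $H_\mu(P)=-\sum_{A\in P}\mu(A)\log\mu(A)$, $P^n=\{A_0\cap\phi_{-1}A_1\cap\cdots\cap\phi_{-(n-1)}A_{n-1}:A_j\in P\}$, and $h_\mu(\phi_1,P)=\lim_{n\to\infty}\frac1nH_\mu(P^n)$. Diameter of a partition/cover is the supremum of diameters of its members.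 Shapira entropy: for a finite open cover $\mathcal{U}$, $\mathcal{U}^n=\{U_0\cap\phi_{-1}U_1\cap\cdots\cap\phi_{-(n-1)}U_{n-1}:U_j\in\mathcal{U}\}$; $N_\mu(\mathcal{U},\delta)=\min\{\#\mathcal{U}':\mathcal{U}'\subset\mathcal{U},\ \mu(\bigcup_{A\in\mathcal{U}'}A)\ge\delta\}$; $\underline{h}^S_\mu(\phi_1,\mathcal{U},\delta)=\liminf_{n\to\infty}\frac1n\log N_\mu(\mathcal{U}^n,\delta)$ and $\overline{h}^S_\mu(\phi_1,\mathcal{U},\delta)=\limsup_{n\to\infty}\frac1n\log N_\mu(\mathcal{U}^n,\delta)$. For $n\in\mathbb{N}$, $B_n(x,\epsilon,\phi_1)=\{y:d(\phi_jx,\phi_jy)<\epsilon,\ j=0,\dots,n-1\}$. Upper Brin–Katok entropy: $\overline{h}^{BK}_\mu(\phi_1,\epsilon)=\int\limsup_{n\to\infty}-\frac1n\log\mu(B_n(x,\epsilon,\phi_1))\,d\mu(x)$. Katok entropy: $R^\delta_\mu(n,\epsilon,\phi_1)=\min\{\#E:E\subset X,\ \mu(\bigcup_{x\in E}B_n(x,\epsilon,\phi_1))>\delta\}$, $\overline{h}^K_\mu(\epsilon,\delta,\phi_1)=\limsup_{n\to\infty}\frac1n\log R^\delta_\mu(n,\epsilon,\phi_1)$, $\underline{h}^K_\mu(\epsilon,\delta,\phi_1)=\liminf_{n\to\infty}\frac1n\log R^\delta_\mu(n,\epsilon,\phi_1)$. *)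

theory Defs
  imports "HOL-Probability.Probability"
begin

text \<open>A flow on the compact metric space X (a compact subset of a metric type, with the
  ambient metric dist); phi x t is the point phi_t(x).\<close>

definition is_flow :: "'a::metric_space set \<Rightarrow> ('a \<Rightarrow> real \<Rightarrow> 'a) \<Rightarrow> bool" where
  "is_flow X phi \<longleftrightarrow>
     continuous_on (X \<times> UNIV) (\<lambda>(x, t). phi x t) \<and>
     (\<forall>x\<in>X. \<forall>t. phi x t \<in> X) \<and>
     (\<forall>x\<in>X. phi x 0 = x) \<and>
     (\<forall>x\<in>X. \<forall>t s. phi x (t + s) = phi (phi x s) t)"

definition uniformly_lipschitz_flow :: "'a::metric_space set \<Rightarrow> ('a \<Rightarrow> real \<Rightarrow> 'a) \<Rightarrow> bool" where
  "uniformly_lipschitz_flow X phi \<longleftrightarrow>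
     (\<forall>t0>0. \<exists>L>0. \<forall>\<epsilon>>0. \<forall>x\<in>X. \<forall>y\<in>X.
        dist x y \<le> \<epsilon> / L \<longrightarrow> (\<forall>s\<in>{0..t0}. dist (phi x s) (phi y s) < \<epsilon>))"

definition flow_dist :: "('a::metric_space \<Rightarrow> real \<Rightarrow> 'a) \<Rightarrow> real \<Rightarrow> 'a \<Rightarrow> 'a \<Rightarrow> real" where
  "flow_dist phi t x y = (SUP s\<in>{0..t}. dist (phi x s) (phi y s))"

definition span_num :: "'a::metric_space set \<Rightarrow> ('a \<Rightarrow> real \<Rightarrow> 'a) \<Rightarrow> real \<Rightarrow> real \<Rightarrow> nat" where
  "span_num X phi t \<epsilon> =
     (LEAST k. \<exists>E. finite E \<and> E \<subseteq> X \<and> card E = k \<and>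
                  (\<forall>x\<in>X. \<exists>y\<in>E. flow_dist phi t x y < \<epsilon>))"

definition span_rate :: "'a::metric_space set \<Rightarrow> ('a \<Rightarrow> real \<Rightarrow> 'a) \<Rightarrow> real \<Rightarrow> ereal" where
  "span_rate X phi \<epsilon> = Limsup at_top (\<lambda>t::real. ereal (ln (real (span_num X phi t \<epsilon>)) / t))"

definition upper_mdim :: "'a::metric_space set \<Rightarrow> ('a \<Rightarrow> real \<Rightarrow> 'a) \<Rightarrow> ereal" where
  "upper_mdim X phi = Limsup (at_right 0) (\<lambda>\<epsilon>. span_rate X phi \<epsilon> / ereal (ln (1 / \<epsilon>)))"

definition ergodic_measures :: "'a::metric_space set \<Rightarrow> ('a \<Rightarrow> real \<Rightarrow> 'a) \<Rightarrow> 'a measure set" where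
  "ergodic_measures X phi =
     {\<mu>. prob_space \<mu> \<and> sets \<mu> = sets (restrict_space borel X) \<and>
         (\<forall>t. \<forall>A\<in>sets \<mu>. measure \<mu> {x\<in>X. phi x t \<in> A} = measure \<mu> A) \<and>
         (\<forall>A\<in>sets \<mu>. (\<forall>t. {x\<in>X. phi x t \<in> A} = A) \<longrightarrow>
                        measure \<mu> A = 0 \<or> measure \<mu> A = 1)}"

definition borel_partition :: "'a::metric_space set \<Rightarrow> 'a set set \<Rightarrow> bool" where
  "borel_partition X P \<longleftrightarrow> finite P \<and>
     (\<forall>A\<in>P. A \<in> sets (restrict_space borel X) \<and> A \<noteq> {}) \<and> disjoint P \<and> \<Union>P = X"

definition join_family :: "'a set \<Rightarrow> ('a \<Rightarrow> real \<Rightarrow> 'a) \<Rightarrow> 'a set set \<Rightarrow> nat \<Rightarrow> 'a set set" where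
  "join_family X phi P n =
     {X \<inter> (\<Inter>j<n. {x. phi x (real j) \<in> As j}) | As. \<forall>j<n. As j \<in> P}"

definition part_entropy :: "'a measure \<Rightarrow> 'a set set \<Rightarrow> real" where
  "part_entropy \<mu> P = - (\<Sum>A\<in>P. measure \<mu> A * ln (measure \<mu> A))"

definition ent_part :: "'a measure \<Rightarrow> 'a set \<Rightarrow> ('a \<Rightarrow> real \<Rightarrow> 'a) \<Rightarrow> 'a set set \<Rightarrow> real" where
  "ent_part \<mu> X phi P = lim (\<lambda>n. part_entropy \<mu> (join_family X phi P n) / real n)"

definition open_cover :: "'a::metric_space set \<Rightarrow> 'a set set \<Rightarrow> bool" where
  "open_cover X U \<longleftrightarrow> finite U \<and> (\<forall>V\<in>U. openin (top_of_set X) V) \<and> X \<subseteq> \<Union>U"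

definition cover_N :: "'a measure \<Rightarrow> 'a set set \<Rightarrow> real \<Rightarrow> nat" where
  "cover_N \<mu> U \<delta> = (LEAST k. \<exists>U'\<subseteq>U. card U' = k \<and> measure \<mu> (\<Union>U') \<ge> \<delta>)"

definition shapira_lower :: "'a measure \<Rightarrow> 'a set \<Rightarrow> ('a \<Rightarrow> real \<Rightarrow> 'a) \<Rightarrow> 'a set set \<Rightarrow> real \<Rightarrow> ereal" where
  "shapira_lower \<mu> X phi U \<delta> =
     liminf (\<lambda>n. ereal (ln (real (cover_N \<mu> (join_family X phi U n) \<delta>)) / real n))"

definition shapira_upper :: "'a measure \<Rightarrow> 'a set \<Rightarrow> ('a \<Rightarrow> real \<Rightarrow> 'a) \<Rightarrow> 'a set set \<Rightarrow> real \<Rightarrow> ereal" where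
  "shapira_upper \<mu> X phi U \<delta> =
     limsup (\<lambda>n. ereal (ln (real (cover_N \<mu> (join_family X phi U n) \<delta>)) / real n))"

definition bowen_ball :: "'a::metric_space set \<Rightarrow> ('a \<Rightarrow> real \<Rightarrow> 'a) \<Rightarrow> nat \<Rightarrow> 'a \<Rightarrow> real \<Rightarrow> 'a set" where
  "bowen_ball X phi n x \<epsilon> = {y\<in>X. \<forall>j<n. dist (phi x (real j)) (phi y (real j)) < \<epsilon>}"

definition neg_log :: "real \<Rightarrow> ereal" where
  "neg_log p = (if p = 0 then \<infinity> else ereal (- ln p))"

definition upper_BK :: "'a::metric_space measure \<Rightarrow> 'a set \<Rightarrow> ('a \<Rightarrow> real \<Rightarrow> 'a) \<Rightarrow> real \<Rightarrow> ereal" where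
  "upper_BK \<mu> X phi \<epsilon> = enn2ereal (\<integral>\<^sup>+ x. e2ennreal
      (limsup (\<lambda>n. neg_log (measure \<mu> (bowen_ball X phi n x \<epsilon>)) / ereal (real n))) \<partial>\<mu>)"

definition katok_R :: "'a::metric_space measure \<Rightarrow> 'a set \<Rightarrow> ('a \<Rightarrow> real \<Rightarrow> 'a) \<Rightarrow> nat \<Rightarrow> real \<Rightarrow> real \<Rightarrow> nat" where
  "katok_R \<mu> X phi n \<epsilon> \<delta> =
     (LEAST k. \<exists>E. finite E \<and> E \<subseteq> X \<and> card E = k \<and>
                  measure \<mu> (\<Union>x\<in>E. bowen_ball X phi n x \<epsilon>) > \<delta>)"

definition katok_upper :: "'a::metric_space measure \<Rightarrow> 'a set \<Rightarrow> ('a \<Rightarrow> real \<Rightarrow> 'a) \<Rightarrow> real \<Rightarrow> real \<Rightarrow> ereal" where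
  "katok_upper \<mu> X phi \<epsilon> \<delta> = limsup (\<lambda>n. ereal (ln (real (katok_R \<mu> X phi n \<epsilon> \<delta>)) / real n))"

definition katok_lower :: "'a::metric_space measure \<Rightarrow> 'a set \<Rightarrow> ('a \<Rightarrow> real \<Rightarrow> 'a) \<Rightarrow> real \<Rightarrow> real \<Rightarrow> ereal" where
  "katok_lower \<mu> X phi \<epsilon> \<delta> = liminf (\<lambda>n. ereal (ln (real (katok_R \<mu> X phi n \<epsilon> \<delta>)) / real n))"

definition scaled_limsup :: "(real \<Rightarrow> ereal) \<Rightarrow> ereal" where
  "scaled_limsup g = Limsup (at_right 0) (\<lambda>\<epsilon>. g \<epsilon> / ereal (ln (1 / \<epsilon>)))"

end

theory Submission
  imports Defs
begin

text \<open>
  Fix a scale \<open>\<epsilon>\<close> and write \<open>T = \<phi>\<^sub>1\<close>. A code of length \<open>n\<close> is a convex combination \<open>g\<close> of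
  continuous bumps around words of \<open>n\<close> points; \<open>- ln (g x)\<close> is the cost of describing the first \<open>n\<close>
  points of the orbit of \<open>x\<close> up to \<open>\<epsilon>\<close>. Codes can be concatenated and mixed, and the sum of a code
  over a separated set is at most 1.

  Lower bounds. Call an invariant state (positive normalised functional on \<open>C(X)\<close>) of cost at least
  \<open>c\<close> if no code of length \<open>n\<close> has mean cost below \<open>n c\<close>. Averaging along orbits, as in Misiurewicz's
  proof of the variational principle, shows that if no invariant state has cost at least \<open>c\<close>, then
  every state whatsoever admits, for large \<open>n\<close>, a code of mean cost below \<open>n c\<close>. Hence the maximal
  cost \<open>h\<close> dominates the growth rate of separated sets, the states of cost \<open>h\<close> form a closed extremal
  set, which contains an extreme point \<open>\<nu>\<close>, and mixing a code for a set covered by few Bowen balls with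
  a cheap code for its complement shows that any set of \<open>\<nu>\<close>-measure at least \<open>\<delta>\<close> needs about
  \<open>exp (n h)\<close> Bowen balls. The average of the translates of \<open>\<nu>\<close> under \<open>\<phi>\<^sub>s\<close>, \<open>0 \<le> s \<le> 1\<close>, is ergodic for the flow,
  and by the Lipschitz property inherits the bound at a comparable scale. The remaining entropies
  are compared with Katok's by Markov's inequality, letting \<open>\<delta>\<close> tend to 0.

  Upper bounds. Only the partition entropy is not immediate. A small set that is visited by almost
  every orbit cuts orbits into blocks that are labelled by an optimal spanning set; the induced
  partition has entropy at most the spanning rate plus a constant, which is negligible against
  \<open>ln (1 / \<epsilon>)\<close>. Such a marker set exists unless \<open>T\<close> is periodic almost everywhere.
\<close>

section \<open>States and the Riesz representation\<close>

text \<open>Two obstacles shape the proof. The suprema are taken at a fixed scale, so each scale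
  needs its own ergodic measure of large entropy, found as a weak limit and then made extremal. The
  entropy of a partition is not semicontinuous in the measure, since cell boundaries may carry mass.
  With bumps in place of cells the mean cost \<open>\<Lambda> (\<lambda>x. - ln (g x))\<close> is a
  coordinate of the state, so "cost at least c" is a family of closed conditions and needs no
  hypothesis on boundaries. The second obstacle is that entropies refer to the time-one map while
  ergodicity refers to the whole flow, and a flow-ergodic measure need not be ergodic for time one.
  The lower bound therefore finds an ergodic measure for the time-one map and averages it over one
  unit of time; the upper bound builds marker sets whose integer-time sweep is invariant under the
  flow. For partitions, cells cut out of a cover at every time can produce exponentially more names
  than a spanning set has points. Reading a spanning label only once per block avoids this overhead,
  up to a constant.\<close>

definition states :: "'a::metric_space set \<Rightarrow> (('a \<Rightarrow> real) \<Rightarrow> real) set" where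
  "states X = {\<Lambda>.
     (\<forall>f g. continuous_on X f \<longrightarrow> continuous_on X g \<longrightarrow> \<Lambda> (\<lambda>x. f x + g x) = \<Lambda> f + \<Lambda> g) \<and>
     (\<forall>c f. continuous_on X f \<longrightarrow> \<Lambda> (\<lambda>x. c * f x) = c * \<Lambda> f) \<and>
     (\<forall>f. continuous_on X f \<longrightarrow> (\<forall>x\<in>X. 0 \<le> f x) \<longrightarrow> 0 \<le> \<Lambda> f) \<and>
     \<Lambda> (\<lambda>x. 1) = 1 \<and> (\<forall>f. \<not> continuous_on X f \<longrightarrow> \<Lambda> f = 0)}"

lemma state_add:
  "\<lbrakk>\<Lambda> \<in> states X; continuous_on X f; continuous_on X g\<rbrakk> \<Longrightarrow> \<Lambda> (\<lambda>x. f x + g x) = \<Lambda> f + \<Lambda> g"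
  by (simp add: states_def)

lemma state_cmult:
  "\<lbrakk>\<Lambda> \<in> states X; continuous_on X f\<rbrakk> \<Longrightarrow> \<Lambda> (\<lambda>x. c * f x) = c * \<Lambda> f"
  by (simp add: states_def)

lemma state_nonneg:
  "\<lbrakk>\<Lambda> \<in> states X; continuous_on X f; \<And>x. x \<in> X \<Longrightarrow> 0 \<le> f x\<rbrakk> \<Longrightarrow> 0 \<le> \<Lambda> f"
  by (simp add: states_def)

lemma state_const:
  assumes "\<Lambda> \<in> states X" shows "\<Lambda> (\<lambda>x. c) = c"
  using state_cmult[OF assms, of "\<lambda>x. 1" c] assms by (simp add: states_def)

lemma state_diff:
  assumes "\<Lambda> \<in> states X" "continuous_on X f" "continuous_on X g"
  shows "\<Lambda> (\<lambda>x. f x - g x) = \<Lambda> f - \<Lambda> g"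
  using state_add[OF assms(1,2), of "\<lambda>x. -1 * g x"] state_cmult[OF assms(1,3), of "-1"] assms
  by (simp add: continuous_on_minus)

lemma state_mono:
  assumes "\<Lambda> \<in> states X" "continuous_on X f" "continuous_on X g" "\<And>x. x \<in> X \<Longrightarrow> f x \<le> g x"
  shows "\<Lambda> f \<le> \<Lambda> g"
  using state_nonneg[OF assms(1), of "\<lambda>x. g x - f x"] state_diff[OF assms(1,3,2)] assms
  by (simp add: continuous_on_diff)

lemma state_cong:
  assumes "\<Lambda> \<in> states X" "continuous_on X f" "continuous_on X g" "\<And>x. x \<in> X \<Longrightarrow> f x = g x"
  shows "\<Lambda> f = \<Lambda> g"
  using assms by (intro antisym state_mono[OF assms(1)]) auto

lemma state_sum:
  assumes "\<Lambda> \<in> states X" "finite I" "\<And>i. i \<in> I \<Longrightarrow> continuous_on X (F i)"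
  shows "\<Lambda> (\<lambda>x. \<Sum>i\<in>I. F i x) = (\<Sum>i\<in>I. \<Lambda> (F i))"
  using assms(2,3)
proof (induction I rule: finite_induct)
  case empty
  then show ?case using state_const[OF assms(1), of 0] by simp
next
  case (insert i I)
  then show ?case
    using state_add[OF assms(1), of "F i" "\<lambda>x. \<Sum>i\<in>I. F i x"] by (simp add: continuous_on_sum)
qed

lemma state_bound:
  assumes "\<Lambda> \<in> states X" "continuous_on X f" "\<And>x. x \<in> X \<Longrightarrow> \<bar>f x\<bar> \<le> B"
  shows "\<bar>\<Lambda> f\<bar> \<le> B"
proof -
  have "\<Lambda> f \<le> \<Lambda> (\<lambda>x. B)" "\<Lambda> (\<lambda>x. -B) \<le> \<Lambda> f"
    using assms(3) by (intro state_mono[OF assms(1)] assms(2) continuous_on_const; force)+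
  then show ?thesis using state_const[OF assms(1)] by (simp add: abs_le_iff)
qed

section \<open>Daniell construction of the measure of a state\<close>

definition pos_cover :: "'a::metric_space set \<Rightarrow> 'a set \<Rightarrow> (nat \<Rightarrow> 'a \<Rightarrow> real) set" where
  "pos_cover X A = {F. (\<forall>i. continuous_on X (F i) \<and> (\<forall>x\<in>X. 0 \<le> F i x)) \<and>
     (\<forall>x\<in>A \<inter> X. 1 \<le> (\<Sum>i. ennreal (F i x)))}"

text \<open>Sets are covered by series of continuous functions, on which the functional is defined,
  in place of open sets.\<close>

definition state_outer :: "'a::metric_space set \<Rightarrow> (('a \<Rightarrow> real) \<Rightarrow> real) \<Rightarrow> 'a set \<Rightarrow> ennreal" where
  "state_outer X \<Lambda> A = (INF F\<in>pos_cover X A. \<Sum>i. ennreal (\<Lambda> (F i)))"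

lemma state_outer_le:
  "F \<in> pos_cover X A \<Longrightarrow> state_outer X \<Lambda> A \<le> (\<Sum>i. ennreal (\<Lambda> (F i)))"
  unfolding state_outer_def by (rule INF_lower)

lemma state_outer_le_single:
  assumes L: "\<Lambda> \<in> states X" and f: "continuous_on X f" "\<And>x. x \<in> X \<Longrightarrow> 0 \<le> f x"
    and "\<And>x. x \<in> A \<inter> X \<Longrightarrow> 1 \<le> f x"
  shows "state_outer X \<Lambda> A \<le> ennreal (\<Lambda> f)"
proof -
  define F where "F i = (if i = (0::nat) then f else (\<lambda>x. 0))" for i
  have s: "(\<Sum>i. ennreal (F i x)) = ennreal (f x)" for x
    by (subst suminf_finite[of "{0}"]) (auto simp: F_def)
  have s2: "(\<Sum>i. ennreal (\<Lambda> (F i))) = ennreal (\<Lambda> f)"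
    using state_const[OF L, of 0] by (subst suminf_finite[of "{0}"]) (auto simp: F_def)
  have "F \<in> pos_cover X A"
    unfolding pos_cover_def using f assms(4) by (auto simp: s) (auto simp: F_def)
  from state_outer_le[OF this, of \<Lambda>] s2 show ?thesis by simp
qed

lemma state_outer_space:
  assumes L: "\<Lambda> \<in> states X"
  shows "outer_measure_space (Pow X) (state_outer X \<Lambda>)"
  unfolding outer_measure_space_def
proof (intro conjI)
  have "state_outer X \<Lambda> {} \<le> ennreal (\<Lambda> (\<lambda>x. 0))"
    by (rule state_outer_le_single[OF L]) auto
  then show "positive (Pow X) (state_outer X \<Lambda>)"
    using state_const[OF L, of 0] by (simp add: positive_def)
  show "increasing (Pow X) (state_outer X \<Lambda>)"
    unfolding increasing_def state_outer_def
  proof (intro ballI impI)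
    fix A B :: "'a set" assume "A \<subseteq> B"
    then have "pos_cover X B \<subseteq> pos_cover X A" by (auto simp: pos_cover_def)
    then show "(INF F\<in>pos_cover X A. \<Sum>i. ennreal (\<Lambda> (F i))) \<le> (INF F\<in>pos_cover X B. \<Sum>i. ennreal (\<Lambda> (F i)))"
      by (rule INF_superset_mono) simp
  qed
  show "countably_subadditive (Pow X) (state_outer X \<Lambda>)"
    unfolding countably_subadditive_def
  proof (intro allI impI)
    fix A :: "nat \<Rightarrow> 'a set"
    let ?O = "state_outer X \<Lambda>"
    show "?O (\<Union>i. A i) \<le> (\<Sum>i. ?O (A i))"
    proof (cases "\<exists>i. ?O (A i) = \<infinity>")
      case True
      then obtain i where "?O (A i) = \<infinity>" by auto
      moreover have "?O (A i) \<le> (\<Sum>i. ?O (A i))"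
        using sum_le_suminf[of "\<lambda>i. ?O (A i)" "{i}"] by simp
      ultimately show ?thesis by (simp add: top_unique)
    next
      case False
      show ?thesis
      proof (rule ennreal_le_epsilon)
        fix e :: real assume e: "0 < e"
        have "\<exists>F. F \<in> pos_cover X (A n) \<and>
                 (\<Sum>i. ennreal (\<Lambda> (F i))) \<le> ?O (A n) + ennreal (e * (1/2) ^ Suc n)" for n
        proof -
          have "?O (A n) < ?O (A n) + ennreal (e * (1/2) ^ Suc n)"
            using False e by (metis ennreal_add_left_cancel_less ennreal_less_zero_iff infinity_ennreal_def
                add.right_neutral mult_pos_pos zero_less_power half_gt_zero zero_less_one)
          then obtain F where "F \<in> pos_cover X (A n)"
             "(\<Sum>i. ennreal (\<Lambda> (F i))) < ?O (A n) + ennreal (e * (1/2) ^ Suc n)"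
            by (auto simp: state_outer_def INF_less_iff)
          then show ?thesis by (auto intro: less_imp_le)
        qed
        then obtain F where F: "\<And>n. F n \<in> pos_cover X (A n)"
          "\<And>n. (\<Sum>i. ennreal (\<Lambda> (F n i))) \<le> ?O (A n) + ennreal (e * (1/2) ^ Suc n)" by metis
        define G where "G k = (case prod_decode k of (n, i) \<Rightarrow> F n i)" for k
        have sG: "(\<Sum>k. ennreal (G k x)) = (\<Sum>n. \<Sum>i. ennreal (F n i x))" for x
          using suminf_ennreal_2dimen[of "\<lambda>n. \<Sum>i. ennreal (F n i x)" "\<lambda>(n, i). ennreal (F n i x)"]
          by (simp add: G_def case_prod_unfold)
        have sL: "(\<Sum>k. ennreal (\<Lambda> (G k))) = (\<Sum>n. \<Sum>i. ennreal (\<Lambda> (F n i)))"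
          using suminf_ennreal_2dimen[of "\<lambda>n. \<Sum>i. ennreal (\<Lambda> (F n i))" "\<lambda>(n, i). ennreal (\<Lambda> (F n i))"]
          by (simp add: G_def case_prod_unfold)
        have "G \<in> pos_cover X (\<Union>i. A i)"
          unfolding pos_cover_def mem_Collect_eq
        proof (intro conjI allI ballI)
          fix k show "continuous_on X (G k)" "\<And>x. x \<in> X \<Longrightarrow> 0 \<le> G k x"
            using F(1) by (auto simp: pos_cover_def G_def case_prod_unfold)
        next
          fix x assume "x \<in> (\<Union>i. A i) \<inter> X"
          then obtain n where "x \<in> A n \<inter> X" by auto
          then have "1 \<le> (\<Sum>i. ennreal (F n i x))" using F(1)[of n] by (auto simp: pos_cover_def)
          also have "\<dots> \<le> (\<Sum>n. \<Sum>i. ennreal (F n i x))"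
            using sum_le_suminf[of "\<lambda>n. \<Sum>i. ennreal (F n i x)" "{n}"] by simp
          finally show "1 \<le> (\<Sum>k. ennreal (G k x))" by (simp add: sG)
        qed
        then have "?O (\<Union>i. A i) \<le> (\<Sum>k. ennreal (\<Lambda> (G k)))" by (rule state_outer_le)
        also have "\<dots> \<le> (\<Sum>n. ?O (A n) + ennreal (e * (1/2) ^ Suc n))"
          unfolding sL using F(2) by (intro suminf_le) auto
        also have "\<dots> = (\<Sum>n. ?O (A n)) + (\<Sum>n. ennreal e * ennreal ((1/2) ^ Suc n))"
          using e by (subst suminf_add[symmetric]) (auto simp flip: ennreal_mult')
        also have "\<dots> = (\<Sum>n. ?O (A n)) + ennreal e"
          unfolding ennreal_suminf_cmult
          by (subst suminf_ennreal_eq[OF zero_le_power power_half_series]) auto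
        finally show "?O (\<Union>i. A i) \<le> (\<Sum>i. ?O (A i)) + ennreal e" .
      qed
    qed
  qed
qed

text \<open>Caratheodory's criterion for cozero sets. The functions \<open>min 1 (k * g)\<close>
  increase to the indicator of \<open>U\<close>. Multiplying a cover of \<open>A\<close> by their
  increments covers \<open>A \<inter> U\<close>, multiplying it by \<open>1 - h n\<close> still
  covers \<open>A - U\<close>, and for each \<open>n\<close> the increments below \<open>n\<close>
  and the factor \<open>1 - h n\<close> together cost exactly as much as the original cover.\<close>

lemma state_outer_split:
  fixes X :: "'a::metric_space set"
    and g :: "'a \<Rightarrow> real"
  assumes L: "\<Lambda> \<in> states X" and g: "continuous_on X g" "\<And>x. x \<in> X \<Longrightarrow> 0 \<le> g x"
  defines "U \<equiv> {x\<in>X. 0 < g x}"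
  shows "state_outer X \<Lambda> (A \<inter> U) + state_outer X \<Lambda> (A - U) \<le> state_outer X \<Lambda> A"
proof -
  let ?O = "state_outer X \<Lambda>"
  have "?O (A \<inter> U) + ?O (A - U) \<le> (\<Sum>i. ennreal (\<Lambda> (F i)))" if F: "F \<in> pos_cover X A" for F
  proof -
    define h where "h k x = min 1 (real k * g x)" for k x
    have hc: "continuous_on X (h k)" for k
      unfolding h_def by (intro continuous_intros g)
    have h01: "0 \<le> h k x" "h k x \<le> 1" if "x \<in> X" for k x
      using g(2)[OF that] by (auto simp: h_def)
    have hmono: "h k x \<le> h (Suc k) x" if "x \<in> X" for k x
      unfolding h_def using g(2)[OF that] by (intro min.mono order_refl mult_right_mono) auto
    have Fc: "continuous_on X (F i)" and F0: "\<And>x. x \<in> X \<Longrightarrow> 0 \<le> F i x" for i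
      using F by (auto simp: pos_cover_def)
    define a where "a k i = ennreal (\<Lambda> (\<lambda>x. F i x * h k x))" for k i
    have lfh: "0 \<le> \<Lambda> (\<lambda>x. F i x * h k x)" for i k
      by (intro state_nonneg[OF L] continuous_intros Fc hc mult_nonneg_nonneg F0 h01)
    have inc: "incseq (\<lambda>k. a k i)" for i
      unfolding a_def by (intro incseq_SucI ennreal_leI state_mono[OF L] continuous_intros Fc hc
          mult_left_mono hmono F0)
    define G where "G k = (case prod_decode k of (i, k) \<Rightarrow> (\<lambda>x. F i x * (h (Suc k) x - h k x)))" for k
    have sG: "(\<Sum>k. ennreal (G k x)) = (\<Sum>i. \<Sum>k. ennreal (F i x * (h (Suc k) x - h k x)))" for x
      using suminf_ennreal_2dimen[of "\<lambda>i. \<Sum>k. ennreal (F i x * (h (Suc k) x - h k x))"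
          "\<lambda>(i, k). ennreal (F i x * (h (Suc k) x - h k x))"]
      by (simp add: G_def case_prod_unfold)
    have tel: "(\<Sum>k<n. F i x * (h (Suc k) x - h k x)) = F i x * h n x" for i n x
      using sum_lessThan_telescope[of "\<lambda>k. h k x" n] by (simp add: sum_distrib_left[symmetric] h_def[of 0])
    have tel_nonneg: "0 \<le> F i x * (h (Suc k) x - h k x)" if "x \<in> X" for i k x
      using F0[OF that] hmono[OF that] by (intro mult_nonneg_nonneg) auto
    have "G \<in> pos_cover X (A \<inter> U)"
      unfolding pos_cover_def mem_Collect_eq
    proof (intro conjI allI ballI)
      fix k show "continuous_on X (G k)"
        unfolding G_def case_prod_unfold by (intro continuous_intros Fc hc)
      show "\<And>x. x \<in> X \<Longrightarrow> 0 \<le> G k x"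
        using tel_nonneg by (auto simp: G_def case_prod_unfold)
    next
      fix x assume x: "x \<in> A \<inter> U \<inter> X"
      then have gx: "0 < g x" by (simp add: U_def)
      obtain n where n: "1 < real n * g x" using reals_Archimedean3[OF gx] by blast
      have "ennreal (F i x) \<le> (\<Sum>k. ennreal (F i x * (h (Suc k) x - h k x)))" for i
      proof -
        have "ennreal (F i x) = ennreal (\<Sum>k<n. F i x * (h (Suc k) x - h k x))"
          using n unfolding tel by (simp add: h_def)
        also have "\<dots> = (\<Sum>k<n. ennreal (F i x * (h (Suc k) x - h k x)))"
          using tel_nonneg x by (subst sum_ennreal) auto
        also have "\<dots> \<le> (\<Sum>k. ennreal (F i x * (h (Suc k) x - h k x)))"
          by (intro sum_le_suminf) auto
        finally show ?thesis .
      qed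
      then have "(\<Sum>i. ennreal (F i x)) \<le> (\<Sum>k. ennreal (G k x))"
        unfolding sG by (intro suminf_le) auto
      moreover have "1 \<le> (\<Sum>i. ennreal (F i x))" using F x by (auto simp: pos_cover_def)
      ultimately show "1 \<le> (\<Sum>k. ennreal (G k x))" by simp
    qed
    then have "?O (A \<inter> U) \<le> (\<Sum>k. ennreal (\<Lambda> (G k)))" by (rule state_outer_le)
    also have "\<dots> = (\<Sum>i. \<Sum>k. ennreal (\<Lambda> (\<lambda>x. F i x * (h (Suc k) x - h k x))))"
      using suminf_ennreal_2dimen[of "\<lambda>i. \<Sum>k. ennreal (\<Lambda> (\<lambda>x. F i x * (h (Suc k) x - h k x)))"
          "\<lambda>(i, k). ennreal (\<Lambda> (\<lambda>x. F i x * (h (Suc k) x - h k x)))"]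
      by (simp add: G_def case_prod_unfold)
    also have "\<dots> = (\<Sum>i. SUP n. a n i)"
    proof (intro arg_cong[where f=suminf] ext)
      fix i
      have "(\<Sum>k<n. ennreal (\<Lambda> (\<lambda>x. F i x * (h (Suc k) x - h k x)))) = a n i" for n
      proof -
        have "(\<Sum>k<n. ennreal (\<Lambda> (\<lambda>x. F i x * (h (Suc k) x - h k x))))
          = ennreal (\<Sum>k<n. \<Lambda> (\<lambda>x. F i x * (h (Suc k) x - h k x)))"
          by (intro sum_ennreal state_nonneg[OF L] continuous_intros Fc hc tel_nonneg)
        also have "(\<Sum>k<n. \<Lambda> (\<lambda>x. F i x * (h (Suc k) x - h k x)))
           = \<Lambda> (\<lambda>x. \<Sum>k<n. F i x * (h (Suc k) x - h k x))"
          by (rule state_sum[OF L, symmetric]) (auto intro!: continuous_intros Fc hc)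
        finally show ?thesis by (simp add: a_def tel)
      qed
      then show "(\<Sum>k. ennreal (\<Lambda> (\<lambda>x. F i x * (h (Suc k) x - h k x)))) = (SUP n. a n i)"
        by (simp add: suminf_eq_SUP)
    qed
    also have "\<dots> = (SUP n. \<Sum>i. a n i)"
      by (rule ennreal_suminf_SUP_eq[OF inc])
    finally have 1: "?O (A \<inter> U) \<le> (SUP n. \<Sum>i. a n i)" .
    have 2: "?O (A - U) + (\<Sum>i. a n i) \<le> (\<Sum>i. ennreal (\<Lambda> (F i)))" for n
    proof -
      have "(\<lambda>i x. F i x * (1 - h n x)) \<in> pos_cover X (A - U)"
        unfolding pos_cover_def mem_Collect_eq
      proof (intro conjI allI ballI)
        fix i show "continuous_on X (\<lambda>x. F i x * (1 - h n x))" by (intro continuous_intros Fc hc)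
        show "\<And>x. x \<in> X \<Longrightarrow> 0 \<le> F i x * (1 - h n x)"
          using F0 h01 by (auto intro: mult_nonneg_nonneg)
      next
        fix x assume x: "x \<in> (A - U) \<inter> X"
        then have "g x = 0" using g(2)[of x] by (auto simp: U_def)
        then show "1 \<le> (\<Sum>i. ennreal (F i x * (1 - h n x)))"
          using x F by (auto simp: pos_cover_def h_def)
      qed
      then have "?O (A - U) \<le> (\<Sum>i. ennreal (\<Lambda> (\<lambda>x. F i x * (1 - h n x))))"
        by (rule state_outer_le)
      then have "?O (A - U) + (\<Sum>i. a n i) \<le> (\<Sum>i. ennreal (\<Lambda> (\<lambda>x. F i x * (1 - h n x)))) + (\<Sum>i. a n i)"
        by (rule add_right_mono)
      also have "\<dots> = (\<Sum>i. ennreal (\<Lambda> (\<lambda>x. F i x * (1 - h n x))) + a n i)"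
        by (rule suminf_add) auto
      also have "\<dots> = (\<Sum>i. ennreal (\<Lambda> (F i)))"
      proof (intro arg_cong[where f=suminf] ext)
        fix i
        have "0 \<le> \<Lambda> (\<lambda>x. F i x * (1 - h n x))"
          using F0 h01 by (intro state_nonneg[OF L] continuous_intros Fc hc) (auto intro: mult_nonneg_nonneg)
        moreover have "\<Lambda> (\<lambda>x. F i x * (1 - h n x)) + \<Lambda> (\<lambda>x. F i x * h n x) = \<Lambda> (F i)"
          by (subst state_add[OF L, symmetric]) (auto intro!: continuous_intros Fc hc simp: algebra_simps)
        ultimately show "ennreal (\<Lambda> (\<lambda>x. F i x * (1 - h n x))) + a n i = ennreal (\<Lambda> (F i))"
          using lfh unfolding a_def by (subst ennreal_plus[symmetric]) auto
      qed
      finally show ?thesis .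
    qed
    have "?O (A \<inter> U) + ?O (A - U) \<le> (SUP n. \<Sum>i. a n i) + ?O (A - U)"
      using 1 by (rule add_right_mono)
    also have "\<dots> = (SUP n. (\<Sum>i. a n i) + ?O (A - U))"
      by (rule ennreal_SUP_add_left[symmetric]) simp
    also have "\<dots> \<le> (\<Sum>i. ennreal (\<Lambda> (F i)))"
      using 2 by (intro SUP_least) (simp add: add.commute)
    finally show ?thesis .
  qed
  then show ?thesis unfolding state_outer_def[of X \<Lambda> A] by (intro INF_greatest)
qed

text \<open>The lower bound is Dini's argument: by compactness some finite partial sum of a cover is
  at least \<open>1 - e\<close> on all of \<open>X\<close>, and finite sums are within reach of
  linearity and monotonicity.\<close>

lemma state_outer_total:
  assumes L: "\<Lambda> \<in> states X" and X: "compact X"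
  shows "state_outer X \<Lambda> X = 1"
proof (rule antisym)
  have "state_outer X \<Lambda> X \<le> ennreal (\<Lambda> (\<lambda>x. 1))"
    by (rule state_outer_le_single[OF L]) auto
  then show "state_outer X \<Lambda> X \<le> 1" using state_const[OF L, of 1] by simp
  show "1 \<le> state_outer X \<Lambda> X"
    unfolding state_outer_def
  proof (rule INF_greatest)
    fix F assume F: "F \<in> pos_cover X X"
    have Fc: "continuous_on X (F i)" and F0: "\<And>x. x \<in> X \<Longrightarrow> 0 \<le> F i x" for i
      using F by (auto simp: pos_cover_def)
    show "1 \<le> (\<Sum>i. ennreal (\<Lambda> (F i)))"
    proof (rule ennreal_le_epsilon)
      fix e :: real assume e: "0 < e"
      define V where "V n = {x\<in>X. 1 - e < (\<Sum>i<n. F i x)}" for n :: nat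
      have "openin (top_of_set X) (V n)" for n
      proof -
        have "V n = X \<inter> (\<lambda>x. \<Sum>i<n. F i x) -` {1 - e<..}" by (auto simp: V_def)
        then show ?thesis
          using continuous_openin_preimage_gen[of X "\<lambda>x. \<Sum>i<n. F i x" "{1 - e<..}"] Fc
          by (simp add: continuous_on_sum)
      qed
      have "X \<subseteq> (\<Union>n. V n)"
      proof
        fix x assume x: "x \<in> X"
        then have "ennreal (1 - e) < (\<Sum>i. ennreal (F i x))"
        proof -
          have "ennreal (1 - e) < 1" using e by simp
          also have "1 \<le> (\<Sum>i. ennreal (F i x))" using F x unfolding pos_cover_def by blast
          finally show ?thesis .
        qed
        then obtain n where "ennreal (1 - e) < (\<Sum>i<n. ennreal (F i x))"
          unfolding suminf_eq_SUP less_SUP_iff by blast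
        then have "1 - e < (\<Sum>i<n. F i x)"
          using x F0 ennreal_leI[of "\<Sum>i<n. F i x" "1 - e"] by (subst (asm) sum_ennreal) (auto simp: not_le[symmetric])
        then show "x \<in> (\<Union>n. V n)" using x by (auto simp: V_def)
      qed
      obtain D where D: "finite D" "X \<subseteq> (\<Union>n\<in>D. V n)"
      proof -
        obtain W where W: "\<And>n. open (W n)" "\<And>n. V n = X \<inter> W n"
          using \<open>\<And>n. openin (top_of_set X) (V n)\<close> unfolding openin_open by metis
        have "X \<subseteq> (\<Union>n. W n)" using \<open>X \<subseteq> (\<Union>n. V n)\<close> W(2) by blast
        then obtain D where D: "finite D" "X \<subseteq> (\<Union>n\<in>D. W n)"
          by (rule compactE_image[OF X W(1)])
        have "X \<subseteq> (\<Union>n\<in>D. V n)" using D(2) W(2) by auto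
        then show ?thesis by (rule that[OF D(1)])
      qed
      obtain m where m: "\<And>n. n \<in> D \<Longrightarrow> n \<le> m" using D(1) Max_ge by blast
      have "1 - e \<le> (\<Sum>i<m. F i x)" if x: "x \<in> X" for x
      proof -
        obtain n where n: "n \<in> D" "x \<in> V n" using D(2) x by auto
        have "(\<Sum>i<n. F i x) \<le> (\<Sum>i<m. F i x)"
          using m[OF n(1)] F0 x by (intro sum_mono2) auto
        then show ?thesis using n(2) by (auto simp: V_def)
      qed
      then have "\<Lambda> (\<lambda>x. 1 - e) \<le> \<Lambda> (\<lambda>x. \<Sum>i<m. F i x)"
        by (intro state_mono[OF L] continuous_intros Fc) auto
      then have "1 - e \<le> (\<Sum>i<m. \<Lambda> (F i))"
        using state_const[OF L, of "1 - e"] state_sum[OF L, of "{..<m}" F] Fc by simp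
      then have "1 \<le> ennreal ((\<Sum>i<m. \<Lambda> (F i)) + e)" by (subst ennreal_ge_1) linarith
      also have "\<dots> = (\<Sum>i<m. ennreal (\<Lambda> (F i))) + ennreal e"
        using e state_nonneg[OF L Fc F0] by (subst ennreal_plus) (auto simp: sum_nonneg sum_ennreal)
      also have "\<dots> \<le> (\<Sum>i. ennreal (\<Lambda> (F i))) + ennreal e"
        by (intro add_right_mono sum_le_suminf) auto
      finally show "1 \<le> (\<Sum>i. ennreal (\<Lambda> (F i))) + ennreal e" .
    qed
  qed
qed

lemma state_Riesz:
  fixes X :: "'a::metric_space set"
  assumes L: "\<Lambda> \<in> states X" and X: "compact X"
  shows "\<exists>M. prob_space M \<and> sets M = sets (restrict_space borel X) \<and>
           (\<forall>f. continuous_on X f \<longrightarrow> integral\<^sup>L M f = \<Lambda> f)"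
proof -
  let ?O = "state_outer X \<Lambda>"
  interpret P: sigma_algebra X "Pow X" by (rule sigma_algebra_Pow)
  let ?L = "lambda_system X (Pow X) ?O"
  have ms: "measure_space X ?L ?O"
    by (rule P.caratheodory_lemma[OF state_outer_space[OF L]])
  then have sa: "sigma_algebra X ?L" by (simp add: measure_space_def)
  have open_in: "{x\<in>X. 0 < g x} \<in> ?L" if g: "continuous_on X g" "\<And>x. x \<in> X \<Longrightarrow> 0 \<le> g x" for g :: "'a \<Rightarrow> real"
    unfolding P.lambda_system_eq mem_Collect_eq
  proof (intro conjI ballI antisym)
    let ?U = "{x\<in>X. 0 < g x}"
    fix A assume A: "A \<in> Pow X"
    show "?O (A \<inter> ?U) + ?O (A - ?U) \<le> ?O A" by (rule state_outer_split[OF L g])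
    have "subadditive (Pow X) ?O"
      using state_outer_space[OF L] by (intro P.countably_subadditive_subadditive)
        (auto simp: outer_measure_space_def)
    moreover have "A \<inter> ?U \<union> (A - ?U) = A" by blast
    ultimately show "?O A \<le> ?O (A \<inter> ?U) + ?O (A - ?U)"
      using A subadditiveD[of "Pow X" ?O "A \<inter> ?U" "A - ?U"] by auto
  qed auto
  have sub: "sets (restrict_space borel X) \<subseteq> ?L"
  proof -
    have "sigma_sets X ((\<inter>) X ` {S. open S}) \<subseteq> ?L"
    proof (rule sigma_algebra.sigma_sets_subset[OF sa], rule subsetI)
      fix A assume "A \<in> (\<inter>) X ` {S. open S}"
      then obtain S where S: "open S" "A = X \<inter> S" by auto
      \<comment> \<open>A relatively open set is the cozero set of the distance to its complement.
        The whole space is separate because \<open>infdist x {}\<close> is 0.\<close>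
      show "A \<in> ?L"
      proof (cases "S = UNIV")
        case True
        then show ?thesis using S(2) open_in[of "\<lambda>x. 1"] by simp
      next
        case False
        then have "A = {x\<in>X. 0 < infdist x (- S)}"
          using S in_closed_iff_infdist_zero[of "- S"] infdist_nonneg
          by (auto simp: less_le closed_def)
        then show ?thesis using open_in[of "\<lambda>x. infdist x (- S)"]
          by (simp add: infdist_nonneg continuous_intros)
      qed
    qed
    moreover have "sets (restrict_space borel X) = sigma_sets X ((\<inter>) X ` {S. open S})"
      using sigma_sets_Int[of X UNIV "{S. open S}"] borel_compact[OF X]
      by (simp add: sets_restrict_space borel_def)
    ultimately show ?thesis by simp
  qed
  define M where "M = measure_of X (sets (restrict_space borel X)) ?O"
  have spX: "space (restrict_space borel X) = X" by (simp add: space_restrict_space)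
  have sM: "sets M = sets (restrict_space borel X)"
    unfolding M_def using sets.sigma_sets_eq[of "restrict_space borel X"] sets.space_closed[of "restrict_space borel X"]
    by (simp add: spX)
  have spM: "space M = X" using sets_eq_imp_space_eq[OF sM] spX by simp
  have eM: "emeasure M A = ?O A" if "A \<in> sets M" for A
    unfolding M_def
  proof (rule emeasure_measure_of_sigma)
    show "sigma_algebra X (sets (restrict_space borel X))"
      using sets.sigma_algebra_axioms[of "restrict_space borel X"] by (simp add: spX)
    show "positive (sets (restrict_space borel X)) ?O"
      using ms by (auto simp: measure_space_def positive_def)
    show "countably_additive (sets (restrict_space borel X)) ?O"
      using ms sub unfolding measure_space_def countably_additive_def by (meson subset_trans subsetD)
    show "A \<in> sets (restrict_space borel X)" using that sM by simp
  qed
  have "emeasure M (space M) = 1"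
    using eM[of X] spM sets.top[of M] state_outer_total[OF L X] by simp
  then have pM: "prob_space M" by (rule prob_spaceI)
  interpret prob_space M by (rule pM)
  have meas: "f \<in> borel_measurable M" if "continuous_on X f" for f :: "'a \<Rightarrow> real"
    using borel_measurable_continuous_on_restrict[OF that] measurable_cong_sets[OF sM refl] by blast
  have int: "integrable M f" if f: "continuous_on X f" for f :: "'a \<Rightarrow> real"
  proof -
    obtain B where "\<And>x. x \<in> X \<Longrightarrow> norm (f x) \<le> B"
      using compact_imp_bounded[OF compact_continuous_image[OF f X]] by (auto simp: bounded_iff)
    then show ?thesis by (intro integrable_const_bound[where B=B] meas f AE_I2) (simp add: spM)
  qed
  \<comment> \<open>Layer cake with \<open>n\<close> levels: \<open>F k\<close> is a level set of
    \<open>f\<close>, and \<open>c k\<close> is a continuous ramp that equals 1 on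
    \<open>F k\<close>. The ramps add up to \<open>n * f\<close>, so the measures of the level sets
    are bounded through \<open>\<Lambda>\<close>. The opposite inequality follows from this one
    applied to \<open>1 - f\<close>.\<close>
  have upper: "integral\<^sup>L M f \<le> \<Lambda> f"
    if f: "continuous_on X f" and f01: "\<And>x. x \<in> X \<Longrightarrow> 0 \<le> f x \<and> f x \<le> 1" for f :: "'a \<Rightarrow> real"
  proof (rule field_le_epsilon)
    fix e :: real assume "0 < e"
    then obtain n :: nat where n: "0 < n" "1 / real n < e"
      by (metis nat_approx_posE of_nat_0_less_iff zero_less_Suc)
    define F where "F k = {x\<in>X. real (Suc k) / n \<le> f x}" for k
    define c where "c k x = max 0 (min 1 (n * f x - real k))" for k x
    have cc: "continuous_on X (c k)" for k unfolding c_def by (intro continuous_intros f)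
    have Fs: "F k \<in> sets M" for k
      using measurable_sets[OF meas[OF f], of "{real (Suc k) / n..}"]
      by (simp add: F_def vimage_def spM Int_def conj_commute)
    have "measure M (F k) \<le> \<Lambda> (c k)" for k
    proof -
      have "emeasure M (F k) \<le> ennreal (\<Lambda> (c k))"
        unfolding eM[OF Fs] using n(1)
        by (intro state_outer_le_single[OF L cc]) (auto simp: c_def F_def field_simps)
      then show ?thesis
        using state_nonneg[OF L cc[of k]] by (simp add: c_def emeasure_eq_measure)
    qed
    have csum: "(\<Sum>k<m. c k x) = min (real m) (n * f x)" if "x \<in> X" for x m
      using f01[OF that] by (induction m) (auto simp: c_def min_def max_def)
    have fle: "f x \<le> 1 / n + (\<Sum>k<n. indicator (F k) x / n)" if x: "x \<in> X" for x
    proof -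
      have "c k x \<le> indicator (F (k - 1)) x" if "0 < k" for k
        using that x n(1) by (auto simp: c_def F_def indicator_def field_simps)
      then have "(\<Sum>k<n. c (Suc k) x) \<le> (\<Sum>k<n. indicator (F k) x)"
        by (intro sum_mono) (metis diff_Suc_1 zero_less_Suc)
      moreover have "(\<Sum>k<Suc n. c k x) = c 0 x + (\<Sum>k<n. c (Suc k) x)"
        by (rule sum.lessThan_Suc_shift)
      moreover have "c 0 x \<le> 1" by (simp add: c_def)
      moreover have "(\<Sum>k<Suc n. c k x) = n * f x"
      proof -
        have "n * f x \<le> real n" using f01[OF x] mult_left_mono[of "f x" 1 "real n"] by simp
        then show ?thesis unfolding csum[OF x] by simp
      qed
      ultimately have "n * f x \<le> 1 + (\<Sum>k<n. indicator (F k) x)" by linarith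
      then show ?thesis using n(1) by (simp add: field_simps sum_divide_distrib[symmetric])
    qed
    have "integral\<^sup>L M f \<le> integral\<^sup>L M (\<lambda>x. 1 / n + (\<Sum>k<n. indicator (F k) x / n))"
      using fle Fs by (intro integral_mono int f Bochner_Integration.integrable_add
         Bochner_Integration.integrable_sum integrable_divide integrable_real_indicator) (auto simp: spM less_top[symmetric])
    also have "\<dots> = 1 / n + (\<Sum>k<n. measure M (F k) / n)"
    proof -
      have i: "integrable M (\<lambda>x. indicator (F k) x / real n)" for k
        using Fs by (intro integrable_divide integrable_real_indicator) (auto simp: less_top[symmetric])
      have "(\<integral>x. indicator (F k) x / real n \<partial>M) = measure M (F k) / n" for k
        using sets.sets_into_space[OF Fs[of k]] by (simp add: Int_absorb2)
      then show ?thesis using i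
        by (subst Bochner_Integration.integral_add)
          (auto simp: Bochner_Integration.integral_sum prob_space simp del: integral_divide integral_divide_zero)
    qed
    also have "\<dots> \<le> 1 / n + (\<Sum>k<n. \<Lambda> (c k) / n)"
      using \<open>\<And>k. measure M (F k) \<le> \<Lambda> (c k)\<close> by (intro add_left_mono sum_mono divide_right_mono) auto
    also have "(\<Sum>k<n. \<Lambda> (c k) / n) = \<Lambda> (\<lambda>x. \<Sum>k<n. c k x) / n"
      by (simp add: state_sum[OF L] cc sum_divide_distrib)
    also have "\<dots> \<le> \<Lambda> (\<lambda>x. n * f x) / n"
      by (intro divide_right_mono state_mono[OF L] continuous_intros cc f) (auto simp: csum)
    also have "\<Lambda> (\<lambda>x. n * f x) = n * \<Lambda> f" by (rule state_cmult[OF L f])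
    finally have "integral\<^sup>L M f \<le> 1 / n + \<Lambda> f" using n(1) by simp
    then show "integral\<^sup>L M f \<le> \<Lambda> f + e" using n(2) by linarith
  qed
  have eq01: "integral\<^sup>L M f = \<Lambda> f"
    if f: "continuous_on X f" and f01: "\<And>x. x \<in> X \<Longrightarrow> 0 \<le> f x \<and> f x \<le> 1" for f :: "'a \<Rightarrow> real"
  proof (rule antisym[OF upper[OF that]])
    have "integral\<^sup>L M (\<lambda>x. 1 - f x) \<le> \<Lambda> (\<lambda>x. 1 - f x)"
      using f01 by (intro upper continuous_intros f) (auto simp: algebra_simps)
    then show "\<Lambda> f \<le> integral\<^sup>L M f"
      using int[OF f] state_diff[OF L, of "\<lambda>x. 1" f] f state_const[OF L, of 1]
      by (simp add: prob_space)
  qed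
  have "integral\<^sup>L M f = \<Lambda> f" if f: "continuous_on X f" for f
  proof -
    obtain B where B: "\<And>x. x \<in> X \<Longrightarrow> norm (f x) \<le> B" "0 < B"
      using compact_imp_bounded[OF compact_continuous_image[OF f X]] by (auto simp: bounded_pos)
    define g where "g x = (f x + B) / (2 * B)" for x
    have gc: "continuous_on X g" unfolding g_def using B(2) by (intro continuous_intros f) auto
    have fg: "f = (\<lambda>x. 2 * B * g x - B)" using B(2) by (auto simp: g_def)
    have "integral\<^sup>L M g = \<Lambda> g"
    proof (intro eq01 gc)
      fix x assume "x \<in> X"
      then have "- B \<le> f x" "f x \<le> B" using B(1)[of x] by auto
      then show "0 \<le> g x \<and> g x \<le> 1" using B(2) by (auto simp: g_def field_simps)
    qed
    moreover have "integral\<^sup>L M f = 2 * B * integral\<^sup>L M g - B"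
      unfolding fg using int[OF gc] by (simp add: prob_space)
    moreover have "\<Lambda> f = 2 * B * \<Lambda> g - B"
      unfolding fg by (subst state_diff[OF L])
        (auto intro!: continuous_intros gc simp: state_cmult[OF L gc] state_const[OF L])
    ultimately show ?thesis by simp
  qed
  then show ?thesis using pM sM by blast
qed

text \<open>The indicator of a closed set is a bounded pointwise limit of the continuous functions
  \<open>max 0 (1 - k * infdist x C)\<close>, and the closed sets form an intersection-stable
  generator.\<close>

lemma prob_eq_if_integrals_eq:
  fixes X :: "'a::metric_space set"
  assumes X: "compact X" and M: "prob_space M" "sets M = sets (restrict_space borel X)"
    and N: "prob_space N" "sets N = sets (restrict_space borel X)"
    and eq: "\<And>f::'a \<Rightarrow> real. continuous_on X f \<Longrightarrow> integral\<^sup>L M f = integral\<^sup>L N f"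
  shows "M = N"
proof -
  interpret M: prob_space M by fact
  interpret N: prob_space N by fact
  have spM: "space M = X" and spN: "space N = X"
    using sets_eq_imp_space_eq[OF M(2)] sets_eq_imp_space_eq[OF N(2)] by (auto simp: space_restrict_space)
  have closed_eq: "measure M (X \<inter> C) = measure N (X \<inter> C)" if C: "closed C" for C
  proof (cases "C = {}")
    case False
    define f where "f k x = max 0 (1 - real k * infdist x C)" for k x
    have fc: "continuous_on X (f k)" for k
      unfolding f_def by (intro continuous_intros)
    have lim: "(\<lambda>k. f k x) \<longlonglongrightarrow> indicator (X \<inter> C) x" if "x \<in> X" for x
    proof (cases "x \<in> C")
      case True
      then show ?thesis using that by (simp add: f_def)
    next
      case False
      then have "0 < infdist x C"
        using C \<open>C \<noteq> {}\<close> in_closed_iff_infdist_zero[of C x] infdist_nonneg[of x C] by (auto simp: less_le)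
      then obtain m where m: "1 < real m * infdist x C" using reals_Archimedean3 by blast
      have "f k x = 0" if "m \<le> k" for k
        using m mult_right_mono[of "real m" "real k" "infdist x C"] that infdist_nonneg[of x C]
        by (simp add: f_def)
      then have "eventually (\<lambda>k. f k x = indicator (X \<inter> C) x) sequentially"
        using False by (auto simp: eventually_sequentially)
      then show ?thesis by (rule tendsto_eventually)
    qed
    have key: "(\<lambda>k. integral\<^sup>L Q (f k)) \<longlonglongrightarrow> measure Q (X \<inter> C)"
      if Q: "prob_space Q" "sets Q = sets (restrict_space borel X)" "space Q = X" for Q
    proof -
      interpret Q: prob_space Q by fact
      have XC: "X \<inter> C \<in> sets Q" unfolding Q(2) sets_restrict_space using C by auto
      have fm: "f k \<in> borel_measurable Q" for k
        using borel_measurable_continuous_on_restrict[OF fc] measurable_cong_sets[OF Q(2) refl] by blast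
      have "(\<lambda>k. integral\<^sup>L Q (f k)) \<longlonglongrightarrow> integral\<^sup>L Q (indicator (X \<inter> C) :: 'a \<Rightarrow> real)"
      proof (rule integral_dominated_convergence[where w="\<lambda>x. 1"])
        show "AE x in Q. (\<lambda>k. f k x) \<longlonglongrightarrow> indicator (X \<inter> C) x" using lim Q(3) by (intro AE_I2) auto
        show "AE x in Q. norm (f k x) \<le> 1" for k
          by (intro AE_I2) (auto simp: f_def infdist_nonneg)
      qed (use fm XC in auto)
      then show ?thesis using XC Q(3) by (simp add: Int_absorb2)
    qed
    show ?thesis
      using key[OF M spM] key[OF N spN] eq[OF fc] LIMSEQ_unique by simp
  qed simp
  have gen: "sets (restrict_space borel X) = sigma_sets X ((\<inter>) X ` {C. closed C})"
    using sigma_sets_Int[of X UNIV "{C. closed C}"] borel_compact[OF X]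
    by (simp add: sets_restrict_space borel_eq_closed)
  show ?thesis
  proof (rule measure_eqI_generator_eq[where E="(\<inter>) X ` {C. closed C}" and \<Omega>=X and A="\<lambda>_. X"])
    show "Int_stable ((\<inter>) X ` {C. closed C})"
      unfolding Int_stable_def
    proof safe
      fix C D :: "'a set" assume "closed C" "closed D"
      then show "X \<inter> C \<inter> (X \<inter> D) \<in> (\<inter>) X ` {C. closed C}"
        by (intro image_eqI[of _ _ "C \<inter> D"]) auto
    qed
    show "\<And>A. A \<in> (\<inter>) X ` {C. closed C} \<Longrightarrow> emeasure M A = emeasure N A"
      using closed_eq by (auto simp: M.emeasure_eq_measure N.emeasure_eq_measure)
    show "range (\<lambda>_. X) \<subseteq> (\<inter>) X ` {C. closed C}" by auto
  qed (use M(2) N(2) gen in \<open>auto simp: M.emeasure_eq_measure\<close>)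
qed

section \<open>Compactness of the state space and extreme points\<close>

lemma closed_states:
  fixes X :: "'a::metric_space set"
  shows "closed (states X)"
proof -
  have ev: "continuous_on UNIV (\<lambda>\<Lambda>::('a \<Rightarrow> real) \<Rightarrow> real. \<Lambda> f)" for f
    by (rule continuous_on_product_coordinates)
  have "states X =
    (\<Inter>f\<in>{f. continuous_on X f}. \<Inter>g\<in>{g. continuous_on X g}. {\<Lambda>. \<Lambda> (\<lambda>x. f x + g x) = \<Lambda> f + \<Lambda> g}) \<inter>
    (\<Inter>c. \<Inter>f\<in>{f. continuous_on X f}. {\<Lambda>. \<Lambda> (\<lambda>x. c * f x) = c * \<Lambda> f}) \<inter>
    (\<Inter>f\<in>{f. continuous_on X f \<and> (\<forall>x\<in>X. 0 \<le> f x)}. {\<Lambda>. 0 \<le> \<Lambda> f}) \<inter>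
    {\<Lambda>. \<Lambda> (\<lambda>x. 1) = 1} \<inter> (\<Inter>f\<in>{f. \<not> continuous_on X f}. {\<Lambda>. \<Lambda> f = 0})"
    unfolding states_def by (intro set_eqI) (simp; blast)
  also have "closed \<dots>"
    by (intro closed_Int closed_INT ballI closed_Collect_eq closed_Collect_le
        continuous_intros ev)
  finally show ?thesis .
qed

text \<open>Tychonoff's theorem: each coordinate of a state is bounded by the supremum norm of the
  function. The convention that states vanish on discontinuous functions bounds the remaining
  coordinates and makes a functional on \<open>C(X)\<close> a single point of the product.\<close>

lemma compact_states:
  fixes X :: "'a::metric_space set"
  assumes X: "compact X"
  shows "compact (states X)"
proof -
  have "\<exists>B. \<forall>x\<in>X. \<bar>f x\<bar> \<le> B" if "continuous_on X f" for f :: "'a \<Rightarrow> real"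
    using compact_imp_bounded[OF compact_continuous_image[OF that X]] by (auto simp: bounded_iff)
  then obtain B :: "('a \<Rightarrow> real) \<Rightarrow> real" where B: "\<And>f x. continuous_on X f \<Longrightarrow> x \<in> X \<Longrightarrow> \<bar>f x\<bar> \<le> B f" by metis
  define K where "K = PiE UNIV (\<lambda>f. {- \<bar>B f\<bar>..\<bar>B f\<bar>})"
  have "compactin (product_topology (\<lambda>i::'a \<Rightarrow> real. euclidean) UNIV) K"
    unfolding K_def by (subst compactin_PiE) (auto simp: compactin_euclidean_iff)
  then have "compact K"
    by (simp add: euclidean_product_topology compactin_euclidean_iff)
  moreover have "states X \<subseteq> K"
  proof
    fix \<Lambda> assume L: "\<Lambda> \<in> states X"
    have "\<bar>\<Lambda> f\<bar> \<le> \<bar>B f\<bar>" for f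
    proof (cases "continuous_on X f")
      case True
      then show ?thesis
        using B[OF True] by (intro state_bound[OF L True]) force
    next
      case False
      then show ?thesis using L by (simp add: states_def)
    qed
    then show "\<Lambda> \<in> K" by (auto simp: K_def PiE_iff abs_le_iff) (metis minus_le_iff)
  qed
  ultimately show ?thesis using compact_Int_closed[of K "states X", OF _ closed_states] by (simp add: Int_absorb1)
qed

text \<open>A cluster point of the sequence in the product topology suffices: an inequality on one
  coordinate that holds eventually up to every \<open>e\<close> passes to it. Equalities needed
  later, such as invariance, are obtained as two inequalities of this form.\<close>

lemma compact_fun_cluster:
  fixes S :: "('b \<Rightarrow> real) set" and \<Lambda>s :: "nat \<Rightarrow> 'b \<Rightarrow> real"
  assumes "compact S" and "\<And>n. \<Lambda>s n \<in> S"
  shows "\<exists>\<Lambda>\<in>S. \<forall>f c. (\<forall>e>0. \<forall>\<^sub>F n in sequentially. c - e \<le> \<Lambda>s n f) \<longrightarrow> c \<le> \<Lambda> f"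
proof -
  let ?F = "filtermap \<Lambda>s sequentially"
  have "?F \<noteq> bot" "eventually (\<lambda>x. x \<in> S) ?F"
    using assms(2) by (auto simp: filtermap_bot_iff eventually_filtermap)
  then obtain \<Lambda> where \<Lambda>: "\<Lambda> \<in> S" "inf (nhds \<Lambda>) ?F \<noteq> bot"
    using assms(1) unfolding compact_filter by blast
  have "c \<le> \<Lambda> f" if "\<forall>e>0. \<forall>\<^sub>F n in sequentially. c - e \<le> \<Lambda>s n f" for f c
  proof (rule ccontr)
    assume "\<not> c \<le> \<Lambda> f"
    define e where "e = (c - \<Lambda> f) / 2"
    have e: "e > 0" "\<Lambda> f < c - e" using \<open>\<not> c \<le> \<Lambda> f\<close> by (auto simp: e_def field_simps)
    have "open {\<Lambda>'::'b \<Rightarrow> real. \<Lambda>' f < c - e}"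
      by (intro open_Collect_less continuous_on_product_coordinates continuous_intros)
    then have "eventually (\<lambda>\<Lambda>'. \<Lambda>' f < c - e) (nhds \<Lambda>)"
      using e(2) eventually_nhds[of "\<lambda>\<Lambda>'. \<Lambda>' f < c - e"] by blast
    moreover have "eventually (\<lambda>\<Lambda>'. c - e \<le> \<Lambda>' f) ?F"
      using that e(1) by (simp add: eventually_filtermap)
    ultimately have "eventually (\<lambda>_. False) (inf (nhds \<Lambda>) ?F)"
      unfolding eventually_inf by (intro exI[of _ "\<lambda>\<Lambda>'. \<Lambda>' f < c - e"] exI[of _ "\<lambda>\<Lambda>'. c - e \<le> \<Lambda>' f"]) auto
    then show False using \<Lambda>(2) by (simp add: trivial_limit_def)
  qed
  then show ?thesis using \<Lambda>(1) by blast
qed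

text \<open>The face condition relative to \<open>K\<close>. For \<open>\<Lambda> \<in> K\<close>
  and the set \<open>{\<Lambda>}\<close> it says that \<open>\<Lambda>\<close> is an extreme point
  of \<open>K\<close>.\<close>

definition extremal_in :: "('b \<Rightarrow> real) set \<Rightarrow> ('b \<Rightarrow> real) set \<Rightarrow> bool" where
  "extremal_in K A \<longleftrightarrow> (\<forall>\<Lambda>1\<in>K. \<forall>\<Lambda>2\<in>K. \<forall>a. 0 < a \<longrightarrow> a < 1 \<longrightarrow>
     (\<lambda>f. a * \<Lambda>1 f + (1 - a) * \<Lambda>2 f) \<in> A \<longrightarrow> \<Lambda>1 \<in> A \<and> \<Lambda>2 \<in> A)"

text \<open>The argument of Krein and Milman: a minimal closed extremal subset exists by Zorn's
  lemma and compactness, and it is a point because evaluations cannot vary on it.\<close>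

lemma extremal_singleton_exists:
  fixes S K :: "('b \<Rightarrow> real) set"
  assumes S: "compact S" "S \<noteq> {}" "closed S" and ext: "extremal_in K S"
  shows "\<exists>\<Lambda>\<in>S. extremal_in K {\<Lambda>}"
proof -
  define F where "F = {A. A \<subseteq> S \<and> A \<noteq> {} \<and> closed A \<and> extremal_in K A}"
  have SF: "S \<in> F" using S ext by (simp add: F_def)
  \<comment> \<open>Passing to complements turns a minimal closed extremal set into a maximal
    element; the bound of a chain is then the complement of an intersection, nonempty by the finite
    intersection property.\<close>
  have "\<exists>M\<in>uminus ` F. \<forall>A\<in>uminus ` F. M \<subseteq> A \<longrightarrow> A = M"
  proof (rule subset_Zorn_nonempty)
    show "uminus ` F \<noteq> {}" using SF by auto
  next
    fix \<C> assume ne: "\<C> \<noteq> {}" and chain: "subset.chain (uminus ` F) \<C>"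
    define D where "D = uminus ` \<C>"
    have DF: "D \<subseteq> F"
    proof
      fix A assume "A \<in> D"
      then obtain C where "C \<in> \<C>" "A = - C" by (auto simp: D_def)
      moreover have "\<C> \<subseteq> uminus ` F" using chain by (simp add: subset.chain_def)
      ultimately show "A \<in> F" by auto
    qed
    have lin: "A \<subseteq> B \<or> B \<subseteq> A" if "A \<in> D" "B \<in> D" for A B
      using that chain unfolding D_def subset.chain_def subset_chain_def by (auto simp: less_le) blast+
    have Dne: "D \<noteq> {}" using ne by (simp add: D_def)
    have fin: "\<Inter>G \<in> D" if "finite G" "G \<noteq> {}" "G \<subseteq> D" for G
      using that
    proof (induction G rule: finite_ne_induct)
      case (insert A G)
      then have "\<Inter>G \<in> D" "A \<in> D" by auto
      with lin[OF this] show ?case by (auto simp: Int_absorb1 Int_absorb2)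
    qed auto
    have "S \<inter> \<Inter>D \<noteq> {}"
    proof (rule compact_imp_fip[OF S(1)])
      show "\<And>T. T \<in> D \<Longrightarrow> closed T" using DF by (auto simp: F_def)
      fix G assume G: "finite G" "G \<subseteq> D"
      show "S \<inter> \<Inter>G \<noteq> {}"
      proof (cases "G = {}")
        case False
        then have "\<Inter>G \<in> F" using fin G DF by blast
        then show ?thesis by (auto simp: F_def)
      qed (use S in auto)
    qed
    moreover have "\<Inter>D \<subseteq> S" using Dne DF by (auto simp: F_def)
    moreover have "closed (\<Inter>D)" using DF by (auto simp: F_def)
    moreover have "extremal_in K (\<Inter>D)"
      using DF unfolding F_def extremal_in_def by (auto; blast)
    ultimately have "\<Inter>D \<in> F" by (auto simp: F_def)
    moreover have "\<Union>\<C> = - \<Inter>D" by (auto simp: D_def)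
    ultimately show "\<Union>\<C> \<in> uminus ` F" by auto
  qed
  then obtain A where A: "A \<in> F" and min: "\<And>B. B \<in> F \<Longrightarrow> B \<subseteq> A \<Longrightarrow> B = A"
    by auto
  have cA: "compact A"
    using A S(1) compact_Int_closed[of S A] by (auto simp: F_def Int_absorb1)
  have const: "\<Lambda> f = \<Lambda>' f" if "\<Lambda> \<in> A" "\<Lambda>' \<in> A" for \<Lambda> \<Lambda>' f
  proof -
    have cev: "continuous_on A (\<lambda>\<Lambda>::'b \<Rightarrow> real. \<Lambda> f)"
      by (rule continuous_on_subset[OF continuous_on_product_coordinates]) simp
    obtain m where m: "m \<in> A" "\<And>\<Lambda>. \<Lambda> \<in> A \<Longrightarrow> \<Lambda> f \<le> m f"
      using continuous_attains_sup[OF cA _ cev] A by (auto simp: F_def)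
    \<comment> \<open>The face of \<open>A\<close> on which evaluation at \<open>f\<close> attains
      its maximum is again closed and extremal. Minimality forces \<open>B = A\<close>, so the
      evaluation is constant on \<open>A\<close>.\<close>
    define B where "B = A \<inter> {\<Lambda>. m f \<le> \<Lambda> f}"
    have "closed B"
      unfolding B_def using A
      by (intro closed_Int closed_Collect_le continuous_on_product_coordinates continuous_intros) (auto simp: F_def)
    moreover have "extremal_in K B"
      unfolding extremal_in_def
    proof (intro ballI allI impI)
      fix \<Lambda>1 \<Lambda>2 a assume *: "\<Lambda>1 \<in> K" "\<Lambda>2 \<in> K" "0 < a" "a < (1::real)"
        "(\<lambda>f. a * \<Lambda>1 f + (1 - a) * \<Lambda>2 f) \<in> B"
      then have A12: "\<Lambda>1 \<in> A" "\<Lambda>2 \<in> A"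
        using A unfolding F_def extremal_in_def B_def by blast+
      have le: "\<Lambda>1 f \<le> m f" "\<Lambda>2 f \<le> m f" using m(2) A12 by auto
      have ge: "m f \<le> a * \<Lambda>1 f + (1 - a) * \<Lambda>2 f" using *(5) by (simp add: B_def)
      have "a * \<Lambda>1 f \<le> a * m f" "(1 - a) * \<Lambda>2 f \<le> (1 - a) * m f"
        using le *(3,4) by (auto intro!: mult_left_mono)
      moreover have "a * m f + (1 - a) * m f = m f" by (simp add: algebra_simps)
      ultimately have "a * \<Lambda>1 f = a * m f" "(1 - a) * \<Lambda>2 f = (1 - a) * m f" using ge by linarith+
      then show "\<Lambda>1 \<in> B \<and> \<Lambda>2 \<in> B" using A12 *(3,4) by (simp add: B_def)
    qed
    moreover have "m \<in> B" "B \<subseteq> S" using A m(1) by (auto simp: F_def B_def)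
    ultimately have "B \<in> F" unfolding F_def by blast
    then have "B = A" by (rule min) (auto simp: B_def)
    then show ?thesis using that m(2) unfolding B_def by (metis (mono_tags, lifting) Int_iff antisym mem_Collect_eq)
  qed
  obtain \<Lambda> where "\<Lambda> \<in> A" using A by (auto simp: F_def)
  then have "A = {\<Lambda>}" using const by (auto intro!: ext)
  then show ?thesis using A by (auto simp: F_def)
qed

section \<open>Codes\<close>

locale compact_flow =
  fixes X :: "'a::metric_space set" and phi :: "'a \<Rightarrow> real \<Rightarrow> 'a"
  assumes compact_X: "compact X" and X_nonempty: "X \<noteq> {}" and flow: "is_flow X phi"
begin

lemma phi_in: "x \<in> X \<Longrightarrow> phi x t \<in> X"
  using flow by (auto simp: is_flow_def)

lemma phi_0 [simp]: "x \<in> X \<Longrightarrow> phi x 0 = x"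
  using flow by (auto simp: is_flow_def)

lemma phi_phi: "x \<in> X \<Longrightarrow> phi (phi x s) t = phi x (t + s)"
  using flow by (auto simp: is_flow_def)

lemma continuous_on_flow: "continuous_on (X \<times> UNIV) (\<lambda>(x, t). phi x t)"
  using flow by (auto simp: is_flow_def)

lemma continuous_phi: "continuous_on X (\<lambda>x. phi x t)"
proof -
  have "continuous_on X ((\<lambda>(x, t). phi x t) \<circ> (\<lambda>x. (x, t)))"
    by (intro continuous_on_compose continuous_on_subset[OF continuous_on_flow] continuous_intros) auto
  then show ?thesis by (simp add: comp_def)
qed

lemma continuous_phi_time: "x \<in> X \<Longrightarrow> continuous_on S (phi x)"
proof -
  assume "x \<in> X"
  then have "continuous_on S ((\<lambda>(x, t). phi x t) \<circ> (\<lambda>t. (x, t)))"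
    by (intro continuous_on_compose continuous_on_subset[OF continuous_on_flow] continuous_intros) auto
  then show ?thesis by (simp add: comp_def)
qed

lemma continuous_comp_phi:
  assumes "continuous_on X f" shows "continuous_on X (\<lambda>x. f (phi x t))"
  by (rule continuous_on_compose2[OF assms continuous_phi]) (auto simp: phi_in)

definition bump :: "real \<Rightarrow> real \<Rightarrow> real" where
  "bump \<epsilon> r = max 0 (min 1 (2 - r / \<epsilon>))"

text \<open>For \<open>\<epsilon> > 0\<close> a continuous stand-in for the indicator of a Bowen
  ball: each factor is 1 up to distance \<open>\<epsilon>\<close> and 0 from
  \<open>2 * \<epsilon>\<close> on. The centres \<open>w j\<close> need not form an orbit, so words
  can be concatenated freely.\<close>

definition word :: "real \<Rightarrow> nat \<Rightarrow> (nat \<Rightarrow> 'a) \<Rightarrow> 'a \<Rightarrow> real" where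
  "word \<epsilon> n w x = (\<Prod>j<n. bump \<epsilon> (dist (phi x (real j)) (w j)))"

text \<open>The convex hull of the words. Functions that agree on \<open>X\<close> are identified
  because the flow identities behind concatenation hold only there.\<close>

inductive code :: "real \<Rightarrow> nat \<Rightarrow> ('a \<Rightarrow> real) \<Rightarrow> bool" for \<epsilon> :: real and n :: nat where
  code_word: "code \<epsilon> n (word \<epsilon> n w)"
| code_mix: "code \<epsilon> n g \<Longrightarrow> code \<epsilon> n h \<Longrightarrow> 0 \<le> a \<Longrightarrow> a \<le> 1 \<Longrightarrow>
     code \<epsilon> n (\<lambda>x. a * g x + (1 - a) * h x)"
| code_cong: "code \<epsilon> n g \<Longrightarrow> (\<And>x. x \<in> X \<Longrightarrow> h x = g x) \<Longrightarrow> code \<epsilon> n h"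

text \<open>Strict positivity makes \<open>- ln (g x)\<close> continuous, so that a state can be
  evaluated on it.\<close>

definition pcode :: "real \<Rightarrow> nat \<Rightarrow> ('a \<Rightarrow> real) \<Rightarrow> bool" where
  "pcode \<epsilon> n g \<longleftrightarrow> code \<epsilon> n g \<and> (\<forall>x\<in>X. 0 < g x)"

lemma bump_01: "0 \<le> bump \<epsilon> r" "bump \<epsilon> r \<le> 1"
  by (auto simp: bump_def)

lemma word_01: "0 \<le> word \<epsilon> n w x" "word \<epsilon> n w x \<le> 1"
  unfolding word_def by (auto intro!: prod_nonneg prod_le_1 simp: bump_01)

lemma continuous_word: "0 < \<epsilon> \<Longrightarrow> continuous_on X (word \<epsilon> n w)"
  unfolding word_def bump_def by (intro continuous_intros continuous_phi) auto

lemma continuous_code: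
  assumes "code \<epsilon> n g" "0 < \<epsilon>" shows "continuous_on X g"
  using assms
proof (induction rule: code.induct)
  case (code_cong g h)
  then show ?case using continuous_on_cong[of X X h g] by simp
qed (auto intro!: continuous_intros continuous_word)

lemma code_01:
  assumes "code \<epsilon> n g" "x \<in> X" shows "0 \<le> g x" "g x \<le> 1"
proof -
  have "0 \<le> g x \<and> g x \<le> 1" using assms
  proof (induction rule: code.induct)
    case (code_mix g h a)
    then show ?case using convex_bound_le[of "g x" 1 "h x" a "1 - a"] by auto
  qed (auto simp: word_01)
  then show "0 \<le> g x" "g x \<le> 1" by auto
qed

lemma word_pos_imp_close:
  assumes "0 < \<epsilon>" "word \<epsilon> n w x \<noteq> 0" "j < n"
  shows "dist (phi x (real j)) (w j) < 2 * \<epsilon>"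
proof -
  have "bump \<epsilon> (dist (phi x (real j)) (w j)) \<noteq> 0"
    using assms(2,3) by (auto simp: word_def)
  then have "0 < 2 - dist (phi x (real j)) (w j) / \<epsilon>" by (auto simp: bump_def)
  then show ?thesis using assms(1) by (simp add: field_simps)
qed

definition separated :: "nat \<Rightarrow> real \<Rightarrow> 'a set \<Rightarrow> bool" where
  "separated n r E \<longleftrightarrow> (\<forall>x\<in>E. \<forall>y\<in>E. x \<noteq> y \<longrightarrow> (\<exists>j<n. r \<le> dist (phi x (real j)) (phi y (real j))))"

text \<open>A Kraft inequality. A word is nonzero only within \<open>2 * \<epsilon>\<close> of its
  centres, so at most one point of a set separated by \<open>4 * \<epsilon>\<close> sees it; convex
  combinations inherit the bound.\<close>

lemma code_sum_separated_le_1: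
  assumes "code \<epsilon> n g" "0 < \<epsilon>" "finite E" "E \<subseteq> X" "separated n (4 * \<epsilon>) E"
  shows "(\<Sum>x\<in>E. g x) \<le> 1"
  using assms
proof (induction rule: code.induct)
  case (code_word w)
  have uniq: "x = y" if xy: "x \<in> E" "y \<in> E" "word \<epsilon> n w x \<noteq> 0" "word \<epsilon> n w y \<noteq> 0" for x y
  proof (rule ccontr)
    assume "x \<noteq> y"
    then obtain j where j: "j < n" "4 * \<epsilon> \<le> dist (phi x (real j)) (phi y (real j))"
      using code_word.prems(4) xy(1,2) unfolding separated_def by metis
    have "dist (phi x (real j)) (phi y (real j)) \<le> dist (phi x (real j)) (w j) + dist (phi y (real j)) (w j)"
      by (rule dist_triangle2)
    then show False
      using word_pos_imp_close[OF \<open>0 < \<epsilon>\<close> xy(3) j(1)] word_pos_imp_close[OF \<open>0 < \<epsilon>\<close> xy(4) j(1)] j(2) by simp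
  qed
  show ?case
  proof (cases "\<exists>x\<in>E. word \<epsilon> n w x \<noteq> 0")
    case True
    then obtain x where x: "x \<in> E" "word \<epsilon> n w x \<noteq> 0" by blast
    have "(\<Sum>y\<in>E. word \<epsilon> n w y) = (\<Sum>y\<in>{x}. word \<epsilon> n w y)"
      using x uniq code_word.prems by (intro sum.mono_neutral_right) auto
    then show ?thesis by (simp add: word_01)
  qed auto
next
  case (code_mix g h a)
  have "(\<Sum>x\<in>E. a * g x + (1 - a) * h x) = a * (\<Sum>x\<in>E. g x) + (1 - a) * (\<Sum>x\<in>E. h x)"
    by (simp add: sum.distrib sum_distrib_left)
  also have "\<dots> \<le> 1" using code_mix by (intro convex_bound_le) auto
  finally show ?case .
next
  case (code_cong g h)
  then have "(\<Sum>x\<in>E. h x) = (\<Sum>x\<in>E. g x)" by (intro sum.cong) auto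
  with code_cong show ?case by simp
qed

lemma word_mult:
  assumes "x \<in> X"
  shows "word \<epsilon> n w x * word \<epsilon> m v (phi x (real n)) = word \<epsilon> (n + m) (\<lambda>j. if j < n then w j else v (j - n)) x"
proof -
  have "(\<Prod>j<n + m. F j) = (\<Prod>j<n. F j) * (\<Prod>j<m. F (n + j))" for F :: "nat \<Rightarrow> real"
    by (induction m) (auto simp: mult.assoc)
  then show ?thesis
    unfolding word_def using assms by (simp add: phi_phi add.commute)
qed

text \<open>The product of two convex combinations is a convex combination of concatenated words.
  The outer induction unfolds the first factor, the inner one the second.\<close>

lemma code_mult:
  assumes "code \<epsilon> n g" "code \<epsilon> m h"
  shows "code \<epsilon> (n + m) (\<lambda>x. g x * h (phi x (real n)))"
  using assms(1)
proof (induction rule: code.induct)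
  case (code_word w)
  show ?case using assms(2)
  proof (induction rule: code.induct)
    case (code_word v)
    show ?case by (rule code_cong[OF code.code_word word_mult])
  next
    case (code_mix g h a)
    show ?case
      by (rule code_cong[OF code.code_mix[OF code_mix.IH code_mix.hyps(3,4)]]) (simp add: algebra_simps)
  next
    case (code_cong g h)
    show ?case by (rule code.code_cong[OF code_cong.IH]) (simp add: code_cong.hyps phi_in)
  qed
next
  case (code_mix g h' a)
  show ?case
    by (rule code_cong[OF code.code_mix[OF code_mix.IH code_mix.hyps(3,4)]]) (simp add: algebra_simps)
next
  case (code_cong g h')
  show ?case by (rule code.code_cong[OF code_cong.IH]) (simp add: code_cong.hyps)
qed

lemma pcode_mult:
  "pcode \<epsilon> n g \<Longrightarrow> pcode \<epsilon> m h \<Longrightarrow> pcode \<epsilon> (n + m) (\<lambda>x. g x * h (phi x (real n)))"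
  unfolding pcode_def by (auto intro!: code_mult mult_pos_pos phi_in)

lemma pcode_mix:
  assumes "pcode \<epsilon> n g" "code \<epsilon> n h" "0 < a" "a \<le> 1"
  shows "pcode \<epsilon> n (\<lambda>x. a * g x + (1 - a) * h x)"
  using assms code_01[OF assms(2)] unfolding pcode_def
  by (auto intro!: code_mix add_pos_nonneg mult_nonneg_nonneg)

lemma pcode_0: "pcode \<epsilon> 0 (\<lambda>x. 1)"
  using code_word[of \<epsilon> 0 undefined] unfolding pcode_def word_def by simp

lemma pcode_power:
  assumes "pcode \<epsilon> n g"
  shows "pcode \<epsilon> (n * M) (\<lambda>x. \<Prod>k<M. g (phi x (real (k * n))))"
proof (induction M)
  case 0
  then show ?case using pcode_0 by simp
next
  case (Suc M)
  show ?case using pcode_mult[OF Suc assms] by (simp add: algebra_simps)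
qed

lemma code_average:
  assumes "finite E" "E \<noteq> {}"
  shows "code \<epsilon> n (\<lambda>x. (\<Sum>c\<in>E. word \<epsilon> n (w c) x) / card E)"
  using assms
proof (induction rule: finite_ne_induct)
  case (singleton c)
  then show ?case using code_word[of \<epsilon> n "w c"] by simp
next
  case (insert c E)
  \<comment> \<open>The weight of the new word in a uniform average over \<open>card E + 1\<close>
    words.\<close>
  define a where "a = 1 / real (Suc (card E))"
  have a: "0 \<le> a" "a \<le> 1" by (auto simp: a_def)
  have "0 < real (card E)" using insert by (simp add: card_gt_0_iff)
  then have ca: "(1 - a) / card E = a"
    unfolding a_def by (simp add: divide_simps)
  show ?case
  proof (rule code_cong[OF code_mix[OF code_word[of \<epsilon> n "w c"] insert.IH a]])
    fix x
    have "(1 - a) * ((\<Sum>c\<in>E. word \<epsilon> n (w c) x) / real (card E)) = ((1 - a) / card E) * (\<Sum>c\<in>E. word \<epsilon> n (w c) x)"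
      by simp
    also have "\<dots> = a * (\<Sum>c\<in>E. word \<epsilon> n (w c) x)" by (simp add: ca)
    finally show "(\<Sum>c\<in>insert c E. word \<epsilon> n (w c) x) / real (card (insert c E)) =
      a * word \<epsilon> n (w c) x + (1 - a) * ((\<Sum>c\<in>E. word \<epsilon> n (w c) x) / real (card E))"
      using insert by (simp add: a_def add_divide_distrib)
  qed
qed

text \<open>A word that follows the orbit of \<open>c\<close> equals 1 on the Bowen ball of
  \<open>c\<close>, so averaging over the centres describes every point of the union at cost at most
  \<open>ln (card E)\<close>.\<close>

lemma code_cover:
  assumes "0 < \<epsilon>" "finite E" "E \<noteq> {}"
  shows "\<exists>g. code \<epsilon> n g \<and> (\<forall>x\<in>(\<Union>c\<in>E. bowen_ball X phi n c \<epsilon>). 1 / card E \<le> g x)"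
proof (intro exI conjI ballI)
  let ?w = "\<lambda>c j. phi c (real j)"
  show "code \<epsilon> n (\<lambda>x. (\<Sum>c\<in>E. word \<epsilon> n (?w c) x) / card E)"
    by (rule code_average[OF assms(2,3)])
  fix x assume "x \<in> (\<Union>c\<in>E. bowen_ball X phi n c \<epsilon>)"
  then obtain c where c: "c \<in> E" "x \<in> bowen_ball X phi n c \<epsilon>" by auto
  have "word \<epsilon> n (?w c) x = 1"
    unfolding word_def using c(2) assms(1)
    by (intro prod.neutral) (auto simp: bowen_ball_def bump_def min_def max_def field_simps dist_commute)
  moreover have "word \<epsilon> n (?w c) x \<le> (\<Sum>c\<in>E. word \<epsilon> n (?w c) x)"
    using c(1) assms(2) by (intro member_le_sum) (auto simp: word_01)
  ultimately show "1 / card E \<le> (\<Sum>c\<in>E. word \<epsilon> n (?w c) x) / card E"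
    by (intro divide_right_mono) auto
qed

text \<open>A padding code of bounded cost per step: a one-step cover, concatenated \<open>n\<close>
  times. It fills the gaps left by block codes and shows that costs are bounded.\<close>

lemma uniform_pcode:
  assumes "0 < \<epsilon>"
  shows "\<exists>K\<ge>1. \<forall>n. \<exists>u. pcode \<epsilon> n u \<and> (\<forall>x\<in>X. - ln (u x) \<le> real n * ln K)"
proof -
  obtain E where E: "finite E" "E \<subseteq> X" "X \<subseteq> (\<Union>c\<in>E. ball c \<epsilon>)"
    using compactE_image[OF compact_X, of X "\<lambda>c. ball c \<epsilon>"] assms by (auto simp: subset_eq) (metis dist_self)
  have ne: "E \<noteq> {}" using E X_nonempty by auto
  obtain u where u: "code \<epsilon> 1 u" "\<And>x. x \<in> (\<Union>c\<in>E. bowen_ball X phi 1 c \<epsilon>) \<Longrightarrow> 1 / card E \<le> u x"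
    using code_cover[OF assms E(1) ne, of 1] by blast
  have ux: "1 / card E \<le> u x" if "x \<in> X" for x
    using that E by (intro u(2)) (force simp: bowen_ball_def)
  have cE: "0 < card E" using E ne by (simp add: card_gt_0_iff)
  have pu: "pcode \<epsilon> 1 u" using u(1) ux cE unfolding pcode_def
    by (auto intro: less_le_trans[of _ "1 / card E"])
  show ?thesis
  proof (intro exI[of _ "real (card E)"] conjI allI)
    show "1 \<le> real (card E)" using cE by simp
    fix n
    show "\<exists>u. pcode \<epsilon> n u \<and> (\<forall>x\<in>X. - ln (u x) \<le> real n * ln (card E))"
    proof (intro exI conjI ballI)
      show "pcode \<epsilon> n (\<lambda>x. \<Prod>k<n. u (phi x (real (k * 1))))" using pcode_power[OF pu, of n] by simp
      fix x assume x: "x \<in> X"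
      have "- ln (u (phi x (real k))) \<le> ln (card E)" for k
      proof -
        have "ln (1 / card E) \<le> ln (u (phi x (real k)))"
          using ux[OF phi_in[OF x]] cE by (intro ln_mono) (auto intro: less_le_trans[of _ "1 / card E"])
        then show ?thesis using cE by (simp add: ln_div)
      qed
      then have "(\<Sum>k<n. - ln (u (phi x (real k)))) \<le> (\<Sum>k<n. ln (card E))" by (intro sum_mono)
      moreover have "ln (\<Prod>k<n. u (phi x (real k))) = (\<Sum>k<n. ln (u (phi x (real k))))"
        using pu phi_in[OF x] by (intro ln_prod) (auto simp: pcode_def less_imp_neq[THEN not_sym])
      ultimately show "- ln (\<Prod>k<n. u (phi x (real (k * 1)))) \<le> real n * ln (card E)"
        by (simp add: sum_negf)
    qed
  qed
qed

lemma continuous_ln_pcode: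
  assumes "pcode \<epsilon> n g" "0 < \<epsilon>" shows "continuous_on X (\<lambda>x. - ln (g x))"
  using assms continuous_code[of \<epsilon> n g] unfolding pcode_def by (intro continuous_intros) auto

lemma ln_pcode_nonneg:
  assumes "pcode \<epsilon> n g" "x \<in> X" shows "0 \<le> - ln (g x)"
  using assms code_01(2)[of \<epsilon> n g x] unfolding pcode_def by (auto simp: ln_le_zero_iff)

section \<open>Invariant states and the cost of codes\<close>

definition cost_ge :: "real \<Rightarrow> real \<Rightarrow> (('a \<Rightarrow> real) \<Rightarrow> real) \<Rightarrow> bool" where
  "cost_ge \<epsilon> c \<Lambda> \<longleftrightarrow> (\<forall>n>0. \<forall>g. pcode \<epsilon> n g \<longrightarrow> real n * c \<le> \<Lambda> (\<lambda>x. - ln (g x)))"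

definition inv_states :: "(('a \<Rightarrow> real) \<Rightarrow> real) set" where
  "inv_states = {\<Lambda>\<in>states X. \<forall>f. continuous_on X f \<longrightarrow> \<Lambda> (\<lambda>x. f (phi x 1)) = \<Lambda> f}"

definition orbit_average :: "nat \<Rightarrow> (('a \<Rightarrow> real) \<Rightarrow> real) \<Rightarrow> ('a \<Rightarrow> real) \<Rightarrow> real" where
  "orbit_average N \<sigma> f =
     (if continuous_on X f then (\<Sum>t<N. \<sigma> (\<lambda>x. f (phi x (real t)))) / real N else 0)"

lemma orbit_average_state:
  assumes \<sigma>: "\<sigma> \<in> states X" and N: "0 < N"
  shows "orbit_average N \<sigma> \<in> states X"
  unfolding states_def mem_Collect_eq
proof (intro conjI allI impI)
  fix f g :: "'a \<Rightarrow> real" assume f: "continuous_on X f"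
  show "orbit_average N \<sigma> (\<lambda>x. c * f x) = c * orbit_average N \<sigma> f" for c
    using f by (simp add: orbit_average_def state_cmult[OF \<sigma>] continuous_comp_phi continuous_on_mult_left sum_distrib_left)
  show "0 \<le> orbit_average N \<sigma> f" if "\<forall>x\<in>X. 0 \<le> f x"
    using f that by (auto simp: orbit_average_def intro!: divide_nonneg_nonneg sum_nonneg state_nonneg[OF \<sigma>] continuous_comp_phi phi_in)
  assume g: "continuous_on X g"
  show "orbit_average N \<sigma> (\<lambda>x. f x + g x) = orbit_average N \<sigma> f + orbit_average N \<sigma> g"
    using f g by (simp add: orbit_average_def state_add[OF \<sigma>] continuous_comp_phi continuous_on_add sum.distrib add_divide_distrib)
qed (use N state_const[OF \<sigma>, of 1] in \<open>auto simp: orbit_average_def\<close>)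

text \<open>A block code is used from every starting phase \<open>s < n\<close>, padded by the uniform code; averaging
  over the phases turns the cost of the long code into a Birkhoff average of the cost of the block.\<close>

lemma phase_averaging:
  assumes \<sigma>: "\<sigma> \<in> states X" and e: "0 < \<epsilon>" and n: "0 < n" and g: "pcode \<epsilon> n g"
    and u: "\<And>m. pcode \<epsilon> m (u m)" "\<And>m x. x \<in> X \<Longrightarrow> - ln (u m x) \<le> real m * B"
    and B: "0 \<le> B" and N: "2 * n \<le> N"
    and low: "\<And>h. pcode \<epsilon> N h \<Longrightarrow> real N * c \<le> \<sigma> (\<lambda>x. - ln (h x))"
  shows "real n * c - 2 * real n ^ 2 * B / real N \<le> orbit_average N \<sigma> (\<lambda>x. - ln (g x))"
proof -
  let ?b = "\<lambda>x. - ln (g x)"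
  have bc: "continuous_on X ?b" by (rule continuous_ln_pcode[OF g e])
  have cc: "continuous_on X (\<lambda>x. - ln (g (phi x t)))" for t by (rule continuous_comp_phi[OF bc])
  \<comment> \<open>One block fewer than would fit, so that \<open>M\<close> blocks have room at
    every phase \<open>s < n\<close>. The padding before and after them then has total length at
    most \<open>2 * n\<close>.\<close>
  define M where "M = N div n - 1"
  have "1 \<le> N div n" using N n by (simp add: Suc_leI div_greater_zero_iff)
  then have nM: "N - n * M < 2 * n" "n * M + n \<le> N"
  proof -
    define q where "q = N div n"
    have "N = n * q + N mod n" "N mod n < n" "n \<le> n * q" "n * M = n * q - n"
      using mod_less_divisor[OF n, of N] mult_le_mono2[OF \<open>1 \<le> N div n\<close>, of n]
      by (auto simp: q_def M_def diff_mult_distrib2)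
    then show "N - n * M < 2 * n" "n * M + n \<le> N" by linarith+
  qed
  have phase: "real N * c \<le> 2 * real n * B + (\<Sum>k<M. \<sigma> (\<lambda>x. ?b (phi x (real (s + k * n)))))" if s: "s < n" for s
  proof -
    define r where "r = N - s - n * M"
    have Nr: "N = s + n * M + r" using nM s by (simp add: r_def)
    define h where "h x = u s x * (\<Prod>k<M. g (phi (phi x (real s)) (real (k * n)))) * u r (phi x (real (s + n * M)))" for x
    have ph: "pcode \<epsilon> N h"
      unfolding Nr h_def
      using pcode_mult[OF pcode_mult[OF u(1)[of s] pcode_power[OF g, of M]] u(1)[of r]] by simp
    have hb: "- ln (h x) \<le> 2 * real n * B + (\<Sum>k<M. ?b (phi x (real (s + k * n))))" if x: "x \<in> X" for x
    proof -
      have pos: "0 < u s x" "0 < u r (phi x (real (s + n * M)))" "\<And>t. 0 < g (phi x t)"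
        using u(1) g x phi_in[OF x] by (auto simp: pcode_def)
      have prodeq: "(\<Prod>k<M. g (phi (phi x (real s)) (real (k * n)))) = (\<Prod>k<M. g (phi x (real (s + k * n))))"
        using x by (simp add: phi_phi add.commute)
      have "ln (h x) = ln (u s x) + (\<Sum>k<M. ln (g (phi x (real (s + k * n))))) + ln (u r (phi x (real (s + n * M))))"
        unfolding h_def prodeq using pos
        by (simp add: ln_mult_pos prod_pos ln_prod less_imp_neq[THEN not_sym] mult_pos_pos)
      moreover have "- ln (u s x) \<le> real s * B" "- ln (u r (phi x (real (s + n * M)))) \<le> real r * B"
        using u(2) x phi_in[OF x] by auto
      moreover have "real s * B + real r * B \<le> 2 * real n * B"
      proof -
        have "s + r \<le> 2 * n" using nM Nr by linarith
        then have "real (s + r) * B \<le> real (2 * n) * B" using B by (intro mult_right_mono) auto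
        then show ?thesis by (simp add: algebra_simps)
      qed
      ultimately show ?thesis by (simp add: sum_negf)
    qed
    have "real N * c \<le> \<sigma> (\<lambda>x. - ln (h x))" by (rule low[OF ph])
    also have "\<dots> \<le> \<sigma> (\<lambda>x. 2 * real n * B + (\<Sum>k<M. ?b (phi x (real (s + k * n)))))"
      using hb by (intro state_mono[OF \<sigma>] continuous_ln_pcode[OF ph e] continuous_intros cc) auto
    also have "\<dots> = 2 * real n * B + (\<Sum>k<M. \<sigma> (\<lambda>x. ?b (phi x (real (s + k * n)))))"
      by (subst state_add[OF \<sigma>]) (auto intro!: continuous_intros cc simp: state_const[OF \<sigma>] state_sum[OF \<sigma>] cc simp del: of_nat_add)
    finally show ?thesis .
  qed
  have bn: "0 \<le> \<sigma> (\<lambda>x. ?b (phi x t))" for t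
    by (intro state_nonneg[OF \<sigma>] cc ln_pcode_nonneg[OF g] phi_in)
  \<comment> \<open>Each time below \<open>M * n\<close> is \<open>s + k * n\<close> for exactly one
    phase and one block, so the sum over phases is a Birkhoff sum.\<close>
  have "(\<Sum>s<n. \<Sum>k<M. \<sigma> (\<lambda>x. ?b (phi x (real (s + k * n))))) = (\<Sum>t<M * n. \<sigma> (\<lambda>x. ?b (phi x (real t))))"
  proof -
    define a where "a t = \<sigma> (\<lambda>x. ?b (phi x (real t)))" for t
    have "(\<Sum>s<n. \<Sum>k<M. a (s + k * n)) = (\<Sum>k<M. \<Sum>s<n. a (s + k * n))" by (rule sum.swap)
    also have "\<dots> = (\<Sum>k<M. sum a {k * n..<k * n + n})"
      by (intro sum.cong refl sum.reindex_bij_witness[of _ "\<lambda>t. t - k * n" "\<lambda>s. s + k * n" for k]) auto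
    also have "\<dots> = sum a {..<M * n}" by (rule sum.nat_group)
    finally show ?thesis by (simp add: a_def)
  qed
  also have "\<dots> \<le> (\<Sum>t<N. \<sigma> (\<lambda>x. ?b (phi x (real t))))"
    using nM bn by (intro sum_mono2) (auto simp: mult.commute)
  also have "\<dots> = real N * orbit_average N \<sigma> ?b"
    using bc N n by (simp add: orbit_average_def)
  finally have A: "(\<Sum>s<n. \<Sum>k<M. \<sigma> (\<lambda>x. ?b (phi x (real (s + k * n))))) \<le> real N * orbit_average N \<sigma> ?b" .
  have "(\<Sum>s<n. real N * c) \<le> (\<Sum>s<n. 2 * real n * B + (\<Sum>k<M. \<sigma> (\<lambda>x. ?b (phi x (real (s + k * n))))))"
    using phase by (intro sum_mono) auto
  then have "real n * (real N * c) \<le> real n * (2 * real n * B) + real N * orbit_average N \<sigma> ?b"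
    using A by (simp add: sum.distrib)
  then show ?thesis using N n by (simp add: field_simps power2_eq_square)
qed

text \<open>Krylov and Bogolyubov's averaging, with cost carried along. Each \<open>\<sigma>\<close>
  has to be expensive only for codes of its own length \<open>N\<close>;
  \<open>phase_averaging\<close> transfers this to every fixed length \<open>n\<close> with an error
  that vanishes as \<open>N\<close> grows, and a cluster point of the orbit averages keeps the
  bounds.\<close>

lemma inv_state_from_states:
  assumes e: "0 < \<epsilon>"
    and freq: "\<And>N0. \<exists>N\<ge>N0. \<exists>\<sigma>\<in>states X. \<forall>h. pcode \<epsilon> N h \<longrightarrow> real N * c \<le> \<sigma> (\<lambda>x. - ln (h x))"
  shows "\<exists>\<Lambda>\<in>inv_states. cost_ge \<epsilon> c \<Lambda>"
proof -
  have "\<exists>N \<sigma>. Suc i \<le> N \<and> \<sigma> \<in> states X \<and> (\<forall>h. pcode \<epsilon> N h \<longrightarrow> real N * c \<le> \<sigma> (\<lambda>x. - ln (h x)))" for i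
    using freq[of "Suc i"] by blast
  then obtain N \<sigma> where N: "\<And>i. Suc i \<le> N i" and \<sigma>: "\<And>i. \<sigma> i \<in> states X"
    and low: "\<And>i h. pcode \<epsilon> (N i) h \<Longrightarrow> real (N i) * c \<le> \<sigma> i (\<lambda>x. - ln (h x))" by metis
  obtain K where K: "1 \<le> K" "\<And>n. \<exists>u. pcode \<epsilon> n u \<and> (\<forall>x\<in>X. - ln (u x) \<le> real n * ln K)"
    using uniform_pcode[OF e] by blast
  then obtain u where u: "\<And>m. pcode \<epsilon> m (u m)" "\<And>m x. x \<in> X \<Longrightarrow> - ln (u m x) \<le> real m * ln K" by metis
  define \<Lambda>s where "\<Lambda>s i = orbit_average (N i) (\<sigma> i)" for i
  have \<Lambda>s: "\<Lambda>s i \<in> states X" for i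
    unfolding \<Lambda>s_def using N[of i] by (intro orbit_average_state \<sigma>) auto
  obtain \<Lambda> where \<Lambda>: "\<Lambda> \<in> states X"
    and cl: "\<And>f c. (\<And>e. 0 < e \<Longrightarrow> \<forall>\<^sub>F n in sequentially. c - e \<le> \<Lambda>s n f) \<Longrightarrow> c \<le> \<Lambda> f"
    using compact_fun_cluster[of "states X" \<Lambda>s, OF compact_states[OF compact_X] \<Lambda>s] by blast
  have small: "\<forall>\<^sub>F i in sequentially. C / real (N i) \<le> d" if "0 < d" "0 \<le> C" for C d :: real
  proof -
    obtain i0 :: nat where i0: "C / d < real i0" using reals_Archimedean2 by blast
    have "C / real (N i) \<le> d" if "i0 \<le> i" for i
    proof -
      have "C < real (N i) * d" using i0 N[of i] \<open>i0 \<le> i\<close> \<open>0 < d\<close>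
        by (smt (verit) mult_right_mono of_nat_mono pos_divide_less_eq Suc_leD le_trans)
      then show ?thesis using N[of i] by (simp add: divide_le_eq mult.commute)
    qed
    then show ?thesis by (auto simp: eventually_sequentially)
  qed
  have "cost_ge \<epsilon> c \<Lambda>"
    unfolding cost_ge_def
  proof (intro allI impI cl)
    fix n g and d :: real assume n: "0 < n" and g: "pcode \<epsilon> n g" and d: "0 < d"
    have "\<forall>\<^sub>F i in sequentially. 2 * n \<le> i" by (rule eventually_ge_at_top)
    moreover have "0 \<le> 2 * real n ^ 2 * ln K" using K(1) by simp
    note small[OF d this]
    ultimately show "\<forall>\<^sub>F i in sequentially. real n * c - d \<le> \<Lambda>s i (\<lambda>x. - ln (g x))"
    proof eventually_elim
      case (elim i)
      have "real n * c - 2 * real n ^ 2 * ln K / real (N i) \<le> \<Lambda>s i (\<lambda>x. - ln (g x))"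
        unfolding \<Lambda>s_def using elim(1) N[of i] K(1)
        by (intro phase_averaging[OF \<sigma> e n g u _ _ low]) auto
      with elim(2) show ?case by linarith
    qed
  qed
  moreover have "\<Lambda> (\<lambda>x. f (phi x 1)) = \<Lambda> f" if f: "continuous_on X f" for f
  proof -
    obtain B where B: "\<And>x. x \<in> X \<Longrightarrow> \<bar>f x\<bar> \<le> B"
      using compact_imp_bounded[OF compact_continuous_image[OF f compact_X]] by (auto simp: bounded_iff)
    have B0: "0 \<le> B" using B X_nonempty by fastforce
    have f1: "continuous_on X (\<lambda>x. f (phi x t))" for t by (rule continuous_comp_phi[OF f])
    \<comment> \<open>Shifting by one step changes an orbit average only by the two end terms of a
      telescoping sum.\<close>
    have diff: "\<bar>\<Lambda>s i (\<lambda>x. f (phi x 1)) - \<Lambda>s i f\<bar> \<le> 2 * B / real (N i)" for i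
    proof -
      define a where "a t = \<sigma> i (\<lambda>x. f (phi x (real t)))" for t
      have eq: "\<sigma> i (\<lambda>x. f (phi (phi x (real t)) 1)) = a (Suc t)" for t
      proof -
        have le: "\<sigma> i p \<le> \<sigma> i q" if "continuous_on X p" "continuous_on X q" "\<And>x. x \<in> X \<Longrightarrow> p x = q x" for p q
          using that by (intro state_mono[OF \<sigma>]) auto
        show ?thesis unfolding a_def
          by (intro antisym le f1 continuous_comp_phi[OF f1]) (auto simp: phi_phi)
      qed
      have "\<Lambda>s i (\<lambda>x. f (phi x 1)) - \<Lambda>s i f = ((\<Sum>t<N i. a (Suc t)) - (\<Sum>t<N i. a t)) / real (N i)"
        unfolding \<Lambda>s_def orbit_average_def using f f1 eq by (simp add: a_def diff_divide_distrib)
      also have "(\<Sum>t<N i. a (Suc t)) - (\<Sum>t<N i. a t) = a (N i) - a 0"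
        by (simp add: sum_subtractf[symmetric] sum_lessThan_telescope)
      finally have "\<bar>\<Lambda>s i (\<lambda>x. f (phi x 1)) - \<Lambda>s i f\<bar> = \<bar>a (N i) - a 0\<bar> / real (N i)" by simp
      moreover have "\<bar>a t\<bar> \<le> B" for t
        unfolding a_def by (intro state_bound[OF \<sigma>] f1 B phi_in)
      from this[of "N i"] this[of 0] have "\<bar>a (N i) - a 0\<bar> \<le> 2 * B" by linarith
      ultimately show ?thesis by (simp add: divide_right_mono)
    qed
    have "0 \<le> \<Lambda> (\<lambda>x. f (phi x 1) - f x)"
    proof (rule cl)
      fix d :: real assume "0 < d"
      then have "\<forall>\<^sub>F i in sequentially. 2 * B / real (N i) \<le> d" using B0 by (intro small) auto
      then show "\<forall>\<^sub>F i in sequentially. 0 - d \<le> \<Lambda>s i (\<lambda>x. f (phi x 1) - f x)"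
      proof eventually_elim
        case (elim i)
        then show ?case using diff[of i] state_diff[OF \<Lambda>s f1 f, of i 1] by linarith
      qed
    qed
    moreover have "0 \<le> \<Lambda> (\<lambda>x. f x - f (phi x 1))"
    proof (rule cl)
      fix d :: real assume "0 < d"
      then have "\<forall>\<^sub>F i in sequentially. 2 * B / real (N i) \<le> d" using B0 by (intro small) auto
      then show "\<forall>\<^sub>F i in sequentially. 0 - d \<le> \<Lambda>s i (\<lambda>x. f x - f (phi x 1))"
      proof eventually_elim
        case (elim i)
        then show ?case using diff[of i] state_diff[OF \<Lambda>s f f1, of i 1] by linarith
      qed
    qed
    ultimately show ?thesis
      using state_diff[OF \<Lambda> f f1] state_diff[OF \<Lambda> f1 f] by force
  qed
  ultimately show ?thesis using \<Lambda> by (auto simp: inv_states_def)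
qed

lemma inv_state_iterate:
  assumes L: "\<Lambda> \<in> inv_states" and f: "continuous_on X f"
  shows "\<Lambda> (\<lambda>x. f (phi x (real k))) = \<Lambda> f"
proof (induction k)
  case 0
  then show ?case using L f by (intro state_cong[of \<Lambda> X] continuous_comp_phi) (auto simp: inv_states_def)
next
  case (Suc k)
  have c: "continuous_on X (\<lambda>x. f (phi x (real k)))" by (rule continuous_comp_phi[OF f])
  have "\<Lambda> (\<lambda>x. f (phi x (real (Suc k)))) = \<Lambda> (\<lambda>x. f (phi (phi x 1) (real k)))"
    using L by (intro state_cong[of \<Lambda> X] continuous_comp_phi[OF f] continuous_comp_phi[OF c])
      (auto simp: inv_states_def phi_phi add.commute)
  also have "\<dots> = \<Lambda> (\<lambda>x. f (phi x (real k)))" using L c unfolding inv_states_def by blast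
  also note Suc
  finally show ?case .
qed

lemma average_over_finite_state:
  assumes "finite E" "E \<noteq> {}" "E \<subseteq> X"
  shows "(\<lambda>f. if continuous_on X f then (\<Sum>x\<in>E. f x) / card E else 0) \<in> states X"
  unfolding states_def using assms
  by (auto intro!: continuous_intros divide_nonneg_nonneg sum_nonneg
      simp: sum.distrib add_divide_distrib sum_distrib_left subset_eq)

text \<open>The uniform distribution on a separated set costs at least \<open>ln (card E)\<close>
  for every code, by the Kraft inequality and the Gibbs inequality; averaging along orbits then
  makes it invariant.\<close>

lemma inv_state_from_separated:
  assumes e: "0 < \<epsilon>"
    and freq: "\<And>N0. \<exists>N\<ge>N0. \<exists>E. finite E \<and> E \<noteq> {} \<and> E \<subseteq> X \<and> separated N (4 * \<epsilon>) E \<and> real N * c \<le> ln (card E)"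
  shows "\<exists>\<Lambda>\<in>inv_states. cost_ge \<epsilon> c \<Lambda>"
proof (rule inv_state_from_states[OF e])
  fix N0
  obtain N E where N: "N0 \<le> N" and E: "finite E" "E \<noteq> {}" "E \<subseteq> X" "separated N (4 * \<epsilon>) E"
    and c: "real N * c \<le> ln (card E)" using freq by metis
  let ?s = "\<lambda>f. if continuous_on X f then (\<Sum>x\<in>E. f x) / card E else 0"
  have cE: "0 < real (card E)" using E by (simp add: card_gt_0_iff)
  have "real N * c \<le> ?s (\<lambda>x. - ln (h x))" if h: "pcode \<epsilon> N h" for h
  proof -
    have "(\<Sum>x\<in>E. h x) \<le> 1"
      using h E e by (intro code_sum_separated_le_1[of \<epsilon> N]) (auto simp: pcode_def)
    \<comment> \<open>The tangent inequality \<open>ln y \<le> y - 1\<close> at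
      \<open>y = card E * h x\<close>. Summed over \<open>E\<close>, the terms beyond the logarithm
      have the right sign because the code sums to at most 1.\<close>
    moreover have "ln (card E) + 1 - card E * h x \<le> - ln (h x)" if "x \<in> E" for x
    proof -
      have hx: "0 < h x" using h that E by (auto simp: pcode_def)
      have "ln (card E * h x) \<le> card E * h x - 1" using hx cE by (intro ln_le_minus_one) auto
      then show ?thesis using hx cE by (simp add: ln_mult_pos)
    qed
    then have "(\<Sum>x\<in>E. ln (card E) + 1 - card E * h x) \<le> (\<Sum>x\<in>E. - ln (h x))" by (rule sum_mono)
    then have "card E * (ln (card E) + 1) - card E * (\<Sum>x\<in>E. h x) \<le> (\<Sum>x\<in>E. - ln (h x))"
      by (simp only: sum_subtractf sum_distrib_left sum_constant)
    moreover have "real (card E) * (\<Sum>x\<in>E. h x) \<le> real (card E) * 1"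
      using cE calculation(1) by (intro mult_left_mono) auto
    ultimately have "card E * ln (card E) \<le> (\<Sum>x\<in>E. - ln (h x))" by (simp add: algebra_simps)
    then have "ln (card E) \<le> (\<Sum>x\<in>E. - ln (h x)) / card E" using cE by (simp add: field_simps)
    then show ?thesis using c continuous_ln_pcode[OF h e] by simp
  qed
  then show "\<exists>N\<ge>N0. \<exists>\<sigma>\<in>states X. \<forall>h. pcode \<epsilon> N h \<longrightarrow> real N * c \<le> \<sigma> (\<lambda>x. - ln (h x))"
    by (intro exI[of _ N] conjI N bexI[of _ ?s] average_over_finite_state[OF E(1-3)] allI impI)
qed

text \<open>The bound \<open>N0\<close> serves all states at once, invariant or not. The mixing
  arguments depend on this, since they apply it to conditional states.\<close>

lemma cheap_code_for_all_states:
  assumes "0 < \<epsilon>" "\<not> (\<exists>\<Lambda>\<in>inv_states. cost_ge \<epsilon> c \<Lambda>)"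
  shows "\<exists>N0. \<forall>N\<ge>N0. \<forall>\<sigma>\<in>states X. \<exists>g. pcode \<epsilon> N g \<and> \<sigma> (\<lambda>x. - ln (g x)) < real N * c"
proof (rule ccontr)
  assume "\<not> ?thesis"
  then have "\<exists>N\<ge>N0. \<exists>\<sigma>\<in>states X. \<forall>h. pcode \<epsilon> N h \<longrightarrow> real N * c \<le> \<sigma> (\<lambda>x. - ln (h x))" for N0
    by (meson not_le)
  from inv_state_from_states[OF assms(1) this] assms(2) show False by blast
qed

section \<open>Maximal cost and extreme points\<close>

lemma closed_inv_states: "closed inv_states"
proof -
  have "inv_states = states X \<inter> (\<Inter>f\<in>{f. continuous_on X f}. {\<Lambda>. \<Lambda> (\<lambda>x. f (phi x 1)) = \<Lambda> f})"
    by (auto simp: inv_states_def)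
  also have "closed \<dots>"
    by (intro closed_Int closed_states closed_INT ballI closed_Collect_eq continuous_on_product_coordinates)
  finally show ?thesis .
qed

lemma compact_inv_states: "compact inv_states"
  using compact_Int_closed[OF compact_states[OF compact_X] closed_inv_states]
  by (simp add: inv_states_def Int_absorb1 subset_eq)

lemma closed_cost_ge: "closed {\<Lambda>. cost_ge \<epsilon> c \<Lambda>}"
proof -
  have "{\<Lambda>. cost_ge \<epsilon> c \<Lambda>} = (\<Inter>n\<in>{0<..}. \<Inter>g\<in>{g. pcode \<epsilon> n g}. {\<Lambda>. real n * c \<le> \<Lambda> (\<lambda>x. - ln (g x))})"
    by (auto simp: cost_ge_def)
  also have "closed \<dots>"
    by (intro closed_INT ballI closed_Collect_le continuous_on_product_coordinates continuous_intros)
  finally show ?thesis .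
qed

text \<open>Costs are bounded by that of the one-step uniform code, and the supremum is attained
  because lower bounds on cost survive at a cluster point.\<close>

lemma max_cost:
  assumes e: "0 < \<epsilon>" and ex: "\<exists>\<Lambda>\<in>inv_states. cost_ge \<epsilon> c \<Lambda>"
  shows "\<exists>h\<ge>c. (\<exists>\<Lambda>\<in>inv_states. cost_ge \<epsilon> h \<Lambda>) \<and> (\<forall>c'>h. \<not> (\<exists>\<Lambda>\<in>inv_states. cost_ge \<epsilon> c' \<Lambda>))"
proof -
  define C where "C = {c. \<exists>\<Lambda>\<in>inv_states. cost_ge \<epsilon> c \<Lambda>}"
  have ne: "C \<noteq> {}" "c \<in> C" using ex by (auto simp: C_def)
  obtain K where "\<And>n. \<exists>u. pcode \<epsilon> n u \<and> (\<forall>x\<in>X. - ln (u x) \<le> real n * ln K)"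
    using uniform_pcode[OF e] by blast
  then obtain u where u: "pcode \<epsilon> 1 u" "\<And>x. x \<in> X \<Longrightarrow> - ln (u x) \<le> ln K" by fastforce
  have "x \<le> ln K" if x: "x \<in> C" for x
  proof -
    obtain \<Lambda> where L: "\<Lambda> \<in> states X" "cost_ge \<epsilon> x \<Lambda>" using x by (auto simp: C_def inv_states_def)
    have "real 1 * x \<le> \<Lambda> (\<lambda>x. - ln (u x))" using L(2)[unfolded cost_ge_def, rule_format, of 1 u] u(1) by simp
    also have "\<dots> \<le> \<Lambda> (\<lambda>x. ln K)"
      using u by (intro state_mono[OF L(1)] continuous_ln_pcode[OF u(1) e]) auto
    finally show ?thesis using state_const[OF L(1)] by simp
  qed
  then have bdd: "bdd_above C" by (rule bdd_aboveI)
  define h where "h = Sup C"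
  have "\<exists>\<Lambda>\<in>inv_states. cost_ge \<epsilon> (h - 1 / real (Suc i)) \<Lambda>" for i
  proof -
    obtain x where "x \<in> C" "h - 1 / real (Suc i) < x"
      using less_cSup_iff[OF ne(1) bdd, of "h - 1 / real (Suc i)"] by (auto simp: h_def)
    then obtain \<Lambda> where \<Lambda>: "\<Lambda> \<in> inv_states" "cost_ge \<epsilon> x \<Lambda>" by (auto simp: C_def)
    have "cost_ge \<epsilon> (h - 1 / real (Suc i)) \<Lambda>"
      unfolding cost_ge_def
    proof (intro allI impI)
      fix n g assume "0 < n" "pcode \<epsilon> n g"
      then have "real n * x \<le> \<Lambda> (\<lambda>x. - ln (g x))" using \<Lambda>(2) by (simp add: cost_ge_def)
      moreover have "real n * (h - 1 / real (Suc i)) \<le> real n * x"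
        using \<open>h - 1 / real (Suc i) < x\<close> by (intro mult_left_mono) auto
      ultimately show "real n * (h - 1 / real (Suc i)) \<le> \<Lambda> (\<lambda>x. - ln (g x))" by linarith
    qed
    then show ?thesis using \<Lambda>(1) by blast
  qed
  then obtain \<Lambda>s where \<Lambda>s: "\<And>i. \<Lambda>s i \<in> inv_states" "\<And>i. cost_ge \<epsilon> (h - 1 / real (Suc i)) (\<Lambda>s i)" by metis
  obtain \<Lambda> where \<Lambda>: "\<Lambda> \<in> inv_states"
    and cl: "\<And>f c. (\<And>e. 0 < e \<Longrightarrow> \<forall>\<^sub>F n in sequentially. c - e \<le> \<Lambda>s n f) \<Longrightarrow> c \<le> \<Lambda> f"
    using compact_fun_cluster[of inv_states \<Lambda>s, OF compact_inv_states \<Lambda>s(1)] by blast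
  have "cost_ge \<epsilon> h \<Lambda>"
    unfolding cost_ge_def
  proof (intro allI impI cl)
    fix n g and d :: real assume n: "0 < n" and g: "pcode \<epsilon> n g" and d: "0 < d"
    obtain i0 :: nat where i0: "real n / d < real i0" using reals_Archimedean2 by blast
    show "\<forall>\<^sub>F i in sequentially. real n * h - d \<le> \<Lambda>s i (\<lambda>x. - ln (g x))"
      unfolding eventually_sequentially
    proof (intro exI[of _ i0] allI impI)
      fix i assume "i0 \<le> i"
      then have "real n / d < real (Suc i)" using i0 by simp
      then have "real n / real (Suc i) \<le> d" using d by (simp add: field_simps)
      moreover have "real n * (h - 1 / real (Suc i)) \<le> \<Lambda>s i (\<lambda>x. - ln (g x))"
        using \<Lambda>s(2)[of i] n g unfolding cost_ge_def by blast
      ultimately show "real n * h - d \<le> \<Lambda>s i (\<lambda>x. - ln (g x))" by (simp add: right_diff_distrib)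
    qed
  qed
  moreover have "c' \<le> h" if "\<exists>\<Lambda>\<in>inv_states. cost_ge \<epsilon> c' \<Lambda>" for c'
    unfolding h_def using that by (intro cSup_upper bdd) (auto simp: C_def)
  moreover have "c \<le> h" unfolding h_def by (intro cSup_upper bdd ne)
  ultimately show ?thesis using \<Lambda> by (meson not_le)
qed

text \<open>Suppose \<open>\<Lambda>1\<close> has a code that beats \<open>h\<close> by
  \<open>d\<close> per step. Repeating it keeps the gain proportional to the length, while
  \<open>\<Lambda>2\<close> has codes costing hardly more than \<open>h\<close> per step. One mixed
  code serves both at an extra cost of \<open>ln 2\<close>, so over a long time the convex
  combination falls below \<open>h\<close>.\<close>

lemma max_cost_extremal:
  assumes e: "0 < \<epsilon>" and max: "\<forall>c'>h. \<not> (\<exists>\<Lambda>\<in>inv_states. cost_ge \<epsilon> c' \<Lambda>)"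
  shows "extremal_in inv_states {\<Lambda>\<in>inv_states. cost_ge \<epsilon> h \<Lambda>}"
proof -
  have key: "cost_ge \<epsilon> h \<Lambda>1" if L1: "\<Lambda>1 \<in> inv_states" and L2: "\<Lambda>2 \<in> inv_states" and a: "0 < a" "a < 1"
    and mix: "\<And>n g. 0 < n \<Longrightarrow> pcode \<epsilon> n g \<Longrightarrow>
       real n * h \<le> a * \<Lambda>1 (\<lambda>x. - ln (g x)) + (1 - a) * \<Lambda>2 (\<lambda>x. - ln (g x))" for \<Lambda>1 \<Lambda>2 and a :: real
  proof (rule ccontr)
    assume "\<not> cost_ge \<epsilon> h \<Lambda>1"
    then obtain n g where n: "0 < n" and g: "pcode \<epsilon> n g" and lt: "\<Lambda>1 (\<lambda>x. - ln (g x)) < real n * h"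
      unfolding cost_ge_def by (auto simp: not_le)
    have s1: "\<Lambda>1 \<in> states X" and s2: "\<Lambda>2 \<in> states X" using L1 L2 by (auto simp: inv_states_def)
    define d where "d = h - \<Lambda>1 (\<lambda>x. - ln (g x)) / real n"
    have d: "0 < d" using lt n by (simp add: d_def field_simps)
    \<comment> \<open>The gain of \<open>\<Lambda>1\<close> enters with weight \<open>a\<close>; an
      excess of at most half of it for \<open>\<Lambda>2\<close> leaves \<open>a * d / 2\<close> per
      step, which outgrows \<open>ln 2\<close>.\<close>
    define \<eta> where "\<eta> = a * d / 2"
    have \<eta>: "0 < \<eta>" using a d by (simp add: \<eta>_def)
    obtain N0 where N0: "\<And>N \<sigma>. N0 \<le> N \<Longrightarrow> \<sigma> \<in> states X \<Longrightarrow> \<exists>g. pcode \<epsilon> N g \<and> \<sigma> (\<lambda>x. - ln (g x)) < real N * (h + \<eta>)"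
      using cheap_code_for_all_states[OF e, of "h + \<eta>"] max \<eta> by (metis less_add_same_cancel1)
    obtain M0 :: nat where M0: "ln 2 / (a * d / 2) < real M0" using reals_Archimedean2 by blast
    define M where "M = N0 + M0 + 1"
    define N where "N = n * M"
    have NM: "M \<le> N" using n by (simp add: N_def)
    have N: "0 < N" "N0 \<le> N" "M0 \<le> N" using NM by (auto simp: M_def)
    obtain g2 where g2: "pcode \<epsilon> N g2" "\<Lambda>2 (\<lambda>x. - ln (g2 x)) < real N * (h + \<eta>)"
      using N0[OF N(2) s2] by blast
    define g1 where "g1 x = (\<Prod>k<M. g (phi x (real (k * n))))" for x
    have g1: "pcode \<epsilon> N g1" unfolding N_def g1_def by (rule pcode_power[OF g])
    have bc: "continuous_on X (\<lambda>x. - ln (g x))" by (rule continuous_ln_pcode[OF g e])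
    have "\<Lambda>1 (\<lambda>x. - ln (g1 x)) = \<Lambda>1 (\<lambda>x. \<Sum>k<M. - ln (g (phi x (real (k * n)))))"
    proof (intro state_cong[OF s1] continuous_ln_pcode[OF g1 e])
      show "continuous_on X (\<lambda>x. \<Sum>k<M. - ln (g (phi x (real (k * n)))))"
        by (rule continuous_on_sum) (rule continuous_comp_phi[OF bc])
      fix x assume "x \<in> X"
      then show "- ln (g1 x) = (\<Sum>k<M. - ln (g (phi x (real (k * n)))))"
        unfolding g1_def sum_negf using g phi_in
        by (subst ln_prod) (auto simp: pcode_def less_imp_neq[THEN not_sym])
    qed
    also have "\<dots> = (\<Sum>k<M. \<Lambda>1 (\<lambda>x. - ln (g (phi x (real (k * n))))))"
      by (rule state_sum[OF s1]) (auto intro: continuous_comp_phi[OF bc])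
    also have "\<dots> = real M * \<Lambda>1 (\<lambda>x. - ln (g x))"
      by (simp only: inv_state_iterate[OF L1 bc] sum_constant card_lessThan)
    also have "\<dots> = real N * (h - d)" using n by (simp add: d_def N_def field_simps)
    finally have c1: "\<Lambda>1 (\<lambda>x. - ln (g1 x)) = real N * (h - d)" .
    \<comment> \<open>Each component keeps half its weight, so the mixture costs at most
      \<open>ln 2\<close> more than either code at every point.\<close>
    define q where "q x = (1/2) * g1 x + (1 - 1/2) * g2 x" for x
    have q: "pcode \<epsilon> N q" unfolding q_def using g2(1) by (intro pcode_mix g1) (auto simp: pcode_def)
    have qle: "- ln (q x) \<le> - ln (g1 x) + ln 2" "- ln (q x) \<le> - ln (g2 x) + ln 2" if "x \<in> X" for x
    proof -
      have p: "0 < g1 x" "0 < g2 x" using g1 g2(1) that by (auto simp: pcode_def)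
      have "ln (g1 x / 2) \<le> ln (q x)" "ln (g2 x / 2) \<le> ln (q x)" using p by (auto simp: q_def)
      then show "- ln (q x) \<le> - ln (g1 x) + ln 2" "- ln (q x) \<le> - ln (g2 x) + ln 2"
        using p by (auto simp: ln_div)
    qed
    have "\<Lambda>1 (\<lambda>x. - ln (q x)) \<le> \<Lambda>1 (\<lambda>x. - ln (g1 x) + ln 2)"
      using qle by (intro state_mono[OF s1] continuous_on_add continuous_ln_pcode[OF q e] continuous_ln_pcode[OF g1 e] continuous_on_const)
    also have "\<dots> = \<Lambda>1 (\<lambda>x. - ln (g1 x)) + ln 2"
      by (subst state_add[OF s1]) (auto intro!: continuous_ln_pcode[OF g1 e] simp: state_const[OF s1])
    finally have b1: "\<Lambda>1 (\<lambda>x. - ln (q x)) \<le> real N * (h - d) + ln 2" using c1 by simp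
    have "\<Lambda>2 (\<lambda>x. - ln (q x)) \<le> \<Lambda>2 (\<lambda>x. - ln (g2 x) + ln 2)"
      using qle by (intro state_mono[OF s2] continuous_on_add continuous_ln_pcode[OF q e] continuous_ln_pcode[OF g2(1) e] continuous_on_const)
    also have "\<dots> = \<Lambda>2 (\<lambda>x. - ln (g2 x)) + ln 2"
      by (subst state_add[OF s2]) (auto intro!: continuous_ln_pcode[OF g2(1) e] simp: state_const[OF s2])
    finally have b2: "\<Lambda>2 (\<lambda>x. - ln (q x)) \<le> real N * (h + \<eta>) + ln 2" using g2(2) by simp
    have "real N * h \<le> a * \<Lambda>1 (\<lambda>x. - ln (q x)) + (1 - a) * \<Lambda>2 (\<lambda>x. - ln (q x))"
      by (rule mix[OF N(1) q])
    also have "\<dots> \<le> a * (real N * (h - d) + ln 2) + (1 - a) * (real N * (h + \<eta>) + ln 2)"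
      using b1 b2 a by (intro add_mono mult_left_mono) auto
    also have "\<dots> = real N * h + ln 2 - real N * (a * d) + (1 - a) * (real N * \<eta>)" by (simp add: algebra_simps)
    also have "(1 - a) * (real N * \<eta>) \<le> real N * \<eta>"
      using a \<eta> by (intro mult_left_le_one_le) auto
    finally have "real N * (a * d / 2) \<le> ln 2" by (simp add: \<eta>_def algebra_simps)
    moreover have "ln 2 < real N * (a * d / 2)"
    proof -
      have "ln 2 < real M0 * (a * d / 2)" using M0 a d by (simp add: divide_less_eq)
      also have "\<dots> \<le> real N * (a * d / 2)" using N(3) a d by (intro mult_right_mono) auto
      finally show ?thesis .
    qed
    ultimately show False by simp
  qed
  show ?thesis
    unfolding extremal_in_def
  proof (intro ballI allI impI)
    fix \<Lambda>1 \<Lambda>2 and a :: real assume *: "\<Lambda>1 \<in> inv_states" "\<Lambda>2 \<in> inv_states" "0 < a" "a < 1"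
      "(\<lambda>f. a * \<Lambda>1 f + (1 - a) * \<Lambda>2 f) \<in> {\<Lambda>\<in>inv_states. cost_ge \<epsilon> h \<Lambda>}"
    then have mix: "\<And>n g. 0 < n \<Longrightarrow> pcode \<epsilon> n g \<Longrightarrow>
       real n * h \<le> a * \<Lambda>1 (\<lambda>x. - ln (g x)) + (1 - a) * \<Lambda>2 (\<lambda>x. - ln (g x))"
      by (simp add: cost_ge_def)
    have "cost_ge \<epsilon> h \<Lambda>1" by (rule key[OF *(1-4) mix])
    moreover have "cost_ge \<epsilon> h \<Lambda>2"
      by (rule key[OF *(2,1), of "1 - a"]) (use * mix in \<open>auto simp: add.commute\<close>)
    ultimately show "\<Lambda>1 \<in> {\<Lambda>\<in>inv_states. cost_ge \<epsilon> h \<Lambda>} \<and> \<Lambda>2 \<in> {\<Lambda>\<in>inv_states. cost_ge \<epsilon> h \<Lambda>}"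
      using * by auto
  qed
qed

lemma extremal_max_cost_state:
  assumes e: "0 < \<epsilon>" and ex: "\<exists>\<Lambda>\<in>inv_states. cost_ge \<epsilon> c \<Lambda>"
  obtains h \<Lambda> where "c \<le> h" "\<Lambda> \<in> inv_states" "cost_ge \<epsilon> h \<Lambda>"
    "\<forall>c'>h. \<not> (\<exists>\<Lambda>\<in>inv_states. cost_ge \<epsilon> c' \<Lambda>)" "extremal_in inv_states {\<Lambda>}"
proof -
  obtain h where h: "c \<le> h" "\<exists>\<Lambda>\<in>inv_states. cost_ge \<epsilon> h \<Lambda>"
    "\<forall>c'>h. \<not> (\<exists>\<Lambda>\<in>inv_states. cost_ge \<epsilon> c' \<Lambda>)" using max_cost[OF e ex] by blast
  let ?S = "{\<Lambda>\<in>inv_states. cost_ge \<epsilon> h \<Lambda>}"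
  have S: "?S = inv_states \<inter> {\<Lambda>. cost_ge \<epsilon> h \<Lambda>}" by auto
  have "compact ?S" "closed ?S"
    unfolding S using compact_inv_states
    by (auto intro!: compact_Int_closed closed_Int closed_cost_ge closed_inv_states)
  then obtain \<Lambda> where "\<Lambda> \<in> ?S" "extremal_in inv_states {\<Lambda>}"
    using extremal_singleton_exists[OF _ _ _ max_cost_extremal[OF e h(3)]] h(2) by blast
  then show thesis using h by (intro that[of h \<Lambda>]) auto
qed

end

section \<open>Ergodic measures of large Katok entropy\<close>

context compact_flow
begin

abbreviation "BX \<equiv> restrict_space borel X"

lemma space_BX [simp]: "space BX = X"
  by (simp add: space_restrict_space)

lemma phi_measurable: "(\<lambda>x. phi x t) \<in> measurable BX BX"
  by (intro measurable_restrict_space2 borel_measurable_continuous_on_restrict continuous_phi)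
    (auto simp: phi_in)

lemma phi_joint_measurable: "(\<lambda>p. phi (fst p) (snd p)) \<in> measurable (BX \<Otimes>\<^sub>M borel) BX"
proof (rule measurable_restrict_space2)
  show "(\<lambda>p. phi (fst p) (snd p)) \<in> space (BX \<Otimes>\<^sub>M borel) \<rightarrow> X"
    by (auto simp: space_pair_measure phi_in)
  \<comment> \<open>Time is rounded down to multiples of \<open>1 / (n + 1)\<close>. Each single
    time map is measurable and only countably many occur, so the approximations are measurable for
    the product sigma-algebra; continuity in time gives the limit.\<close>
  define q where "q n s = real_of_int \<lfloor>real (Suc n) * s\<rfloor> / real (Suc n)" for n and s :: real
  show "(\<lambda>p. phi (fst p) (snd p)) \<in> borel_measurable (BX \<Otimes>\<^sub>M borel)"
  proof (rule borel_measurable_LIMSEQ_metric)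
    fix n
    have "(\<lambda>p. (\<lambda>i::int. \<lambda>p. phi (fst p) (real_of_int i / real (Suc n))) \<lfloor>real (Suc n) * snd p\<rfloor> p)
        \<in> borel_measurable (BX \<Otimes>\<^sub>M borel)"
    proof (rule measurable_compose_countable[where f="\<lambda>i p. phi (fst p) (real_of_int i / real (Suc n))"
          and g="\<lambda>p. \<lfloor>real (Suc n) * snd p\<rfloor>"])
      show "(\<lambda>p. phi (fst p) (real_of_int i / real (Suc n))) \<in> borel_measurable (BX \<Otimes>\<^sub>M borel)" for i
        by (rule measurable_compose[OF measurable_fst
             borel_measurable_continuous_on_restrict[OF continuous_phi]])
    qed measurable
    then show "(\<lambda>p. phi (fst p) (q n (snd p))) \<in> borel_measurable (BX \<Otimes>\<^sub>M borel)"
      by (simp add: q_def)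
  next
    fix p assume "p \<in> space (BX \<Otimes>\<^sub>M (borel :: real measure))"
    then have x: "fst p \<in> X" by (auto simp: space_pair_measure)
    have "(\<lambda>n. q n (snd p)) \<longlonglongrightarrow> snd p"
    proof (rule LIMSEQ_I)
      fix e :: real assume "0 < e"
      then obtain n0 where n0: "1 / real (Suc n0) < e" by (metis nat_approx_posE)
      show "\<exists>n0. \<forall>n\<ge>n0. norm (q n (snd p) - snd p) < e"
      proof (intro exI allI impI)
        fix n assume "n0 \<le> n"
        have "\<bar>q n (snd p) - snd p\<bar> = \<bar>real_of_int \<lfloor>real (Suc n) * snd p\<rfloor> - real (Suc n) * snd p\<bar> / real (Suc n)"
          by (simp add: q_def abs_div field_simps flip: abs_divide)
        also have "\<dots> \<le> 1 / real (Suc n)"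
          by (intro divide_right_mono) linarith+
        also have "\<dots> \<le> 1 / real (Suc n0)" using \<open>n0 \<le> n\<close> by (simp add: frac_le)
        finally show "norm (q n (snd p) - snd p) < e" using n0 by simp
      qed
    qed
    then show "(\<lambda>n. phi (fst p) (q n (snd p))) \<longlonglongrightarrow> phi (fst p) (snd p)"
      using continuous_on_tendsto_compose[OF continuous_phi_time[OF x, of UNIV]] by simp
  qed
qed

lemma preimage_sets: "A \<in> sets BX \<Longrightarrow> {x\<in>X. phi x t \<in> A} \<in> sets BX"
  using measurable_sets[OF phi_measurable, of A t] by (simp add: vimage_def Int_def conj_commute)

lemma inv_state_measure_invariant:
  assumes M: "prob_space M" "sets M = sets BX" and L: "\<Lambda> \<in> inv_states"
    and int: "\<And>f. continuous_on X f \<Longrightarrow> integral\<^sup>L M f = \<Lambda> f" and A: "A \<in> sets BX"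
  shows "measure M {x\<in>X. phi x 1 \<in> A} = measure M A"
proof -
  interpret prob_space M by fact
  have sp: "space M = X" using sets_eq_imp_space_eq[OF M(2)] by simp
  have ph: "(\<lambda>x. phi x 1) \<in> measurable M BX"
    using phi_measurable measurable_cong_sets[OF M(2) refl] by blast
  have "distr M BX (\<lambda>x. phi x 1) = M"
  proof (rule prob_eq_if_integrals_eq[OF compact_X])
    show "prob_space (distr M BX (\<lambda>x. phi x 1))" by (rule prob_space_distr[OF ph])
    show "prob_space M" "sets M = sets BX" by fact+
    fix f :: "'a \<Rightarrow> real" assume f: "continuous_on X f"
    have "integral\<^sup>L (distr M BX (\<lambda>x. phi x 1)) f = (\<integral>x. f (phi x 1) \<partial>M)"
      by (rule integral_distr[OF ph borel_measurable_continuous_on_restrict[OF f]])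
    also have "\<dots> = \<Lambda> (\<lambda>x. f (phi x 1))" by (rule int[OF continuous_comp_phi[OF f]])
    also have "\<dots> = integral\<^sup>L M f" using L f int[OF f] by (simp add: inv_states_def)
    finally show "integral\<^sup>L (distr M BX (\<lambda>x. phi x 1)) f = integral\<^sup>L M f" .
  qed simp
  then have "measure M A = measure (distr M BX (\<lambda>x. phi x 1)) A" by simp
  also have "\<dots> = measure M {x\<in>X. phi x 1 \<in> A}"
    using measure_distr[OF ph A] by (simp add: vimage_def Int_def sp conj_commute)
  finally show ?thesis by simp
qed

text \<open>The conditional distribution on \<open>G\<close> viewed as a state; it is in general not
  invariant.\<close>

lemma conditional_state:
  assumes M: "prob_space M" "sets M = sets BX" and G: "G \<in> sets BX" "0 < measure M G"
  shows "(\<lambda>f. if continuous_on X f then (\<integral>x. indicator G x * f x \<partial>M) / measure M G else 0) \<in> states X"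
    and "\<And>f::'a \<Rightarrow> real. continuous_on X f \<Longrightarrow> integrable M (\<lambda>x. indicator G x * f x)"
    and "\<And>f::'a \<Rightarrow> real. continuous_on X f \<Longrightarrow> integrable M f"
proof -
  interpret prob_space M by fact
  have sp: "space M = X" using sets_eq_imp_space_eq[OF M(2)] by simp
  have GM: "G \<in> sets M" using G(1) M(2) by simp
  have GX: "G \<subseteq> X" using sets.sets_into_space[OF GM] sp by simp
  show integ: "integrable M f" if f: "continuous_on X f" for f :: "'a \<Rightarrow> real"
  proof -
    obtain B where "\<And>x. x \<in> X \<Longrightarrow> norm (f x) \<le> B"
      using compact_imp_bounded[OF compact_continuous_image[OF f compact_X]] by (auto simp: bounded_iff)
    moreover have "f \<in> borel_measurable M"
      using borel_measurable_continuous_on_restrict[OF f] measurable_cong_sets[OF M(2) refl] by blast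
    ultimately show ?thesis by (intro integrable_const_bound[where B=B] AE_I2) (auto simp: sp)
  qed
  show integJ: "integrable M (\<lambda>x. indicator G x * f x)" if "continuous_on X f" for f :: "'a \<Rightarrow> real"
    using integrable_real_mult_indicator[OF GM integ[OF that]] by (simp add: mult.commute)
  let ?J = "\<lambda>f. \<integral>x. indicator G x * f x \<partial>M"
  have J1: "?J (\<lambda>x. 1) = measure M G" using GX by (simp add: sp Int_absorb2)
  define \<sigma> where "\<sigma> f = (if continuous_on X f then ?J f / measure M G else 0)" for f
  have "\<sigma> \<in> states X"
    unfolding states_def mem_Collect_eq
  proof (intro conjI allI impI)
    fix f g :: "'a \<Rightarrow> real" assume f: "continuous_on X f"
    have "?J (\<lambda>x. k * f x) = k * ?J f" for k
      by (subst integral_mult_right_zero[symmetric]) (simp add: ac_simps)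
    then show "\<sigma> (\<lambda>x. k * f x) = k * \<sigma> f" for k
      using f by (simp add: \<sigma>_def continuous_on_mult_left)
    show "0 \<le> \<sigma> f" if "\<forall>x\<in>X. 0 \<le> f x"
      using f that G(2) unfolding \<sigma>_def
      by (auto intro!: divide_nonneg_nonneg integral_nonneg_AE AE_I2 simp: sp)
    assume g: "continuous_on X g"
    have "?J (\<lambda>x. f x + g x) = ?J f + ?J g"
      using integJ[OF f] integJ[OF g] by (simp add: distrib_left)
    then show "\<sigma> (\<lambda>x. f x + g x) = \<sigma> f + \<sigma> g"
      using f g by (simp add: \<sigma>_def continuous_on_add add_divide_distrib)
  qed (use J1 G(2) in \<open>auto simp: \<sigma>_def\<close>)
  then show "(\<lambda>f. if continuous_on X f then (\<integral>x. indicator G x * f x \<partial>M) / measure M G else 0) \<in> states X"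
    by (simp add: \<sigma>_def[abs_def])
qed

text \<open>An invariant set of intermediate measure splits \<open>\<Lambda>\<close> into its two
  conditional states, both invariant. Extremality makes the conditional state on \<open>A\<close>
  equal to \<open>\<Lambda>\<close>; as states determine measures, \<open>M\<close> is then
  concentrated on \<open>A\<close>.\<close>

lemma extremal_state_ergodic:
  assumes M: "prob_space M" "sets M = sets BX" and L: "\<Lambda> \<in> inv_states"
    and int: "\<And>f. continuous_on X f \<Longrightarrow> integral\<^sup>L M f = \<Lambda> f"
    and ext: "extremal_in inv_states {\<Lambda>}"
    and A: "A \<in> sets BX" "{x\<in>X. phi x 1 \<in> A} = A"
  shows "measure M A = 0 \<or> measure M A = 1"
proof (rule ccontr)
  assume neg: "\<not> ?thesis"
  interpret prob_space M by fact
  have sp: "space M = X" using sets_eq_imp_space_eq[OF M(2)] by simp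
  have AM: "A \<in> sets M" using A(1) M(2) by simp
  let ?a = "measure M A"
  have a: "0 < ?a" "?a < 1"
    using neg prob_le_1[of A] measure_nonneg[of M A] by linarith+
  define cs where "cs G f = (if continuous_on X f then (\<integral>x. indicator G x * f x \<partial>M) / measure M G else 0)" for G f
  have inv: "measure M {x\<in>X. phi x 1 \<in> G} = measure M G" if "G \<in> sets BX" for G
    by (rule inv_state_measure_invariant[OF M L int that])
  have ph: "(\<lambda>x. phi x 1) \<in> measurable M M"
    using phi_measurable measurable_cong_sets[OF M(2) M(2)] by blast
  have distr: "distr M M (\<lambda>x. phi x 1) = M"
  proof (rule measure_eqI)
    fix G assume "G \<in> sets (distr M M (\<lambda>x. phi x 1))"
    then have G: "G \<in> sets M" by simp
    show "emeasure (distr M M (\<lambda>x. phi x 1)) G = emeasure M G"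
      using inv[of G] G M(2) unfolding emeasure_distr[OF ph G]
      by (simp add: emeasure_eq_measure vimage_def Int_def sp conj_commute)
  qed simp
  have csinv: "cs G \<in> inv_states" if G: "G \<in> sets BX" "0 < measure M G" "{x\<in>X. phi x 1 \<in> G} = G" for G
    unfolding inv_states_def
  proof (intro CollectI conjI allI impI)
    show "cs G \<in> states X" unfolding cs_def[abs_def] by (rule conditional_state(1)[OF M G(1,2)])
    fix f :: "'a \<Rightarrow> real" assume f: "continuous_on X f"
    have meas: "(\<lambda>x. indicator G x * f x) \<in> borel_measurable M"
      using conditional_state(2)[OF M G(1,2) f] by (rule borel_measurable_integrable)
    have "(\<integral>x. indicator G x * f x \<partial>M) = (\<integral>x. indicator G x * f x \<partial>(distr M M (\<lambda>x. phi x 1)))"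
      by (simp add: distr)
    also have "\<dots> = (\<integral>x. indicator G (phi x 1) * f (phi x 1) \<partial>M)"
      by (rule integral_distr[OF ph meas])
    also have "\<dots> = (\<integral>x. indicator G x * f (phi x 1) \<partial>M)"
    proof (intro Bochner_Integration.integral_cong refl)
      fix x assume "x \<in> space M"
      then have "x \<in> X" using sp by simp
      then have "phi x 1 \<in> G \<longleftrightarrow> x \<in> G" using G(3) by blast
      then show "indicator G (phi x 1) * f (phi x 1) = indicator G x * f (phi x 1)" by (simp add: indicator_def)
    qed
    finally show "cs G (\<lambda>x. f (phi x 1)) = cs G f"
      using f continuous_comp_phi[OF f, of 1] by (simp add: cs_def)
  qed
  have B: "X - A \<in> sets BX" "{x\<in>X. phi x 1 \<in> X - A} = X - A"
    using sets.compl_sets[OF A(1)] A(2) phi_in by auto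
  have mB: "measure M (X - A) = 1 - ?a" using prob_compl[OF AM] sp by simp
  have "\<Lambda> = (\<lambda>f. ?a * cs A f + (1 - ?a) * cs (X - A) f)"
  proof
    fix f
    show "\<Lambda> f = ?a * cs A f + (1 - ?a) * cs (X - A) f"
    proof (cases "continuous_on X f")
      case True
      have "(\<integral>x. f x \<partial>M) = (\<integral>x. indicator A x * f x + indicator (X - A) x * f x \<partial>M)"
        by (intro Bochner_Integration.integral_cong refl) (auto simp: sp indicator_def)
      also have "\<dots> = (\<integral>x. indicator A x * f x \<partial>M) + (\<integral>x. indicator (X - A) x * f x \<partial>M)"
        using a mB by (intro Bochner_Integration.integral_add conditional_state(2)[OF M] True A B) auto
      finally show ?thesis using True a mB int[OF True] by (simp add: cs_def)
    next
      case False
      then show ?thesis using L by (simp add: cs_def inv_states_def states_def)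
    qed
  qed
  then have "cs A = \<Lambda>"
    using ext csinv[OF A(1) a(1) A(2)] csinv[OF B(1) _ B(2)] a mB unfolding extremal_in_def by fastforce
  define Q where "Q = density M (\<lambda>x. ennreal (indicator A x / ?a))"
  have Qe: "emeasure Q G = ennreal (measure M (A \<inter> G) / ?a)" if "G \<in> sets M" for G
  proof -
    have "emeasure Q G = (\<integral>\<^sup>+x. ennreal (1 / ?a) * indicator (A \<inter> G) x \<partial>M)"
      unfolding Q_def using that AM
      by (subst emeasure_density) (auto intro!: nn_integral_cong simp: indicator_def)
    also have "\<dots> = ennreal (1 / ?a) * emeasure M (A \<inter> G)"
      using that AM by (subst nn_integral_cmult_indicator) auto
    finally show ?thesis using a by (simp add: emeasure_eq_measure flip: ennreal_mult')
  qed
  have "Q = M"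
  proof (rule prob_eq_if_integrals_eq[OF compact_X])
    show "prob_space Q"
      using Qe[of X] a sets.top[of M] sets.sets_into_space[OF AM] by (intro prob_spaceI) (simp add: Q_def sp Int_absorb2)
    show "sets Q = sets BX" using M(2) by (simp add: Q_def)
    show "prob_space M" "sets M = sets BX" by fact+
    fix f :: "'a \<Rightarrow> real" assume f: "continuous_on X f"
    have fm: "f \<in> borel_measurable M"
      using borel_measurable_integrable[OF conditional_state(3)[OF M A(1) a(1) f]] .
    have "integral\<^sup>L Q f = (\<integral>x. (indicator A x / ?a) *\<^sub>R f x \<partial>M)"
      unfolding Q_def using fm AM a by (intro integral_density) auto
    also have "\<dots> = cs A f" using f by (simp add: cs_def)
    also have "\<dots> = integral\<^sup>L M f" using \<open>cs A = \<Lambda>\<close> int[OF f] by simp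
    finally show "integral\<^sup>L Q f = integral\<^sup>L M f" .
  qed
  then have "emeasure M (X - A) = ennreal (measure M (A \<inter> (X - A)) / ?a)" using Qe[of "X - A"] B(1) M(2) by simp
  then have "measure M (X - A) = 0" by (simp add: Int_Diff emeasure_eq_measure)
  then show False using mB a by simp
qed

text \<open>A code for the balls over \<open>G\<close>, mixed with a cheap code for the conditional
  state off \<open>G\<close>, has mean cost at most the right-hand side, and no code costs less than
  \<open>N * h\<close>. When \<open>c\<close> is close to \<open>h\<close> this gives
  \<open>ln (card E)\<close> of order \<open>N * h\<close>, whatever the mass of
  \<open>G\<close>.\<close>

lemma covering_count_ge:
  assumes e: "0 < \<epsilon>" and M: "prob_space M" "sets M = sets (restrict_space borel X)"
    and int: "\<And>f. continuous_on X f \<Longrightarrow> integral\<^sup>L M f = \<Lambda> f" and h: "cost_ge \<epsilon> h \<Lambda>" and N: "0 < N"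
    and cheap: "\<And>\<sigma>. \<sigma> \<in> states X \<Longrightarrow> \<exists>g. pcode \<epsilon> N g \<and> \<sigma> (\<lambda>x. - ln (g x)) < real N * c"
    and E: "finite E" and G: "G \<in> sets M" "G \<subseteq> (\<Union>y\<in>E. bowen_ball X phi N y \<epsilon>)" "0 < measure M G"
  shows "real N * h \<le> measure M G * ln (card E) + (1 - measure M G) * (real N * c) + ln 2"
proof -
  interpret prob_space M by fact
  have sp: "space M = X" using sets_eq_imp_space_eq[OF M(2)] by (simp add: space_restrict_space)
  have GX: "G \<subseteq> X" using sets.sets_into_space[OF G(1)] sp by simp
  have Ene: "E \<noteq> {}" using G by auto
  let ?a = "measure M G"
  let ?J = "\<lambda>f. \<integral>x. indicator (X - G) x * f x \<partial>M"
  have XG: "X - G \<in> sets M" using sets.compl_sets[OF G(1)] sp by simp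
  have mXG: "measure M (X - G) = 1 - ?a" using prob_compl[OF G(1)] sp by simp
  have "\<exists>g. pcode \<epsilon> N g \<and> ?J (\<lambda>x. - ln (g x)) \<le> (1 - ?a) * (real N * c)"
  proof (cases "?a = 1")
    \<comment> \<open>There is no conditional state off \<open>G\<close> here, but the complement is
      null, so any positive code will do.\<close>
    case True
    obtain K where "\<And>n. \<exists>u. pcode \<epsilon> n u \<and> (\<forall>x\<in>X. - ln (u x) \<le> real n * ln K)"
      using uniform_pcode[OF e] by blast
    then obtain u where u: "pcode \<epsilon> N u" by metis
    have "AE x in M. x \<notin> X - G"
      using mXG True XG by (intro AE_not_in) (auto simp: null_sets_def emeasure_eq_measure)
    then have "?J (\<lambda>x. - ln (u x)) = 0"
      by (intro integral_eq_zero_AE) (auto simp: indicator_def elim!: eventually_mono)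
    then show ?thesis using u True by auto
  next
    case False
    then have a1: "0 < 1 - ?a" using prob_le_1[of G] by linarith
    define \<sigma> where "\<sigma> f = (if continuous_on X f then ?J f / measure M (X - G) else 0)" for f
    have "\<sigma> \<in> states X"
      unfolding \<sigma>_def[abs_def] using XG M(2) a1 mXG by (intro conditional_state(1)[OF M]) auto
    from cheap[OF this] obtain g where g: "pcode \<epsilon> N g" "\<sigma> (\<lambda>x. - ln (g x)) < real N * c" by blast
    then have "?J (\<lambda>x. - ln (g x)) / (1 - ?a) < real N * c"
      using continuous_ln_pcode[OF g(1) e] by (simp add: \<sigma>_def mXG)
    then have "?J (\<lambda>x. - ln (g x)) \<le> (1 - ?a) * (real N * c)"
      using a1 pos_divide_less_eq[OF a1, of "?J (\<lambda>x. - ln (g x))"] by (simp only: mult.commute less_imp_le)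
    then show ?thesis using g(1) by blast
  qed
  then obtain g2 where g2: "pcode \<epsilon> N g2" "?J (\<lambda>x. - ln (g2 x)) \<le> (1 - ?a) * (real N * c)" by blast
  obtain g1 where g1: "code \<epsilon> N g1" "\<And>x. x \<in> (\<Union>y\<in>E. bowen_ball X phi N y \<epsilon>) \<Longrightarrow> 1 / card E \<le> g1 x"
    using code_cover[OF e E Ene] by blast
  define q where "q x = (1/2) * g2 x + (1 - 1/2) * g1 x" for x
  have q: "pcode \<epsilon> N q" unfolding q_def by (intro pcode_mix g2 g1) auto
  have cE: "0 < real (card E)" using E Ene by (simp add: card_gt_0_iff)
  have qle: "- ln (q x) \<le> indicator G x * ln (card E) + ln 2 + indicator (X - G) x * (- ln (g2 x))" if x: "x \<in> X" for x
  proof (cases "x \<in> G")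
    case True
    have p: "0 < g2 x" "0 < 1 / real (card E)" "1 / card E \<le> g1 x"
      using g2(1) x cE g1(2)[of x] subsetD[OF G(2) True] by (auto simp: pcode_def)
    have "ln (1 / card E / 2) \<le> ln (q x)" using p by (intro ln_mono) (auto simp: q_def add_pos_pos)
    moreover have "ln (1 / card E / 2) = - ln (card E) - ln 2" using cE by (simp add: ln_div ln_mult_pos)
    ultimately show ?thesis using True by simp
  next
    case False
    have p: "0 < g2 x" "0 \<le> g1 x" using g2(1) x code_01[OF g1(1) x] by (auto simp: pcode_def)
    then have "ln (g2 x / 2) \<le> ln (q x)" by (intro ln_mono) (auto simp: q_def add_pos_nonneg)
    then show ?thesis using False x p by (simp add: ln_div)
  qed
  have iG: "integrable M (\<lambda>x. indicator G x * ln (card E))"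
    using G(1) by (intro integrable_mult_left integrable_real_indicator) (auto simp: less_top[symmetric])
  have integ: "integrable M f" if "continuous_on X f" for f :: "'a \<Rightarrow> real"
    using conditional_state(3)[OF M _ G(3) that] G(1) M(2) by simp
  have i2: "integrable M (\<lambda>x. indicator (X - G) x * (- ln (g2 x)))"
    using integrable_real_mult_indicator[OF XG integ[OF continuous_ln_pcode[OF g2(1) e]]] by (simp add: mult.commute)
  have "real N * h \<le> \<Lambda> (\<lambda>x. - ln (q x))" using h N q by (simp add: cost_ge_def)
  also have "\<dots> = (\<integral>x. - ln (q x) \<partial>M)" by (rule int[symmetric, OF continuous_ln_pcode[OF q e]])
  also have "\<dots> \<le> (\<integral>x. indicator G x * ln (card E) + ln 2 + indicator (X - G) x * (- ln (g2 x)) \<partial>M)"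
    using qle by (intro integral_mono integ continuous_ln_pcode[OF q e] Bochner_Integration.integrable_add iG i2)
      (auto simp: sp)
  also have "\<dots> = ?a * ln (card E) + ln 2 + ?J (\<lambda>x. - ln (g2 x))"
    using iG i2 GX prob_space by (simp add: sp Int_absorb2)
  finally show ?thesis using g2(2) by simp
qed

section \<open>From time-one ergodicity to flow ergodicity\<close>

lemma ergodic_measuresD:
  assumes "\<mu> \<in> ergodic_measures X phi"
  shows "prob_space \<mu>" "sets \<mu> = sets BX" "space \<mu> = X"
    "\<And>t A. A \<in> sets BX \<Longrightarrow> measure \<mu> {x\<in>X. phi x t \<in> A} = measure \<mu> A"
    "\<And>A. A \<in> sets BX \<Longrightarrow> (\<And>t. {x\<in>X. phi x t \<in> A} = A) \<Longrightarrow> measure \<mu> A = 0 \<or> measure \<mu> A = 1"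
  using assms sets_eq_imp_space_eq[of \<mu> BX] by (auto simp: ergodic_measures_def)

lemma nn_integral_periodic_shift:
  fixes k :: "real \<Rightarrow> ennreal"
  assumes k: "k \<in> borel_measurable borel" "\<And>s. k (s + 1) = k s" and t: "0 \<le> t" "t \<le> 1"
  shows "(\<integral>\<^sup>+s. k (t + s) * indicator {0<..1} s \<partial>lborel) = (\<integral>\<^sup>+s. k s * indicator {0<..1} s \<partial>lborel)"
proof -
  have [measurable]: "k \<in> borel_measurable borel" by fact
  have "(\<integral>\<^sup>+s. k s * indicator {t<..1 + t} s \<partial>lborel) = (\<integral>\<^sup>+s. k (t + s) * indicator {t<..1 + t} (t + s) \<partial>lborel)"
    using nn_integral_real_affine[of "\<lambda>s. k s * indicator {t<..1 + t} s" 1 t] by simp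
  also have "\<dots> = (\<integral>\<^sup>+s. k (t + s) * indicator {0<..1} s \<partial>lborel)"
    by (intro nn_integral_cong) (auto simp: indicator_def)
  finally have 1: "(\<integral>\<^sup>+s. k (t + s) * indicator {0<..1} s \<partial>lborel) = (\<integral>\<^sup>+s. k s * indicator {t<..1 + t} s \<partial>lborel)" by simp
  have "(\<integral>\<^sup>+s. k s * indicator {1<..1 + t} s \<partial>lborel) = (\<integral>\<^sup>+s. k (1 + s) * indicator {1<..1 + t} (1 + s) \<partial>lborel)"
    using nn_integral_real_affine[of "\<lambda>s. k s * indicator {1<..1 + t} s" 1 1] by simp
  also have "\<dots> = (\<integral>\<^sup>+s. k s * indicator {0<..t} s \<partial>lborel)"
    using k(2) by (intro nn_integral_cong) (auto simp: indicator_def add.commute)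
  finally have 2: "(\<integral>\<^sup>+s. k s * indicator {1<..1 + t} s \<partial>lborel) = (\<integral>\<^sup>+s. k s * indicator {0<..t} s \<partial>lborel)" .
  have "(\<integral>\<^sup>+s. k s * indicator {t<..1 + t} s \<partial>lborel)
      = (\<integral>\<^sup>+s. k s * indicator {t<..1} s + k s * indicator {1<..1 + t} s \<partial>lborel)"
    using t by (intro nn_integral_cong) (auto simp: indicator_def)
  also have "\<dots> = (\<integral>\<^sup>+s. k s * indicator {t<..1} s \<partial>lborel) + (\<integral>\<^sup>+s. k s * indicator {0<..t} s \<partial>lborel)"
    by (subst nn_integral_add) (auto simp: 2)
  also have "\<dots> = (\<integral>\<^sup>+s. k s * indicator {t<..1} s + k s * indicator {0<..t} s \<partial>lborel)"
    by (subst nn_integral_add) auto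
  also have "\<dots> = (\<integral>\<^sup>+s. k s * indicator {0<..1} s \<partial>lborel)"
    using t by (intro nn_integral_cong) (auto simp: indicator_def)
  finally show ?thesis using 1 by simp
qed

text \<open>The average over \<open>s\<close> in the unit interval of the images of \<open>M\<close>
  under \<open>\<phi>_s\<close>. As a function of \<open>s\<close> the measure of a preimage has
  period 1, so the average does not notice a shift in time. A flow-invariant set has the same mass
  for \<open>\<mu>\<close> and \<open>M\<close>, hence mass 0 or 1. An average that exceeds
  \<open>d\<close> must do so on some slice.\<close>

lemma flow_average_measure:
  assumes M: "prob_space M" "sets M = sets BX"
    and inv: "\<And>A. A \<in> sets BX \<Longrightarrow> measure M {x\<in>X. phi x 1 \<in> A} = measure M A"
    and erg: "\<And>A. A \<in> sets BX \<Longrightarrow> {x\<in>X. phi x 1 \<in> A} = A \<Longrightarrow> measure M A = 0 \<or> measure M A = 1"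
  shows "\<exists>\<mu>\<in>ergodic_measures X phi. \<forall>A\<in>sets BX. \<forall>d\<ge>0. d < measure \<mu> A \<longrightarrow>
           (\<exists>s\<in>{0..1}. d < measure M {x\<in>X. phi x s \<in> A})"
proof -
  interpret M: prob_space M by fact
  have sp: "space M = X" using sets_eq_imp_space_eq[OF M(2)] by simp
  define Q where "Q = uniform_measure lborel {0<..1::real}"
  have Q: "prob_space Q" unfolding Q_def by (rule prob_space_uniform_measure) auto
  interpret Q: prob_space Q by fact
  interpret P: pair_prob_space M Q by standard
  have setsQ: "sets Q = sets borel" by (simp add: Q_def)
  have joint: "(\<lambda>p. phi (fst p) (snd p)) \<in> measurable (M \<Otimes>\<^sub>M Q) BX"
    using phi_joint_measurable measurable_cong_sets[OF sets_pair_measure_cong[OF M(2) setsQ] refl] by blast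
  define \<mu> where "\<mu> = distr (M \<Otimes>\<^sub>M Q) BX (\<lambda>p. phi (fst p) (snd p))"
  have p\<mu>: "prob_space \<mu>" unfolding \<mu>_def by (rule P.prob_space_distr[OF joint])
  interpret \<mu>: prob_space \<mu> by fact
  have s\<mu>: "sets \<mu> = sets BX" by (simp add: \<mu>_def)
  define k where "k A s = emeasure M {x\<in>X. phi x s \<in> A}" for A s
  have pre: "{x\<in>X. phi x s \<in> A} \<in> sets M" if "A \<in> sets BX" for A s
    using preimage_sets[OF that] M(2) by simp
  have kmeas: "k A \<in> borel_measurable borel"
    and e\<mu>: "emeasure \<mu> A = (\<integral>\<^sup>+s. k A s * indicator {0<..1} s \<partial>lborel)" if A: "A \<in> sets BX" for A
  proof -
    let ?S = "(\<lambda>p. phi (fst p) (snd p)) -` A \<inter> space (M \<Otimes>\<^sub>M Q)"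
    have S: "?S \<in> sets (M \<Otimes>\<^sub>M Q)" by (rule measurable_sets[OF joint A])
    have slice: "emeasure M ((\<lambda>x. (x, s)) -` ?S) = k A s" for s
      unfolding k_def by (intro arg_cong[where f="emeasure M"]) (auto simp: space_pair_measure sp Q_def)
    have "k A \<in> borel_measurable Q"
      using P.measurable_emeasure_Pair2[OF S] unfolding slice .
    then show km: "k A \<in> borel_measurable borel" using measurable_cong_sets[OF setsQ refl] by blast
    have "emeasure \<mu> A = (\<integral>\<^sup>+s. k A s \<partial>Q)"
      unfolding \<mu>_def emeasure_distr[OF joint A] P.emeasure_pair_measure_alt2[OF S] slice ..
    also have "\<dots> = (\<integral>\<^sup>+s. k A s * indicator {0<..1} s \<partial>lborel) / emeasure lborel {0<..1::real}"
      unfolding Q_def using km by (intro nn_integral_uniform_measure) auto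
    finally show "emeasure \<mu> A = (\<integral>\<^sup>+s. k A s * indicator {0<..1} s \<partial>lborel)"
      by (simp add: divide_ennreal_def)
  qed
  have kper: "k A (s + 1) = k A s" if A: "A \<in> sets BX" for A s
  proof -
    have "{x\<in>X. phi x (s + 1) \<in> A} = {x\<in>X. phi x 1 \<in> {x\<in>X. phi x s \<in> A}}"
      by (auto simp: phi_phi phi_in)
    then show ?thesis using inv[OF preimage_sets[OF A, of s]] by (simp add: k_def M.emeasure_eq_measure)
  qed
  have kshift: "k {x\<in>X. phi x t \<in> A} s = k A (t + s)" if A: "A \<in> sets BX" for A s t
  proof -
    have "{x\<in>X. phi x s \<in> {x\<in>X. phi x t \<in> A}} = {x\<in>X. phi x (t + s) \<in> A}"
      by (auto simp: phi_phi phi_in)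
    then show ?thesis by (simp add: k_def)
  qed
  have inv1: "measure \<mu> {x\<in>X. phi x t \<in> A} = measure \<mu> A" if A: "A \<in> sets BX" and t: "0 \<le> t" "t \<le> 1" for A t
  proof -
    have "emeasure \<mu> {x\<in>X. phi x t \<in> A} = emeasure \<mu> A"
      unfolding e\<mu>[OF A] e\<mu>[OF preimage_sets[OF A]] kshift[OF A]
      by (rule nn_integral_periodic_shift[OF kmeas[OF A] kper[OF A] t])
    then show ?thesis by (simp add: measure_def)
  qed
  have step: "{x\<in>X. phi x (s + t) \<in> A} = {x\<in>X. phi x t \<in> {x\<in>X. phi x s \<in> A}}" for s t A
    by (auto simp: phi_phi phi_in)
  have inv_nat: "measure \<mu> {x\<in>X. phi x (r + real n) \<in> A} = measure \<mu> A"
    if A: "A \<in> sets BX" and r: "0 \<le> r" "r \<le> 1" for A r n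
  proof (induction n)
    case 0
    then show ?case using inv1[OF A r] by simp
  next
    case (Suc n)
    have "measure \<mu> {x\<in>X. phi x (r + real n + 1) \<in> A} = measure \<mu> {x\<in>X. phi x (r + real n) \<in> A}"
      unfolding step[of "r + real n" 1] by (rule inv1[OF preimage_sets[OF A]]) auto
    then show ?case using Suc by (simp add: algebra_simps)
  qed
  have inv_pos: "measure \<mu> {x\<in>X. phi x t \<in> A} = measure \<mu> A" if A: "A \<in> sets BX" and t: "0 \<le> t" for A t
  proof -
    have "t = frac t + real (nat \<lfloor>t\<rfloor>)" using t by (simp add: frac_def)
    then show ?thesis
      using inv_nat[OF A frac_ge_0 less_imp_le[OF frac_lt_1], of t "nat \<lfloor>t\<rfloor>"] by metis
  qed
  have inv_all: "measure \<mu> {x\<in>X. phi x t \<in> A} = measure \<mu> A" if A: "A \<in> sets BX" for A t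
  proof (cases "0 \<le> t")
    case False
    \<comment> \<open>For negative \<open>t\<close> the invariance under the positive time
      \<open>- t\<close> is applied to the preimage.\<close>
    have "measure \<mu> {x\<in>X. phi x (- t) \<in> {x\<in>X. phi x t \<in> A}} = measure \<mu> {x\<in>X. phi x t \<in> A}"
      using False by (intro inv_pos preimage_sets[OF A]) auto
    moreover have "{x\<in>X. phi x (- t) \<in> {x\<in>X. phi x t \<in> A}} = A"
      using sets.sets_into_space[OF A] by (auto simp: phi_phi phi_in)
    ultimately show ?thesis by simp
  qed (rule inv_pos[OF A])
  have erg_all: "measure \<mu> A = 0 \<or> measure \<mu> A = 1"
    if A: "A \<in> sets BX" and ia: "\<And>t. {x\<in>X. phi x t \<in> A} = A" for A
  proof -
    have "emeasure \<mu> A = (\<integral>\<^sup>+s. emeasure M A * indicator {0<..1} s \<partial>(lborel :: real measure))"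
      unfolding e\<mu>[OF A] k_def ia ..
    also have "\<dots> = emeasure M A"
      by (subst nn_integral_cmult_indicator) auto
    finally have "measure \<mu> A = measure M A" by (simp add: measure_def)
    then show ?thesis using erg[OF A ia] by simp
  qed
  have "\<mu> \<in> ergodic_measures X phi"
    unfolding ergodic_measures_def using p\<mu> s\<mu> inv_all erg_all by auto
  moreover have "\<exists>s\<in>{0..1}. d < measure M {x\<in>X. phi x s \<in> A}"
    if A: "A \<in> sets BX" and d: "0 \<le> d" "d < measure \<mu> A" for A d
  proof (rule ccontr)
    assume "\<not> ?thesis"
    then have le: "measure M {x\<in>X. phi x s \<in> A} \<le> d" if "s \<in> {0..1}" for s using that by force
    have "emeasure \<mu> A \<le> (\<integral>\<^sup>+s. ennreal d * indicator {0<..1} s \<partial>(lborel :: real measure))"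
      unfolding e\<mu>[OF A] k_def M.emeasure_eq_measure using le
      by (intro nn_integral_mono) (auto simp: indicator_def ennreal_leI)
    also have "\<dots> = ennreal d" by (subst nn_integral_cmult_indicator) auto
    finally show False using d by (simp add: \<mu>.emeasure_eq_measure)
  qed
  ultimately show ?thesis by blast
qed

end

text \<open>\<open>L\<close> is the Lipschitz constant for \<open>t0 = 1\<close>, taken at least 1.
  Orbits are compared at integer times and \<open>L\<close> bridges the fractional part.\<close>

locale lipschitz_flow = compact_flow +
  fixes L :: real
  assumes L_ge_1: "1 \<le> L"
    and lip: "\<lbrakk>0 < \<epsilon>; x \<in> X; y \<in> X; dist x y \<le> \<epsilon> / L; 0 \<le> s; s \<le> 1\<rbrakk> \<Longrightarrow> dist (phi x s) (phi y s) < \<epsilon>"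
begin

lemma bowen_ball_subset: "bowen_ball X phi n x \<epsilon> \<subseteq> X"
  by (auto simp: bowen_ball_def)

lemma openin_bowen_ball: "x \<in> X \<Longrightarrow> openin (top_of_set X) (bowen_ball X phi n x \<epsilon>)"
proof (induction n)
  case 0
  then show ?case by (simp add: bowen_ball_def)
next
  case (Suc n)
  have "bowen_ball X phi (Suc n) x \<epsilon> = bowen_ball X phi n x \<epsilon> \<inter> (X \<inter> (\<lambda>y. phi y (real n)) -` ball (phi x (real n)) \<epsilon>)"
    by (auto simp: bowen_ball_def less_Suc_eq)
  moreover have "openin (top_of_set X) (X \<inter> (\<lambda>y. phi y (real n)) -` ball (phi x (real n)) \<epsilon>)"
    by (rule continuous_openin_preimage_gen[OF continuous_phi open_ball])
  ultimately show ?case using Suc openin_Int by metis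
qed

lemma openin_sets: "openin (top_of_set X) A \<Longrightarrow> A \<in> sets BX"
  unfolding openin_open sets_restrict_space by (metis borel_open image_eqI)

lemma bowen_ball_sets: "x \<in> X \<Longrightarrow> bowen_ball X phi n x \<epsilon> \<in> sets BX"
  by (rule openin_sets[OF openin_bowen_ball])

lemma finite_bowen_cover:
  assumes "0 < \<epsilon>"
  shows "\<exists>E. finite E \<and> E \<subseteq> X \<and> X = (\<Union>x\<in>E. bowen_ball X phi n x \<epsilon>)"
proof -
  have "\<forall>x\<in>X. \<exists>W. open W \<and> bowen_ball X phi n x \<epsilon> = X \<inter> W"
    using openin_bowen_ball by (auto simp: openin_open)
  then obtain W where W: "\<And>x. x \<in> X \<Longrightarrow> open (W x)" "\<And>x. x \<in> X \<Longrightarrow> bowen_ball X phi n x \<epsilon> = X \<inter> W x" by metis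
  have "X \<subseteq> (\<Union>x\<in>X. W x)"
  proof
    fix x assume "x \<in> X"
    then have "x \<in> bowen_ball X phi n x \<epsilon>" using assms by (simp add: bowen_ball_def)
    then show "x \<in> (\<Union>x\<in>X. W x)" using W(2) \<open>x \<in> X\<close> by blast
  qed
  then obtain E where E: "E \<subseteq> X" "finite E" "X \<subseteq> (\<Union>x\<in>E. W x)"
    using compactE_image[OF compact_X, of X W] W(1) by metis
  have "X = (\<Union>x\<in>E. bowen_ball X phi n x \<epsilon>)"
  proof
    show "X \<subseteq> (\<Union>x\<in>E. bowen_ball X phi n x \<epsilon>)" using E W(2) by blast
    show "(\<Union>x\<in>E. bowen_ball X phi n x \<epsilon>) \<subseteq> X" using bowen_ball_subset by blast
  qed
  then show ?thesis using E by blast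
qed

lemma katok_R_attained:
  assumes \<mu>: "\<mu> \<in> ergodic_measures X phi" and e: "0 < \<epsilon>" and \<delta>: "\<delta> < 1"
  obtains E where "finite E" "E \<subseteq> X" "card E = katok_R \<mu> X phi n \<epsilon> \<delta>"
    "\<delta> < measure \<mu> (\<Union>x\<in>E. bowen_ball X phi n x \<epsilon>)"
proof -
  obtain E where "finite E" "E \<subseteq> X" "X = (\<Union>x\<in>E. bowen_ball X phi n x \<epsilon>)"
    using finite_bowen_cover[OF e, of n] by metis
  then have "\<exists>k E. finite E \<and> E \<subseteq> X \<and> card E = k \<and> measure \<mu> (\<Union>x\<in>E. bowen_ball X phi n x \<epsilon>) > \<delta>"
    using prob_space.prob_space[OF ergodic_measuresD(1)[OF \<mu>]] ergodic_measuresD(3)[OF \<mu>] \<delta> by metis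
  from LeastI_ex[OF this, folded katok_R_def] obtain E where
    "finite E" "E \<subseteq> X" "card E = katok_R \<mu> X phi n \<epsilon> \<delta>" "\<delta> < measure \<mu> (\<Union>x\<in>E. bowen_ball X phi n x \<epsilon>)"
    by blast
  then show thesis by (rule that)
qed

text \<open>A family of balls with \<open>\<mu>\<close>-mass above \<open>\<delta>\<close> has, at
  some time \<open>s\<close>, a preimage of \<open>M\<close>-mass above \<open>\<delta>\<close>.
  Moving the centres along the flow turns it into a cover for \<open>M\<close> at a scale larger by
  the factor \<open>L\<close>, to which \<open>covering_count_ge\<close> applies.\<close>

lemma katok_lower_ge:
  assumes e: "0 < \<epsilon>" and \<mu>: "\<mu> \<in> ergodic_measures X phi"
    and M: "prob_space M" "sets M = sets BX" and L: "\<Lambda> \<in> inv_states"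
    and int: "\<And>f. continuous_on X f \<Longrightarrow> integral\<^sup>L M f = \<Lambda> f"
    and h: "cost_ge \<epsilon> h \<Lambda>" and max: "\<forall>c'>h. \<not> (\<exists>\<Lambda>\<in>inv_states. cost_ge \<epsilon> c' \<Lambda>)"
    and slice: "\<And>A d. A \<in> sets BX \<Longrightarrow> 0 \<le> d \<Longrightarrow> d < measure \<mu> A \<Longrightarrow>
           \<exists>s\<in>{0..1}. d < measure M {x\<in>X. phi x s \<in> A}"
    and \<delta>: "0 < \<delta>" "\<delta> < 1"
  shows "ereal h \<le> katok_lower \<mu> X phi (\<epsilon> / L) \<delta>"
proof (rule dense_le)
  fix y assume y: "y < ereal h"
  obtain r where r: "y < ereal r" "r < h" using ereal_dense2[OF y] by auto
  \<comment> \<open>Two errors occur, the constant \<open>ln 2\<close> and the excess of the cheap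
    code, each at most \<open>N * \<eta>\<close>. Together they are at most
    \<open>a * N * (h - r)\<close> for every mass \<open>a > \<delta>\<close>.\<close>
  define \<eta> where "\<eta> = \<delta> * (h - r) / 2"
  have \<eta>: "0 < \<eta>" using r \<delta> by (simp add: \<eta>_def)
  obtain N0 where N0: "\<And>N \<sigma>. N0 \<le> N \<Longrightarrow> \<sigma> \<in> states X \<Longrightarrow> \<exists>g. pcode \<epsilon> N g \<and> \<sigma> (\<lambda>x. - ln (g x)) < real N * (h + \<eta>)"
    using cheap_code_for_all_states[OF e, of "h + \<eta>"] max \<eta> by (metis less_add_same_cancel1)
  obtain N1 :: nat where N1: "ln 2 / \<eta> < real N1" using reals_Archimedean2 by blast
  interpret M: prob_space M by fact
  have eL: "0 < \<epsilon> / L" using e L_ge_1 by simp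
  have "r \<le> ln (real (katok_R \<mu> X phi N (\<epsilon> / L) \<delta>)) / real N" if N: "max (max N0 N1) 1 \<le> N" for N
  proof -
    obtain E where E: "finite E" "E \<subseteq> X" "card E = katok_R \<mu> X phi N (\<epsilon> / L) \<delta>"
      "\<delta> < measure \<mu> (\<Union>x\<in>E. bowen_ball X phi N x (\<epsilon> / L))"
      using katok_R_attained[OF \<mu> eL \<delta>(2)] by blast
    let ?G = "\<Union>x\<in>E. bowen_ball X phi N x (\<epsilon> / L)"
    have G: "?G \<in> sets BX" using E by (intro sets.finite_UN bowen_ball_sets) auto
    obtain s where s: "s \<in> {0..1}" "\<delta> < measure M {x\<in>X. phi x s \<in> ?G}"
      using slice[OF G _ E(4)] \<delta> by auto
    \<comment> \<open>By invariance under time one, \<open>s\<close> may be replaced by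
      \<open>s - 1\<close>. A point of \<open>H\<close> is then reached from its image in the balls
      by flowing forward for \<open>1 - s\<close>, a time in the unit interval, where the Lipschitz
      bound is available.\<close>
    define H where "H = {x\<in>X. phi x (s - 1) \<in> ?G}"
    have Hs: "H \<in> sets BX" unfolding H_def by (rule preimage_sets[OF G])
    have "{x\<in>X. phi x s \<in> ?G} = {x\<in>X. phi x 1 \<in> H}"
      unfolding H_def by (auto simp: phi_phi phi_in)
    then have a: "\<delta> < measure M H"
      using s(2) inv_state_measure_invariant[OF M L int Hs] by simp
    define E' where "E' = (\<lambda>c. phi c (1 - s)) ` E"
    have E': "finite E'" "card E' \<le> card E" using E(1) by (auto simp: E'_def card_image_le)
    have cover: "H \<subseteq> (\<Union>y\<in>E'. bowen_ball X phi N y \<epsilon>)"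
    proof
      fix x assume "x \<in> H"
      then obtain c where x: "x \<in> X" and c: "c \<in> E" "phi x (s - 1) \<in> bowen_ball X phi N c (\<epsilon> / L)"
        by (auto simp: H_def)
      have cX: "c \<in> X" using c E by auto
      have "dist (phi (phi c (1 - s)) (real j)) (phi x (real j)) < \<epsilon>" if "j < N" for j
      proof -
        have "dist (phi c (real j)) (phi (phi x (s - 1)) (real j)) < \<epsilon> / L"
          using c(2) that by (simp add: bowen_ball_def)
        then have "dist (phi (phi c (real j)) (1 - s)) (phi (phi (phi x (s - 1)) (real j)) (1 - s)) < \<epsilon>"
          using s(1) cX x by (intro lip[OF e]) (auto simp: phi_in)
        then show ?thesis using x cX by (simp add: phi_phi phi_in algebra_simps)
      qed
      then show "x \<in> (\<Union>y\<in>E'. bowen_ball X phi N y \<epsilon>)"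
        using c(1) x by (auto simp: E'_def bowen_ball_def)
    qed
    let ?a = "measure M H"
    have a1: "?a \<le> 1" by (rule M.prob_le_1)
    have H0: "H \<noteq> {}" using a \<delta> by auto
    then have E'0: "E' \<noteq> {}" using cover by auto
    have "real N * h \<le> ?a * ln (card E') + (1 - ?a) * (real N * (h + \<eta>)) + ln 2"
      using N a \<delta> Hs M(2) by (intro covering_count_ge[OF e M int h _ _ E'(1) _ cover] N0) auto
    moreover have "ln (card E') \<le> ln (card E)"
      using E' E'0 by (intro ln_mono) (auto simp: card_gt_0_iff)
    then have "?a * ln (card E') \<le> ?a * ln (card E)" using a \<delta> by (intro mult_left_mono) auto
    moreover have "(1 - ?a) * (real N * \<eta>) \<le> real N * \<eta>"
      using a1 a \<delta> \<eta> by (intro mult_left_le_one_le) auto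
    moreover have "ln 2 \<le> real N * \<eta>"
    proof -
      have "ln 2 < real N1 * \<eta>" using N1 \<eta> by (simp add: divide_less_eq)
      also have "\<dots> \<le> real N * \<eta>" using N \<eta> by (intro mult_right_mono) auto
      finally show ?thesis by simp
    qed
    moreover have "(1 - ?a) * (real N * (h + \<eta>)) = real N * h - ?a * (real N * h) + (1 - ?a) * (real N * \<eta>)"
      by (simp add: algebra_simps)
    ultimately have "?a * (real N * h) - 2 * (real N * \<eta>) \<le> ?a * ln (card E)" by linarith
    moreover have "2 * (real N * \<eta>) \<le> ?a * (real N * (h - r))"
    proof -
      have "2 * (real N * \<eta>) = \<delta> * (real N * (h - r))" by (simp add: \<eta>_def)
      also have "\<dots> \<le> ?a * (real N * (h - r))" using a r by (intro mult_right_mono) auto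
      finally show ?thesis .
    qed
    ultimately have "?a * (real N * r) \<le> ?a * ln (card E)" by (simp add: algebra_simps)
    then have "real N * r \<le> ln (card E)" using a \<delta> by simp
    then show ?thesis using N E(3) by (simp add: field_simps)
  qed
  then have "eventually (\<lambda>N. ereal r \<le> ereal (ln (real (katok_R \<mu> X phi N (\<epsilon> / L) \<delta>)) / real N)) sequentially"
    unfolding eventually_sequentially by (intro exI[of _ "max (max N0 N1) 1"]) simp
  then have "ereal r \<le> katok_lower \<mu> X phi (\<epsilon> / L) \<delta>"
    unfolding katok_lower_def by (rule Liminf_bounded)
  then show "y \<le> katok_lower \<mu> X phi (\<epsilon> / L) \<delta>" using r by simp
qed

text \<open>The Kraft inequality for the uniform code bounds the size of separated sets of a given
  length, so one of maximal size exists, and maximality makes it spanning.\<close>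

lemma maximal_separated:
  assumes e: "0 < \<epsilon>"
  shows "\<exists>E. finite E \<and> E \<noteq> {} \<and> E \<subseteq> X \<and> separated N (4 * \<epsilon>) E \<and>
     (\<forall>x\<in>X. \<exists>y\<in>E. \<forall>j<N. dist (phi x (real j)) (phi y (real j)) < 4 * \<epsilon>)"
proof -
  define P where "P E \<longleftrightarrow> finite E \<and> E \<subseteq> X \<and> separated N (4 * \<epsilon>) E" for E
  obtain K where K: "1 \<le> K" "\<And>n. \<exists>u. pcode \<epsilon> n u \<and> (\<forall>x\<in>X. - ln (u x) \<le> real n * ln K)"
    using uniform_pcode[OF e] by blast
  obtain u where u: "pcode \<epsilon> N u" "\<And>x. x \<in> X \<Longrightarrow> - ln (u x) \<le> real N * ln K" using K(2) by blast
  have bound: "real (card E) \<le> exp (real N * ln K)" if "P E" for E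
  proof -
    have "exp (- (real N * ln K)) \<le> u x" if "x \<in> E" for x
    proof -
      have "x \<in> X" using that \<open>P E\<close> by (auto simp: P_def)
      then have "0 < u x" "- (real N * ln K) \<le> ln (u x)" using u by (auto simp: pcode_def) (smt (verit))
      then show ?thesis by (simp add: ln_ge_iff)
    qed
    then have "(\<Sum>x\<in>E. exp (- (real N * ln K))) \<le> (\<Sum>x\<in>E. u x)" by (rule sum_mono)
    also have "\<dots> \<le> 1"
      using u(1) that e by (intro code_sum_separated_le_1[of \<epsilon> N]) (auto simp: P_def pcode_def)
    finally have "real (card E) * exp (- (real N * ln K)) \<le> 1" by simp
    then show ?thesis by (simp add: exp_minus field_simps)
  qed
  have bnd: "\<forall>E. P E \<longrightarrow> card E < Suc (nat \<lceil>exp (real N * ln K)\<rceil>)"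
  proof (intro allI impI)
    fix E assume "P E"
    from bound[OF this] show "card E < Suc (nat \<lceil>exp (real N * ln K)\<rceil>)" by linarith
  qed
  obtain x0 where x0: "x0 \<in> X" using X_nonempty by blast
  have "P {x0}" using x0 by (simp add: P_def separated_def)
  then obtain E where E: "P E" "\<And>F. P F \<Longrightarrow> card F \<le> card E"
    using ex_has_greatest_nat[of P "{x0}" card "Suc (nat \<lceil>exp (real N * ln K)\<rceil>)"] bnd by blast
  have "\<exists>y\<in>E. \<forall>j<N. dist (phi x (real j)) (phi y (real j)) < 4 * \<epsilon>" if x: "x \<in> X" for x
  proof (rule ccontr)
    assume *: "\<not> ?thesis"
    then have far: "\<exists>j<N. 4 * \<epsilon> \<le> dist (phi x (real j)) (phi y (real j))" if "y \<in> E" for y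
      using that by (meson not_le)
    have "x \<notin> E" using * e by auto
    moreover have "P (insert x E)"
      using E(1) x far unfolding P_def separated_def by (auto simp: dist_commute)
    ultimately show False using E(2)[of "insert x E"] E(1) by (simp add: P_def)
  qed
  moreover have "E \<noteq> {}" using E(2)[OF \<open>P {x0}\<close>] by auto
  ultimately show ?thesis using E(1) unfolding P_def by blast
qed

text \<open>Every time up to \<open>t\<close> is an integer below \<open>N\<close> plus a fraction,
  and the fraction costs one factor \<open>L\<close>.\<close>

lemma flow_dist_le:
  assumes xy: "x \<in> X" "y \<in> X" and e: "0 < \<epsilon>" and t: "0 \<le> t" "t < real N"
    and close: "\<And>j. j < N \<Longrightarrow> dist (phi x (real j)) (phi y (real j)) < \<epsilon>"
  shows "flow_dist phi t x y \<le> \<epsilon> * L"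
  unfolding flow_dist_def
proof (rule cSUP_least)
  fix s assume s: "s \<in> {0..t}"
  define j where "j = nat \<lfloor>s\<rfloor>"
  have j: "real j \<le> s" "s < real j + 1" "j < N" using s t by (auto simp: j_def) linarith+
  have "dist (phi (phi x (real j)) (s - real j)) (phi (phi y (real j)) (s - real j)) < \<epsilon> * L"
    using close[OF j(3)] j L_ge_1 e xy by (intro lip) (auto simp: phi_in)
  then show "dist (phi x s) (phi y s) \<le> \<epsilon> * L" using xy by (simp add: phi_phi)
qed (use t in auto)

lemma span_num_le:
  assumes "finite E" "E \<subseteq> X" "\<And>x. x \<in> X \<Longrightarrow> \<exists>y\<in>E. flow_dist phi t x y < \<epsilon>"
  shows "span_num X phi t \<epsilon> \<le> card E"
  unfolding span_num_def by (rule Least_le) (use assms in blast)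

lemma ergodic_measure_katok_ge:
  assumes e: "0 < \<epsilon>" and r: "ereal r < span_rate X phi (8 * L\<^sup>2 * \<epsilon>)"
  shows "\<exists>\<mu>\<in>ergodic_measures X phi. \<forall>\<delta>. 0 < \<delta> \<longrightarrow> \<delta> < 1 \<longrightarrow> ereal r \<le> katok_lower \<mu> X phi \<epsilon> \<delta>"
proof -
  \<comment> \<open>The transfer to the flow-ergodic measure loses a factor \<open>L\<close>, which
    \<open>e' = L * \<epsilon>\<close> anticipates. Sets separated by \<open>4 * e'\<close> span at
    that scale, and passing to the flow distance costs another \<open>L\<close>: in all
    \<open>4 * L\<^sup>2 * \<epsilon>\<close>, doubled in the statement for a strict
    inequality.\<close>
  define e' where "e' = L * \<epsilon>"
  have e': "0 < e'" "e' / L = \<epsilon>" using e L_ge_1 by (auto simp: e'_def)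
  obtain h where h: "r < h" "ereal h < span_rate X phi (8 * L\<^sup>2 * \<epsilon>)"
    using ereal_dense2[OF r] by auto
  have "\<exists>\<Lambda>\<in>inv_states. cost_ge e' r \<Lambda>"
  proof (rule inv_state_from_separated[OF e'(1)])
    fix N0 :: nat
    \<comment> \<open>Beyond \<open>N1\<close> the gap between \<open>h\<close> and \<open>r\<close>
      pays for rounding \<open>t\<close> up to an integer:
      \<open>N * r \<le> (N - 1) * h\<close>.\<close>
    obtain N1 :: nat where N1: "h / (h - r) < real N1" using reals_Archimedean2 by blast
    have "frequently (\<lambda>t::real. h < ln (real (span_num X phi t (8 * L\<^sup>2 * \<epsilon>))) / t) at_top"
      using h(2) Limsup_bounded[of "\<lambda>t::real. ereal (ln (real (span_num X phi t (8 * L\<^sup>2 * \<epsilon>))) / t)" "ereal h" at_top]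
      unfolding span_rate_def frequently_def by (auto simp: not_less not_le)
    from frequently_ex[OF frequently_eventually_conj[OF this eventually_ge_at_top[of "max (real N0) (real N1) + 1"]]]
    obtain t where t: "h < ln (real (span_num X phi t (8 * L\<^sup>2 * \<epsilon>))) / t" "max (real N0) (real N1) + 1 \<le> t"
      by blast
    \<comment> \<open>\<open>N\<close> exceeds \<open>t\<close>, so the integer times below
      \<open>N\<close> control the whole interval up to \<open>t\<close>.\<close>
    define N where "N = nat \<lfloor>t\<rfloor> + 1"
    have N: "t < real N" "real N \<le> t + 1" "N0 \<le> N" "N1 \<le> N" using t(2) by (auto simp: N_def) linarith+
    have t0: "1 \<le> t" using t(2) by linarith
    obtain E where E: "finite E" "E \<noteq> {}" "E \<subseteq> X" "separated N (4 * e') E"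
      "\<And>x. x \<in> X \<Longrightarrow> \<exists>y\<in>E. \<forall>j<N. dist (phi x (real j)) (phi y (real j)) < 4 * e'"
      using maximal_separated[OF e'(1), of N] by blast
    have cE: "1 \<le> card E" using E by (simp add: Suc_leI card_gt_0_iff)
    have "span_num X phi t (8 * L\<^sup>2 * \<epsilon>) \<le> card E"
    proof (rule span_num_le[OF E(1,3)])
      fix x assume x: "x \<in> X"
      obtain y where y: "y \<in> E" "\<forall>j<N. dist (phi x (real j)) (phi y (real j)) < 4 * e'" using E(5)[OF x] by blast
      have "flow_dist phi t x y \<le> 4 * e' * L"
        using y E(3) x t0 N e' by (intro flow_dist_le[where N=N]) auto
      also have "\<dots> < 8 * L\<^sup>2 * \<epsilon>" using e L_ge_1 by (simp add: e'_def power2_eq_square)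
      finally show "\<exists>y\<in>E. flow_dist phi t x y < 8 * L\<^sup>2 * \<epsilon>" using y(1) by blast
    qed
    then have "ln (real (span_num X phi t (8 * L\<^sup>2 * \<epsilon>))) \<le> ln (real (card E))"
      using cE by (cases "span_num X phi t (8 * L\<^sup>2 * \<epsilon>) = 0") auto
    then have th: "t * h \<le> ln (card E)" using t(1) t0 by (simp add: field_simps)
    have "real N * r \<le> ln (card E)"
    proof (cases "r \<le> 0")
      case True
      then have "real N * r \<le> 0" by (simp add: mult_nonneg_nonpos)
      also have "0 \<le> ln (card E)" using cE by simp
      finally show ?thesis .
    next
      case False
      have "h < real N1 * (h - r)" using N1 h(1) by (simp add: divide_less_eq)
      also have "\<dots> \<le> real N * (h - r)" using N(4) h(1) by (intro mult_right_mono) auto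
      finally have "real N * r \<le> (real N - 1) * h" by (simp add: algebra_simps)
      also have "\<dots> \<le> t * h" using N(2) False h(1) by (intro mult_right_mono) auto
      finally show ?thesis using th by simp
    qed
    then show "\<exists>N\<ge>N0. \<exists>E. finite E \<and> E \<noteq> {} \<and> E \<subseteq> X \<and> separated N (4 * e') E \<and> real N * r \<le> ln (card E)"
      using N(3) E by blast
  qed
  then obtain c \<Lambda> where c: "r \<le> c" "\<Lambda> \<in> inv_states" "cost_ge e' c \<Lambda>"
    "\<forall>c'>c. \<not> (\<exists>\<Lambda>\<in>inv_states. cost_ge e' c' \<Lambda>)" "extremal_in inv_states {\<Lambda>}"
    by (rule extremal_max_cost_state[OF e'(1)])
  obtain M where M: "prob_space M" "sets M = sets BX" and int: "\<And>f. continuous_on X f \<Longrightarrow> integral\<^sup>L M f = \<Lambda> f"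
    using state_Riesz[OF _ compact_X, of \<Lambda>] c(2) by (auto simp: inv_states_def)
  obtain \<mu> where \<mu>: "\<mu> \<in> ergodic_measures X phi"
    and slice: "\<And>A d. A \<in> sets BX \<Longrightarrow> 0 \<le> d \<Longrightarrow> d < measure \<mu> A \<Longrightarrow> \<exists>s\<in>{0..1}. d < measure M {x\<in>X. phi x s \<in> A}"
    using flow_average_measure[OF M inv_state_measure_invariant[OF M c(2) int] extremal_state_ergodic[OF M c(2) int c(5)]]
    by blast
  have "ereal r \<le> katok_lower \<mu> X phi \<epsilon> \<delta>" if "0 < \<delta>" "\<delta> < 1" for \<delta>
  proof -
    have "ereal c \<le> katok_lower \<mu> X phi (e' / L) \<delta>"
      by (rule katok_lower_ge[OF e'(1) \<mu> M c(2) int c(3,4) slice that])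
    then show ?thesis using c(1) e'(2) order_trans[of "ereal r" "ereal c"] by simp
  qed
  then show ?thesis using \<mu> by blast
qed

end

section \<open>Comparison of Katok, Shapira and Brin--Katok entropies\<close>

lemma ereal_le_of_real_bounds:
  fixes y z :: ereal
  assumes "\<And>c::real. z < ereal c \<Longrightarrow> y \<le> ereal c"
  shows "y \<le> z"
proof (rule dense_ge)
  fix x assume "z < x"
  then obtain c where "z < ereal c" "ereal c < x" using ereal_dense2 by blast
  then show "y \<le> x" using assms[of c] by simp
qed

context lipschitz_flow
begin

section \<open>Spanning sets of the flow\<close>

lemma dist_le_flow_dist:
  assumes "x \<in> X" "y \<in> X" "0 \<le> s" "s \<le> t"
  shows "dist (phi x s) (phi y s) \<le> flow_dist phi t x y"
  unfolding flow_dist_def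
proof (rule cSUP_upper)
  show "bdd_above ((\<lambda>s. dist (phi x s) (phi y s)) ` {0..t})"
  proof (rule bdd_aboveI2)
    fix s show "dist (phi x s) (phi y s) \<le> diameter X"
      using assms by (intro diameter_bounded_bound compact_imp_bounded compact_X phi_in)
  qed
qed (use assms in auto)

lemma span_num_attained:
  assumes e: "0 < \<epsilon>" and t: "0 \<le> t"
  obtains E where "finite E" "E \<subseteq> X" "card E = span_num X phi t \<epsilon>"
    "\<And>x. x \<in> X \<Longrightarrow> \<exists>y\<in>E. flow_dist phi t x y < \<epsilon>"
proof -
  define N where "N = nat \<lfloor>t\<rfloor> + 1"
  have N: "t < real N" using t unfolding N_def by linarith
  \<comment> \<open>Chosen so that \<open>4 * e' * L\<close> is \<open>\<epsilon> / 2\<close>,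
    leaving room for the strict inequality.\<close>
  define e' where "e' = \<epsilon> / (8 * L)"
  have e': "0 < e'" "4 * e' * L < \<epsilon>" using e L_ge_1 by (auto simp: e'_def)
  obtain E where E: "finite E" "E \<subseteq> X"
      "\<And>x. x \<in> X \<Longrightarrow> \<exists>y\<in>E. \<forall>j<N. dist (phi x (real j)) (phi y (real j)) < 4 * e'"
    using maximal_separated[OF e'(1), of N] by metis
  have "\<exists>y\<in>E. flow_dist phi t x y < \<epsilon>" if x: "x \<in> X" for x
  proof -
    obtain y where y: "y \<in> E" "\<And>j. j < N \<Longrightarrow> dist (phi x (real j)) (phi y (real j)) < 4 * e'"
      using E(3)[OF x] by blast
    have "flow_dist phi t x y \<le> 4 * e' * L"
      using y E(2) x t N e' by (intro flow_dist_le[where N=N]) auto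
    then show ?thesis using y(1) e'(2) by (intro bexI[of _ y]) auto
  qed
  then have "\<exists>k E. finite E \<and> E \<subseteq> X \<and> card E = k \<and> (\<forall>x\<in>X. \<exists>y\<in>E. flow_dist phi t x y < \<epsilon>)"
    using E(1,2) by (intro exI[of _ "card E"] exI[of _ E]) auto
  from LeastI_ex[OF this, folded span_num_def] obtain F where
    F: "finite F" "F \<subseteq> X" "card F = span_num X phi t \<epsilon>" "\<forall>x\<in>X. \<exists>y\<in>F. flow_dist phi t x y < \<epsilon>"
    by metis
  show thesis using F(4) by (intro that[OF F(1-3)]) auto
qed

lemma span_cover:
  assumes e: "0 < \<epsilon>"
  obtains E where "finite E" "E \<subseteq> X" "card E = span_num X phi (real n) \<epsilon>"
    "X = (\<Union>y\<in>E. bowen_ball X phi n y \<epsilon>)"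
proof -
  obtain E where E: "finite E" "E \<subseteq> X" "card E = span_num X phi (real n) \<epsilon>"
    "\<And>x. x \<in> X \<Longrightarrow> \<exists>y\<in>E. flow_dist phi (real n) x y < \<epsilon>"
    using span_num_attained[OF e, of "real n"] by auto
  have "x \<in> (\<Union>y\<in>E. bowen_ball X phi n y \<epsilon>)" if x: "x \<in> X" for x
  proof -
    obtain y where y: "y \<in> E" "flow_dist phi (real n) x y < \<epsilon>" using E(4)[OF x] by blast
    have "dist (phi y (real j)) (phi x (real j)) < \<epsilon>" if "j < n" for j
      using dist_le_flow_dist[of x y "real j" "real n"] that x y E(2) by (auto simp: dist_commute)
    then show ?thesis using y(1) x by (auto simp: bowen_ball_def)
  qed
  then have "X = (\<Union>y\<in>E. bowen_ball X phi n y \<epsilon>)" using bowen_ball_subset by blast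
  then show thesis by (rule that[OF E(1-3)])
qed

lemma span_num_pos: "0 < \<epsilon> \<Longrightarrow> 0 \<le> t \<Longrightarrow> 1 \<le> span_num X phi t \<epsilon>"
proof -
  assume "0 < \<epsilon>" "0 \<le> t"
  then obtain E where E: "finite E" "E \<subseteq> X" "card E = span_num X phi t \<epsilon>"
    "\<And>x. x \<in> X \<Longrightarrow> \<exists>y\<in>E. flow_dist phi t x y < \<epsilon>" by (metis span_num_attained)
  then have "E \<noteq> {}" using X_nonempty by blast
  then show ?thesis using E(1,3) by (simp add: Suc_leI card_gt_0_iff flip: E(3))
qed

lemma span_rate_nonneg: "0 < \<epsilon> \<Longrightarrow> 0 \<le> span_rate X phi \<epsilon>"
proof -
  assume e: "0 < \<epsilon>"
  have "eventually (\<lambda>t::real. 0 \<le> ereal (ln (real (span_num X phi t \<epsilon>)) / t)) at_top"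
    using eventually_gt_at_top[of 0]
  proof eventually_elim
    case (elim t)
    then show ?case using span_num_pos[OF e, of t] by simp
  qed
  then have "0 \<le> Liminf at_top (\<lambda>t::real. ereal (ln (real (span_num X phi t \<epsilon>)) / t))"
    by (rule Liminf_bounded)
  also have "\<dots> \<le> span_rate X phi \<epsilon>" unfolding span_rate_def by (rule Liminf_le_Limsup) simp
  finally show ?thesis .
qed

lemma span_rate_less:
  assumes "span_rate X phi \<epsilon> < ereal c"
  shows "\<forall>\<^sub>F n in sequentially. ln (real (span_num X phi (real n) \<epsilon>)) \<le> real n * c"
proof -
  have "eventually (\<lambda>t::real. ereal (ln (real (span_num X phi t \<epsilon>)) / t) < ereal c) at_top"
    using assms unfolding span_rate_def by (rule Limsup_lessD)
  then have "\<forall>\<^sub>F n in sequentially. ln (real (span_num X phi (real n) \<epsilon>)) / real n < c"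
    using filterlim_real_sequentially by (auto simp: filterlim_iff)
  then show ?thesis using eventually_gt_at_top[of 0]
    by eventually_elim (simp add: divide_less_eq mult.commute)
qed

text \<open>The upper limit over real times dominates the one along the integers, so counting
  numbers of the time-one map need only be compared at integers.\<close>

lemma limsup_le_span_rate:
  assumes e: "0 < \<epsilon>" and le: "\<And>n. a n \<le> span_num X phi (real n) \<epsilon>"
  shows "limsup (\<lambda>n. ereal (ln (real (a n)) / real n)) \<le> span_rate X phi \<epsilon>"
proof (rule ereal_le_of_real_bounds)
  fix c assume "span_rate X phi \<epsilon> < ereal c"
  from span_rate_less[OF this]
  have "\<forall>\<^sub>F n in sequentially. ereal (ln (real (a n)) / real n) \<le> ereal c"
    using eventually_gt_at_top[of 0]
  proof eventually_elim
    case (elim n)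
    have "ln (real (a n)) \<le> ln (real (span_num X phi (real n) \<epsilon>))"
      using le[of n] span_num_pos[OF e, of "real n"] by (cases "a n = 0") auto
    then show ?case using elim by (simp add: divide_le_eq mult.commute)
  qed
  then show "limsup (\<lambda>n. ereal (ln (real (a n)) / real n)) \<le> ereal c" by (rule Limsup_bounded)
qed

lemma katok_R_le:
  assumes "finite E" "E \<subseteq> X" "\<delta> < measure \<mu> (\<Union>x\<in>E. bowen_ball X phi n x \<epsilon>)"
  shows "katok_R \<mu> X phi n \<epsilon> \<delta> \<le> card E"
  unfolding katok_R_def by (rule Least_le) (use assms in blast)

lemma katok_upper_le:
  assumes \<mu>: "\<mu> \<in> ergodic_measures X phi" and e: "0 < \<epsilon>" and \<delta>: "\<delta> < 1"
  shows "katok_upper \<mu> X phi \<epsilon> \<delta> \<le> span_rate X phi \<epsilon>"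
  unfolding katok_upper_def
proof (rule limsup_le_span_rate[OF e])
  fix n
  obtain E where E: "finite E" "E \<subseteq> X" "card E = span_num X phi (real n) \<epsilon>"
    "X = (\<Union>y\<in>E. bowen_ball X phi n y \<epsilon>)" using span_cover[OF e] by metis
  have "\<delta> < measure \<mu> (\<Union>y\<in>E. bowen_ball X phi n y \<epsilon>)"
    using prob_space.prob_space[OF ergodic_measuresD(1)[OF \<mu>]] ergodic_measuresD(3)[OF \<mu>] \<delta> E(4) by simp
  from katok_R_le[OF E(1,2) this] show "katok_R \<mu> X phi n \<epsilon> \<delta> \<le> span_num X phi (real n) \<epsilon>" using E(3) by simp
qed

section \<open>Shapira entropy\<close>

lemma finite_join_family: "finite P \<Longrightarrow> finite (join_family X phi P n)"
proof -
  assume P: "finite P"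
  \<comment> \<open>Only the first \<open>n\<close> choices matter, so the choice functions may be
    taken from a finite product.\<close>
  have "join_family X phi P n \<subseteq> (\<lambda>As. X \<inter> (\<Inter>j<n. {x. phi x (real j) \<in> As j})) ` (PiE {..<n} (\<lambda>_. P))"
  proof
    fix A assume "A \<in> join_family X phi P n"
    then obtain As where As: "A = X \<inter> (\<Inter>j<n. {x. phi x (real j) \<in> As j})" "\<forall>j<n. As j \<in> P"
      by (auto simp: join_family_def)
    then show "A \<in> (\<lambda>As. X \<inter> (\<Inter>j<n. {x. phi x (real j) \<in> As j})) ` (PiE {..<n} (\<lambda>_. P))"
      by (intro image_eqI[of _ _ "restrict As {..<n}"]) auto
  qed
  then show ?thesis by (rule finite_subset) (intro finite_imageI finite_PiE, auto simp: P)
qed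

lemma join_family_cover:
  assumes "X \<subseteq> \<Union>P" shows "\<Union>(join_family X phi P n) = X"
proof
  show "\<Union>(join_family X phi P n) \<subseteq> X" by (auto simp: join_family_def)
  show "X \<subseteq> \<Union>(join_family X phi P n)"
  proof
    fix x assume x: "x \<in> X"
    then have "\<exists>A\<in>P. phi x (real j) \<in> A" for j using assms phi_in by blast
    then obtain As where "\<And>j. As j \<in> P" "\<And>j. phi x (real j) \<in> As j" by metis
    then show "x \<in> \<Union>(join_family X phi P n)" using x by (auto simp: join_family_def)
  qed
qed

text \<open>The diameter bound is not strict while Bowen balls are open; the factor 2 bridges
  this.\<close>

lemma join_family_subset_bowen_ball:
  assumes d: "\<And>A. A \<in> P \<Longrightarrow> A \<subseteq> X \<and> diameter A \<le> \<epsilon>" and e: "0 < \<epsilon>"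
    and A: "A \<in> join_family X phi P n" "x \<in> A"
  shows "A \<subseteq> bowen_ball X phi n x (2 * \<epsilon>)"
proof
  fix y assume y: "y \<in> A"
  obtain As where As: "A = X \<inter> (\<Inter>j<n. {x. phi x (real j) \<in> As j})" "\<forall>j<n. As j \<in> P"
    using A by (auto simp: join_family_def)
  have "dist (phi x (real j)) (phi y (real j)) < 2 * \<epsilon>" if j: "j < n" for j
  proof -
    have "As j \<subseteq> X" "diameter (As j) \<le> \<epsilon>" using d As(2) j by auto
    moreover have "phi x (real j) \<in> As j" "phi y (real j) \<in> As j" using A(2) y As j by auto
    ultimately have "dist (phi x (real j)) (phi y (real j)) \<le> \<epsilon>"
      using diameter_bounded_bound[OF bounded_subset[OF compact_imp_bounded[OF compact_X]]] order_trans by blast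
    then show ?thesis using e by simp
  qed
  then show "y \<in> bowen_ball X phi n x (2 * \<epsilon>)" using y As(1) by (auto simp: bowen_ball_def)
qed

text \<open>One point chosen in each nonempty member of \<open>F\<close> serves as the centre of a
  ball containing it; empty members have no centre and are dropped.\<close>

lemma katok_R_le_family:
  assumes d: "\<And>A. A \<in> P \<Longrightarrow> A \<subseteq> X \<and> diameter A \<le> \<epsilon>" and e: "0 < \<epsilon>"
    and F: "finite F" "F \<subseteq> join_family X phi P n" "\<delta> < measure \<mu> (\<Union>F)"
    and \<mu>: "\<mu> \<in> ergodic_measures X phi"
  shows "katok_R \<mu> X phi n (2 * \<epsilon>) \<delta> \<le> card F"
proof -
  interpret prob_space \<mu> by (rule ergodic_measuresD(1)[OF \<mu>])
  define F' where "F' = F - {{}}"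
  have "\<forall>A\<in>F'. \<exists>x. x \<in> A" by (auto simp: F'_def)
  then obtain c where c: "\<And>A. A \<in> F' \<Longrightarrow> c A \<in> A" by metis
  have F'X: "A \<subseteq> X" if "A \<in> F'" for A using that F(2) by (auto simp: F'_def join_family_def)
  have sub: "\<Union>F \<subseteq> (\<Union>x\<in>c ` F'. bowen_ball X phi n x (2 * \<epsilon>))"
  proof
    fix y assume "y \<in> \<Union>F"
    then obtain A where A: "A \<in> F'" "y \<in> A" by (auto simp: F'_def)
    then have "A \<subseteq> bowen_ball X phi n (c A) (2 * \<epsilon>)"
      using F(2) by (intro join_family_subset_bowen_ball[OF d e _ c]) (auto simp: F'_def)
    then show "y \<in> (\<Union>x\<in>c ` F'. bowen_ball X phi n x (2 * \<epsilon>))" using A by auto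
  qed
  have fin: "finite F'" using F(1) by (simp add: F'_def)
  have cX: "c ` F' \<subseteq> X" using c F'X by auto
  have "measure \<mu> (\<Union>F) \<le> measure \<mu> (\<Union>x\<in>c ` F'. bowen_ball X phi n x (2 * \<epsilon>))"
    using sub fin cX bowen_ball_sets ergodic_measuresD(2)[OF \<mu>] by (intro finite_measure_mono sets.finite_UN) auto
  then have "katok_R \<mu> X phi n (2 * \<epsilon>) \<delta> \<le> card (c ` F')"
    using F(3) fin cX by (intro katok_R_le) auto
  also have "\<dots> \<le> card F'" by (rule card_image_le[OF fin])
  also have "\<dots> \<le> card F" using F(1) by (intro card_mono) (auto simp: F'_def)
  finally show ?thesis .
qed

lemma katok_R_pos:
  assumes "\<mu> \<in> ergodic_measures X phi" "0 < \<epsilon>" "0 \<le> \<delta>" "\<delta> < 1"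
  shows "1 \<le> katok_R \<mu> X phi n \<epsilon> \<delta>"
proof -
  obtain E where E: "finite E" "card E = katok_R \<mu> X phi n \<epsilon> \<delta>"
    "\<delta> < measure \<mu> (\<Union>x\<in>E. bowen_ball X phi n x \<epsilon>)" using katok_R_attained[OF assms(1,2,4)] by metis
  then have "E \<noteq> {}" using assms(3) by auto
  then show ?thesis using E by (metis One_nat_def Suc_leI card_gt_0_iff)
qed

text \<open>Katok's number asks for mass strictly above its threshold and Shapira's for mass at
  least \<open>\<delta>\<close>; halving the threshold reconciles them.\<close>

lemma shapira_lower_ge:
  assumes \<mu>: "\<mu> \<in> ergodic_measures X phi" and e: "0 < \<epsilon>" and \<delta>: "0 < \<delta>" "\<delta> < 1"
    and U: "open_cover X U" "\<forall>V\<in>U. diameter V \<le> \<epsilon>"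
  shows "katok_lower \<mu> X phi (2 * \<epsilon>) (\<delta> / 2) \<le> shapira_lower \<mu> X phi U \<delta>"
  unfolding katok_lower_def shapira_lower_def
proof (intro Liminf_mono always_eventually allI)
  fix n
  let ?J = "join_family X phi U n"
  have fin: "finite ?J" using U(1) by (intro finite_join_family) (auto simp: open_cover_def)
  have "\<Union>?J = X" using U(1) by (intro join_family_cover) (auto simp: open_cover_def)
  then have "measure \<mu> (\<Union>?J) \<ge> \<delta>"
    using prob_space.prob_space[OF ergodic_measuresD(1)[OF \<mu>]] ergodic_measuresD(3)[OF \<mu>] \<delta> by simp
  then have "\<exists>k. \<exists>U'\<subseteq>?J. card U' = k \<and> measure \<mu> (\<Union>U') \<ge> \<delta>" by blast
  from LeastI_ex[OF this, folded cover_N_def] obtain U' where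
    U': "U' \<subseteq> ?J" "card U' = cover_N \<mu> ?J \<delta>" "measure \<mu> (\<Union>U') \<ge> \<delta>" by metis
  have "katok_R \<mu> X phi n (2 * \<epsilon>) (\<delta> / 2) \<le> card U'"
    using U U' \<delta> fin
    by (intro katok_R_le_family[OF _ e _ U'(1) _ \<mu>]) (auto simp: open_cover_def openin_open intro: finite_subset)
  then have "ln (real (katok_R \<mu> X phi n (2 * \<epsilon>) (\<delta> / 2))) \<le> ln (real (cover_N \<mu> ?J \<delta>))"
    using katok_R_pos[OF \<mu>, of "2 * \<epsilon>" "\<delta> / 2" n] e \<delta> U'(2) by simp
  then show "ereal (ln (real (katok_R \<mu> X phi n (2 * \<epsilon>) (\<delta> / 2))) / real n)
      \<le> ereal (ln (real (cover_N \<mu> ?J \<delta>)) / real n)"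
    by (simp add: divide_right_mono)
qed

text \<open>The cover consists of balls of radius \<open>\<epsilon> / 2\<close> about a net of mesh
  \<open>\<epsilon> / 4\<close>. If every point of the orbit of a centre \<open>y\<close> is
  replaced by a net point within \<open>\<epsilon> / 4\<close>, the resulting member of the join
  contains the Bowen ball of \<open>y\<close> of radius \<open>\<epsilon> / 4\<close>. Hence a
  spanning set yields equally many members that cover \<open>X\<close>.\<close>

lemma shapira_upper_le:
  assumes \<mu>: "\<mu> \<in> ergodic_measures X phi" and e: "0 < \<epsilon>" and \<delta>: "\<delta> < 1"
  shows "\<exists>U. open_cover X U \<and> (\<forall>V\<in>U. diameter V \<le> \<epsilon>) \<and> shapira_upper \<mu> X phi U \<delta> \<le> span_rate X phi (\<epsilon> / 4)"
proof -
  have e4: "0 < \<epsilon> / 4" using e by simp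
  obtain C where C: "finite C" "C \<subseteq> X" "X = (\<Union>x\<in>C. bowen_ball X phi 1 x (\<epsilon> / 4))"
    using finite_bowen_cover[OF e4, of 1] by metis
  define U where "U = (\<lambda>c. X \<inter> ball c (\<epsilon> / 2)) ` C"
  have near: "\<exists>c\<in>C. dist c x < \<epsilon> / 4" if xX: "x \<in> X" for x
  proof -
    obtain c where c: "c \<in> C" "x \<in> bowen_ball X phi 1 c (\<epsilon> / 4)" using xX equalityD1[OF C(3)] by blast
    then have "c \<in> X" using C(2) by blast
    then show ?thesis using c xX by (intro bexI[of _ c]) (auto simp: bowen_ball_def)
  qed
  have "open_cover X U"
    unfolding open_cover_def
  proof (intro conjI ballI)
    show "finite U" using C by (simp add: U_def)
    show "openin (top_of_set X) V" if "V \<in> U" for V using that by (auto simp: U_def)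
    show "X \<subseteq> \<Union>U"
    proof
      fix x assume x: "x \<in> X"
      then obtain c where "c \<in> C" "dist c x < \<epsilon> / 4" using near by blast
      then show "x \<in> \<Union>U" using x e by (auto simp: U_def intro!: bexI[of _ c])
    qed
  qed
  moreover have "diameter V \<le> \<epsilon>" if V: "V \<in> U" for V
  proof -
    obtain c where c: "V = X \<inter> ball c (\<epsilon> / 2)" using V by (auto simp: U_def)
    have "dist x y \<le> \<epsilon>" if "x \<in> V" "y \<in> V" for x y
      using dist_triangle_half_r[of c x \<epsilon> y] that c by auto
    then show ?thesis using e by (cases "V = {}") (auto simp: diameter_def intro!: cSUP_least)
  qed
  moreover have "shapira_upper \<mu> X phi U \<delta> \<le> span_rate X phi (\<epsilon> / 4)"
    unfolding shapira_upper_def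
  proof (rule limsup_le_span_rate[OF e4])
    fix n
    obtain E where E: "finite E" "E \<subseteq> X" "card E = span_num X phi (real n) (\<epsilon> / 4)"
      "X = (\<Union>y\<in>E. bowen_ball X phi n y (\<epsilon> / 4))" using span_cover[OF e4] by metis
    have "\<forall>y\<in>E. \<forall>j. \<exists>c\<in>C. dist c (phi y (real j)) < \<epsilon> / 4" using near[OF phi_in] E(2) by (meson subsetD)
    then obtain c where c: "\<And>y j. y \<in> E \<Longrightarrow> c y j \<in> C" "\<And>y j. y \<in> E \<Longrightarrow> dist (c y j) (phi y (real j)) < \<epsilon> / 4" by metis
    define W where "W y = X \<inter> (\<Inter>j<n. {x. phi x (real j) \<in> X \<inter> ball (c y j) (\<epsilon> / 2)})" for y
    have "W y \<in> join_family X phi U n" if "y \<in> E" for y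
      unfolding W_def join_family_def
      by (intro CollectI exI[of _ "\<lambda>j. X \<inter> ball (c y j) (\<epsilon> / 2)"] conjI refl allI impI)
        (simp add: U_def c(1)[OF that])
    then have WJ: "W ` E \<subseteq> join_family X phi U n" by auto
    have "bowen_ball X phi n y (\<epsilon> / 4) \<subseteq> W y" if y: "y \<in> E" for y
    proof
      fix x assume x: "x \<in> bowen_ball X phi n y (\<epsilon> / 4)"
      then have xX: "x \<in> X" by (simp add: bowen_ball_def)
      have "dist (c y j) (phi x (real j)) < \<epsilon> / 2" if "j < n" for j
      proof -
        have "dist (phi y (real j)) (phi x (real j)) < \<epsilon> / 4" using x that by (simp add: bowen_ball_def)
        then show ?thesis
          using c(2)[OF y, of j] dist_triangle[of "c y j" "phi x (real j)" "phi y (real j)"] by simp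
      qed
      then show "x \<in> W y" using xX phi_in by (auto simp: W_def)
    qed
    then have "(\<Union>y\<in>E. bowen_ball X phi n y (\<epsilon> / 4)) \<subseteq> \<Union>(W ` E)" by (intro UN_mono) auto
    then have "X \<subseteq> \<Union>(W ` E)" by (rule subset_trans[OF equalityD1[OF E(4)]])
    then have "\<Union>(W ` E) = X" by (auto simp: W_def)
    then have "measure \<mu> (\<Union>(W ` E)) \<ge> \<delta>"
      using prob_space.prob_space[OF ergodic_measuresD(1)[OF \<mu>]] ergodic_measuresD(3)[OF \<mu>] \<delta> by simp
    then have "cover_N \<mu> (join_family X phi U n) \<delta> \<le> card (W ` E)"
      unfolding cover_N_def using WJ by (intro Least_le) blast
    also have "\<dots> \<le> card E" by (rule card_image_le[OF E(1)])
    finally show "cover_N \<mu> (join_family X phi U n) \<delta> \<le> span_num X phi (real n) (\<epsilon> / 4)" using E(3) by simp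
  qed
  ultimately show ?thesis by blast
qed

section \<open>Brin-Katok entropy\<close>

lemma bowen_ball_measure_open:
  assumes \<mu>: "\<mu> \<in> ergodic_measures X phi"
  shows "openin (top_of_set X) {x\<in>X. c < measure \<mu> (bowen_ball X phi n x \<epsilon>)}"
proof (subst openin_subopen, intro ballI)
  interpret prob_space \<mu> by (rule ergodic_measuresD(1)[OF \<mu>])
  have sets: "bowen_ball X phi n y r \<in> sets \<mu>" if "y \<in> X" for y r
    using bowen_ball_sets[OF that] ergodic_measuresD(2)[OF \<mu>] by simp
  fix x assume "x \<in> {x\<in>X. c < measure \<mu> (bowen_ball X phi n x \<epsilon>)}"
  then have x: "x \<in> X" "c < measure \<mu> (bowen_ball X phi n x \<epsilon>)" by auto
  \<comment> \<open>Lower semicontinuity in the centre. The ball at \<open>x\<close> is the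
    increasing union of the balls \<open>B k\<close>, one of which already has measure above
    \<open>c\<close>; it lies in the \<open>\<epsilon>\<close>-ball of every \<open>y\<close> within
    Bowen distance \<open>1 / (k + 1)\<close> of \<open>x\<close>.\<close>
  define B where "B k = bowen_ball X phi n x (\<epsilon> - 1 / real (Suc k))" for k
  have "incseq B"
  proof (rule incseq_SucI, rule subsetI)
    fix k y assume "y \<in> B k"
    moreover have "1 / real (Suc (Suc k)) \<le> 1 / real (Suc k)" by (simp add: frac_le)
    ultimately show "y \<in> B (Suc k)" by (force simp: B_def bowen_ball_def)
  qed
  moreover have "(\<Union>k. B k) = bowen_ball X phi n x \<epsilon>"
  proof
    show "(\<Union>k. B k) \<subseteq> bowen_ball X phi n x \<epsilon>"
    proof (intro UN_least subsetI)
      fix k y assume "y \<in> B k"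
      moreover have "a < \<epsilon>" if "a < \<epsilon> - 1 / real (Suc k)" for a
        using that zero_less_divide_1_iff[of "real (Suc k)"] by linarith
      ultimately show "y \<in> bowen_ball X phi n x \<epsilon>" by (simp add: B_def bowen_ball_def)
    qed
    show "bowen_ball X phi n x \<epsilon> \<subseteq> (\<Union>k. B k)"
    proof
      fix y assume y: "y \<in> bowen_ball X phi n x \<epsilon>"
      have "\<exists>k. \<forall>j<m. dist (phi x (real j)) (phi y (real j)) < \<epsilon> - 1 / real (Suc k)" if "m \<le> n" for m
        using that
      proof (induction m)
        case (Suc m)
        then obtain k where k: "\<forall>j<m. dist (phi x (real j)) (phi y (real j)) < \<epsilon> - 1 / real (Suc k)" by auto
        have "0 < \<epsilon> - dist (phi x (real m)) (phi y (real m))" using y Suc.prems by (simp add: bowen_ball_def)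
        then obtain l where l: "1 / real (Suc l) < \<epsilon> - dist (phi x (real m)) (phi y (real m))" by (metis nat_approx_posE)
        have m1: "1 / real (Suc (max k l)) \<le> 1 / real (Suc k)" "1 / real (Suc (max k l)) \<le> 1 / real (Suc l)"
          by (auto simp: frac_le)
        have "dist (phi x (real j)) (phi y (real j)) < \<epsilon> - 1 / real (Suc (max k l))" if "j < Suc m" for j
        proof (cases "j = m")
          case True
          show ?thesis unfolding True using l m1(2) by linarith
        next
          case False
          then have "dist (phi x (real j)) (phi y (real j)) < \<epsilon> - 1 / real (Suc k)" using k that by simp
          then show ?thesis using m1 by linarith
        qed
        then show ?case by blast
      qed auto
      from this[of n] obtain k where "\<forall>j<n. dist (phi x (real j)) (phi y (real j)) < \<epsilon> - 1 / real (Suc k)" by auto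
      then show "y \<in> (\<Union>k. B k)" using y by (auto simp: B_def bowen_ball_def)
    qed
  qed
  moreover have "range B \<subseteq> sets \<mu>" using sets[OF x(1)] by (auto simp: B_def)
  ultimately have "(\<lambda>k. measure \<mu> (B k)) \<longlonglongrightarrow> measure \<mu> (bowen_ball X phi n x \<epsilon>)"
    using finite_Lim_measure_incseq[of B] by simp
  then have "\<forall>\<^sub>F k in sequentially. c < measure \<mu> (B k)" using x(2) by (rule order_tendstoD)
  then obtain k where k: "c < measure \<mu> (B k)" by (auto simp: eventually_sequentially)
  let ?V = "bowen_ball X phi n x (1 / real (Suc k))"
  show "\<exists>T. openin (top_of_set X) T \<and> x \<in> T \<and> T \<subseteq> {x\<in>X. c < measure \<mu> (bowen_ball X phi n x \<epsilon>)}"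
  proof (intro exI[of _ ?V] conjI subsetI)
    show "openin (top_of_set X) ?V" by (rule openin_bowen_ball[OF x(1)])
    show "x \<in> ?V" using x(1) by (simp add: bowen_ball_def)
    fix y assume y: "y \<in> ?V"
    then have yX: "y \<in> X" by (simp add: bowen_ball_def)
    have "B k \<subseteq> bowen_ball X phi n y \<epsilon>"
    proof
      fix z assume z: "z \<in> B k"
      have "dist (phi y (real j)) (phi z (real j)) < \<epsilon>" if "j < n" for j
      proof -
        have "dist (phi x (real j)) (phi y (real j)) < 1 / real (Suc k)" using y that by (simp add: bowen_ball_def)
        moreover have "dist (phi x (real j)) (phi z (real j)) < \<epsilon> - 1 / real (Suc k)" using z that by (simp add: B_def bowen_ball_def)
        moreover have "dist (phi y (real j)) (phi z (real j)) \<le> dist (phi x (real j)) (phi y (real j)) + dist (phi x (real j)) (phi z (real j))"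
          by (rule dist_triangle3)
        ultimately show ?thesis by linarith
      qed
      then show "z \<in> bowen_ball X phi n y \<epsilon>" using z by (simp add: B_def bowen_ball_def)
    qed
    then have "measure \<mu> (B k) \<le> measure \<mu> (bowen_ball X phi n y \<epsilon>)"
      using sets[OF yX] by (intro finite_measure_mono) auto
    then show "y \<in> {x\<in>X. c < measure \<mu> (bowen_ball X phi n x \<epsilon>)}" using yX k by simp
  qed
qed

lemma bowen_ball_measure_measurable:
  assumes \<mu>: "\<mu> \<in> ergodic_measures X phi"
  shows "(\<lambda>x. measure \<mu> (bowen_ball X phi n x \<epsilon>)) \<in> borel_measurable \<mu>"
  unfolding borel_measurable_iff_greater
  using openin_sets[OF bowen_ball_measure_open[OF \<mu>]] ergodic_measuresD(2,3)[OF \<mu>] by simp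

lemma bowen_ball_triangle:
  assumes "x \<in> bowen_ball X phi n y r" "z \<in> bowen_ball X phi n y r'"
  shows "z \<in> bowen_ball X phi n x (r + r')"
proof -
  have "dist (phi x (real j)) (phi z (real j)) < r + r'" if "j < n" for j
    using dist_triangle3[of "phi x (real j)" "phi z (real j)" "phi y (real j)"] assms that
    by (force simp: bowen_ball_def)
  then show ?thesis using assms by (simp add: bowen_ball_def)
qed

text \<open>Borel-Cantelli. A ball of radius \<open>\<epsilon>\<close> contains any spanning ball of
  half the radius around its centre, so the points with a ball of mass below
  \<open>exp (- n * c)\<close> are covered by spanning balls that are as light. There are at most
  \<open>exp (n * b)\<close> of them for large \<open>n\<close>, with \<open>b < c\<close>, so the
  masses are summable.\<close>

lemma upper_BK_le:
  assumes \<mu>: "\<mu> \<in> ergodic_measures X phi" and e: "0 < \<epsilon>"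
  shows "upper_BK \<mu> X phi \<epsilon> \<le> span_rate X phi (\<epsilon> / 2)"
proof (rule ereal_le_of_real_bounds)
  interpret prob_space \<mu> by (rule ergodic_measuresD(1)[OF \<mu>])
  have sp: "space \<mu> = X" and st: "sets \<mu> = sets BX" using ergodic_measuresD[OF \<mu>] by auto
  fix c assume c: "span_rate X phi (\<epsilon> / 2) < ereal c"
  obtain b where b: "span_rate X phi (\<epsilon> / 2) < ereal b" "b < c" using ereal_dense2[OF c] by auto
  have e2: "0 < \<epsilon> / 2" using e by simp
  have c0: "0 \<le> c" using span_rate_nonneg[OF e2] c by (metis ereal_less_eq(5) less_imp_le order_trans)
  let ?m = "\<lambda>n x. measure \<mu> (bowen_ball X phi n x \<epsilon>)"
  define A where "A n = {x\<in>X. ?m n x < exp (- (real n * c))}" for n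
  have As: "A n \<in> sets \<mu>" for n
    using measurable_sets[OF bowen_ball_measure_measurable[OF \<mu>], of "{..<exp (- (real n * c))}" n \<epsilon>]
    by (simp add: A_def vimage_def sp Int_def conj_commute)
  have Ale: "measure \<mu> (A n) \<le> real (span_num X phi (real n) (\<epsilon> / 2)) * exp (- (real n * c))" for n
  proof -
    obtain E where E: "finite E" "E \<subseteq> X" "card E = span_num X phi (real n) (\<epsilon> / 2)"
      "X = (\<Union>y\<in>E. bowen_ball X phi n y (\<epsilon> / 2))" using span_cover[OF e2] by metis
    define F where "F = {y\<in>E. measure \<mu> (bowen_ball X phi n y (\<epsilon> / 2)) < exp (- (real n * c))}"
    have bs: "bowen_ball X phi n y r \<in> sets \<mu>" if "y \<in> X" for y r using bowen_ball_sets[OF that] st by simp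
    have "A n \<subseteq> (\<Union>y\<in>F. bowen_ball X phi n y (\<epsilon> / 2))"
    proof
      fix x assume x: "x \<in> A n"
      then obtain y where y: "y \<in> E" "x \<in> bowen_ball X phi n y (\<epsilon> / 2)" using E(4) by (auto simp: A_def)
      have "bowen_ball X phi n y (\<epsilon> / 2) \<subseteq> bowen_ball X phi n x \<epsilon>"
        using bowen_ball_triangle[OF y(2), of _ "\<epsilon> / 2"] by auto
      then have "measure \<mu> (bowen_ball X phi n y (\<epsilon> / 2)) \<le> ?m n x"
        using x by (intro finite_measure_mono bs) (auto simp: A_def)
      then show "x \<in> (\<Union>y\<in>F. bowen_ball X phi n y (\<epsilon> / 2))" using x y by (auto simp: F_def A_def)
    qed
    then have "measure \<mu> (A n) \<le> measure \<mu> (\<Union>y\<in>F. bowen_ball X phi n y (\<epsilon> / 2))"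
      using E by (intro finite_measure_mono sets.finite_UN bs) (auto simp: F_def)
    also have "\<dots> \<le> (\<Sum>y\<in>F. measure \<mu> (bowen_ball X phi n y (\<epsilon> / 2)))"
      using E by (intro finite_measure_subadditive_finite) (auto simp: F_def intro!: bs)
    also have "\<dots> \<le> (\<Sum>y\<in>F. exp (- (real n * c)))" by (intro sum_mono) (auto simp: F_def)
    also have "\<dots> = real (card F) * exp (- (real n * c))" by simp
    also have "\<dots> \<le> real (card E) * exp (- (real n * c))"
      using card_mono[of E F] E(1) by (intro mult_right_mono) (auto simp: F_def)
    finally show ?thesis using E(3) by simp
  qed
  have "summable (\<lambda>n. measure \<mu> (A n))"
  proof (rule summable_comparison_test_ev)
    show "summable (\<lambda>n. exp (- (c - b)) ^ n)" using b(2) by (intro summable_geometric) auto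
    show "\<forall>\<^sub>F n in sequentially. norm (measure \<mu> (A n)) \<le> exp (- (c - b)) ^ n"
      using span_rate_less[OF b(1)]
    proof eventually_elim
      case (elim n)
      have "0 < real (span_num X phi (real n) (\<epsilon> / 2))" using span_num_pos[OF e2, of "real n"] by simp
      then have "real (span_num X phi (real n) (\<epsilon> / 2)) \<le> exp (real n * b)" using elim by (metis exp_le_cancel_iff exp_ln)
      then have "measure \<mu> (A n) \<le> exp (real n * b) * exp (- (real n * c))"
        using Ale[of n] mult_right_mono[of _ "exp (real n * b)" "exp (- (real n * c))"] by (meson exp_ge_zero order_trans)
      also have "\<dots> = exp (- (c - b)) ^ n"
        by (simp add: exp_of_nat_mult[symmetric] exp_add[symmetric] algebra_simps)
      finally show ?case by simp
    qed
  qed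
  then have "AE x in \<mu>. eventually (\<lambda>n. x \<in> space \<mu> - A n) sequentially"
    by (intro borel_cantelli_AE1 As) (auto simp: less_top[symmetric])
  then have "AE x in \<mu>. e2ennreal (limsup (\<lambda>n. neg_log (?m n x) / ereal (real n))) \<le> ennreal c"
  proof (rule AE_mp[OF _ AE_I2], intro impI)
    fix x assume ev: "eventually (\<lambda>n. x \<in> space \<mu> - A n) sequentially"
    have "\<forall>\<^sub>F n in sequentially. neg_log (?m n x) / ereal (real n) \<le> ereal c"
      using ev eventually_gt_at_top[of 0]
    proof eventually_elim
      case (elim n)
      then have ge: "exp (- (real n * c)) \<le> ?m n x" by (auto simp: A_def sp)
      then have pos: "0 < ?m n x" by (meson exp_gt_zero less_le_trans)
      then have "- (real n * c) \<le> ln (?m n x)" using ge by (simp add: ln_ge_iff)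
      then have "- ln (?m n x) / real n \<le> c" using elim(2) by (simp add: field_simps)
      then show ?case using pos elim(2) by (simp add: neg_log_def)
    qed
    then have "limsup (\<lambda>n. neg_log (?m n x) / ereal (real n)) \<le> ereal c" by (rule Limsup_bounded)
    from e2ennreal_mono[OF this] show "e2ennreal (limsup (\<lambda>n. neg_log (?m n x) / ereal (real n))) \<le> ennreal c" by simp
  qed
  then have "(\<integral>\<^sup>+x. e2ennreal (limsup (\<lambda>n. neg_log (?m n x) / ereal (real n))) \<partial>\<mu>) \<le> (\<integral>\<^sup>+x. ennreal c \<partial>\<mu>)"
    by (rule nn_integral_mono_AE)
  also have "\<dots> = ennreal c" by (simp add: emeasure_space_1)
  finally have "enn2ereal (\<integral>\<^sup>+x. e2ennreal (limsup (\<lambda>n. neg_log (?m n x) / ereal (real n))) \<partial>\<mu>) \<le> enn2ereal (ennreal c)"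
    by (simp only: less_eq_ennreal.rep_eq)
  then show "upper_BK \<mu> X phi \<epsilon> \<le> ereal c"
    unfolding upper_BK_def using c0 by (simp only: enn2ereal_ennreal)
qed

text \<open>The entropy is a mean of local rates, so Markov's inequality bounds the rate by
  \<open>b * (1 + d)\<close> off a set of mass at most \<open>1 / (1 + d)\<close>. Where the rate is
  bounded, Bowen balls are heavy, so few of them are disjoint, and doubling the radii of a maximal
  disjoint family covers the set.\<close>

lemma katok_lower_le_BK:
  assumes \<mu>: "\<mu> \<in> ergodic_measures X phi" and e: "0 < \<epsilon>" and d: "0 < d"
    and b: "0 < b" "upper_BK \<mu> X phi \<epsilon> < ereal b"
  shows "katok_lower \<mu> X phi (2 * \<epsilon>) (d / (2 * (1 + d))) \<le> ereal (b * (1 + d))"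
proof -
  interpret prob_space \<mu> by (rule ergodic_measuresD(1)[OF \<mu>])
  have sp: "space \<mu> = X" and st: "sets \<mu> = sets BX" using ergodic_measuresD[OF \<mu>] by auto
  \<comment> \<open>Half of the mass \<open>d / (1 + d)\<close> left over by Markov's inequality, to
    allow strict inequalities.\<close>
  define \<delta> where "\<delta> = d / (2 * (1 + d))"
  have \<delta>: "0 < \<delta>" "\<delta> < 1" "\<delta> < 1 - 1 / (1 + d)" using d by (auto simp: \<delta>_def field_simps add_pos_pos)
  define b' where "b' = b * (1 + d)"
  have b': "0 < b'" using b d by (simp add: b'_def)
  let ?m = "\<lambda>n x. measure \<mu> (bowen_ball X phi n x \<epsilon>)"
  note [measurable] = bowen_ball_measure_measurable[OF \<mu>]
  define g where "g x = limsup (\<lambda>n. neg_log (?m n x) / ereal (real n))" for x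
  have gm [measurable]: "g \<in> borel_measurable \<mu>"
    unfolding g_def neg_log_def by measurable
  define u where "u x = e2ennreal (g x)" for x
  have um [measurable]: "u \<in> borel_measurable \<mu>" unfolding u_def by measurable
  have Iu: "(\<integral>\<^sup>+x. u x \<partial>\<mu>) \<le> ennreal b"
  proof -
    have "enn2ereal (\<integral>\<^sup>+x. u x \<partial>\<mu>) < ereal b" using b(2) by (simp add: upper_BK_def u_def g_def)
    then show ?thesis using b(1) by (metis enn2ereal_ennreal less_eq_ennreal.rep_eq less_imp_le)
  qed
  let ?W = "{x\<in>space \<mu>. 1 \<le> ennreal (1 / b') * u x}"
  have W: "?W \<in> sets \<mu>" by measurable
  have "emeasure \<mu> ?W \<le> ennreal (1 / b') * (\<integral>\<^sup>+x. u x * indicator (space \<mu>) x \<partial>\<mu>)"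
    by (rule nn_integral_Markov_inequality) auto
  also have "(\<integral>\<^sup>+x. u x * indicator (space \<mu>) x \<partial>\<mu>) = (\<integral>\<^sup>+x. u x \<partial>\<mu>)" by (intro nn_integral_cong) auto
  also have "ennreal (1 / b') * (\<integral>\<^sup>+x. u x \<partial>\<mu>) \<le> ennreal (1 / b') * ennreal b" by (intro mult_left_mono Iu) auto
  also have "\<dots> = ennreal (1 / (1 + d))" using b d by (simp add: b'_def flip: ennreal_mult')
  finally have "measure \<mu> ?W \<le> 1 / (1 + d)" using d by (simp add: emeasure_eq_measure)
  then have Wc: "\<delta> < measure \<mu> (space \<mu> - ?W)" using prob_compl[OF W] \<delta>(3) by simp
  \<comment> \<open>The bound on the local rate holds from a time depending on the point; the sets
    with a common time \<open>N\<close> increase, and one of them still has mass above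
    \<open>\<delta>\<close>.\<close>
  define D where "D N = {x\<in>space \<mu>. \<forall>n\<ge>N. exp (- (real n * b')) \<le> ?m n x}" for N
  have Ds: "D N \<in> sets \<mu>" for N unfolding D_def by measurable
  have "incseq D" by (rule incseq_SucI) (auto simp: D_def)
  then have limD: "(\<lambda>N. measure \<mu> (D N)) \<longlonglongrightarrow> measure \<mu> (\<Union>N. D N)"
    using Ds by (intro finite_Lim_measure_incseq) auto
  have "space \<mu> - ?W \<subseteq> (\<Union>N. D N)"
  proof
    fix x assume x: "x \<in> space \<mu> - ?W"
    have "g x < ereal b'"
    proof (rule ccontr)
      assume "\<not> g x < ereal b'"
      then have "e2ennreal (ereal b') \<le> u x" unfolding u_def by (intro e2ennreal_mono) simp
      then have "ennreal (1 / b') * ennreal b' \<le> ennreal (1 / b') * u x" by (intro mult_left_mono) auto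
      moreover have "ennreal (1 / b') * ennreal b' = 1" using b' by (simp flip: ennreal_mult')
      ultimately show False using x by auto
    qed
    then have "\<forall>\<^sub>F n in sequentially. neg_log (?m n x) / ereal (real n) < ereal b'"
      unfolding g_def by (rule Limsup_lessD)
    then have "\<forall>\<^sub>F n in sequentially. exp (- (real n * b')) \<le> ?m n x"
      using eventually_gt_at_top[of 0]
    proof eventually_elim
      case (elim n)
      have ne: "?m n x \<noteq> 0" using elim by (auto simp: neg_log_def)
      then have pos: "0 < ?m n x" by (simp add: less_le)
      have "- ln (?m n x) / real n < b'" using elim ne by (simp add: neg_log_def)
      then have "- (real n * b') \<le> ln (?m n x)" using elim(2) by (simp add: field_simps)
      then show ?case using pos by (simp add: ln_ge_iff)
    qed
    then show "x \<in> (\<Union>N. D N)" using x by (auto simp: D_def eventually_sequentially)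
  qed
  then have "\<delta> < measure \<mu> (\<Union>N. D N)"
    using Wc Ds by (intro less_le_trans[OF Wc] finite_measure_mono) auto
  then have "\<forall>\<^sub>F N in sequentially. \<delta> < measure \<mu> (D N)" using limD by (intro order_tendstoD(1))
  then obtain N where N: "\<delta> < measure \<mu> (D N)" by (auto simp: eventually_sequentially)
  have "ln (real (katok_R \<mu> X phi n (2 * \<epsilon>) \<delta>)) / real n \<le> b'" if n: "max N 1 \<le> n" for n
  proof -
    define P where "P F \<longleftrightarrow> finite F \<and> F \<subseteq> D N \<and> disjoint_family_on (\<lambda>x. bowen_ball X phi n x \<epsilon>) F" for F
    have bs: "bowen_ball X phi n y r \<in> sets \<mu>" if "y \<in> X" for y r using bowen_ball_sets[OF that] st by simp
    have bound: "real (card F) \<le> exp (real n * b')" if F: "P F" for F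
    proof -
      have FX: "F \<subseteq> X" using F sp by (auto simp: P_def D_def)
      have "real (card F) * exp (- (real n * b')) = (\<Sum>x\<in>F. exp (- (real n * b')))" by simp
      also have "\<dots> \<le> (\<Sum>x\<in>F. ?m n x)" using F n by (intro sum_mono) (auto simp: P_def D_def)
      also have "\<dots> = measure \<mu> (\<Union>x\<in>F. bowen_ball X phi n x \<epsilon>)"
        using F FX by (intro finite_measure_finite_Union[symmetric]) (auto simp: P_def intro!: bs)
      also have "\<dots> \<le> 1" by (rule prob_le_1)
      finally show ?thesis by (simp add: exp_minus field_simps)
    qed
    have bnd: "\<forall>E. P E \<longrightarrow> card E < Suc (nat \<lceil>exp (real n * b')\<rceil>)"
    proof (intro allI impI)
      fix E assume "P E"
      from bound[OF this] show "card E < Suc (nat \<lceil>exp (real n * b')\<rceil>)" by linarith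
    qed
    have "P {}" by (simp add: P_def disjoint_family_on_def)
    then obtain F where F: "P F" "\<And>F'. P F' \<Longrightarrow> card F' \<le> card F"
      using ex_has_greatest_nat[of P "{}" card "Suc (nat \<lceil>exp (real n * b')\<rceil>)"] bnd by blast
    have FX: "F \<subseteq> X" "finite F" using F(1) sp by (auto simp: P_def D_def)
    have "D N \<subseteq> (\<Union>x\<in>F. bowen_ball X phi n x (2 * \<epsilon>))"
    proof
      fix z assume z: "z \<in> D N"
      then have zX: "z \<in> X" using sp by (simp add: D_def)
      show "z \<in> (\<Union>x\<in>F. bowen_ball X phi n x (2 * \<epsilon>))"
      proof (rule ccontr)
        assume no: "z \<notin> (\<Union>x\<in>F. bowen_ball X phi n x (2 * \<epsilon>))"
        have dj: "bowen_ball X phi n z \<epsilon> \<inter> bowen_ball X phi n x \<epsilon> = {}" if "x \<in> F" for x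
        proof (rule ccontr)
          assume "bowen_ball X phi n z \<epsilon> \<inter> bowen_ball X phi n x \<epsilon> \<noteq> {}"
          then obtain y where "y \<in> bowen_ball X phi n z \<epsilon>" "y \<in> bowen_ball X phi n x \<epsilon>" by blast
          then have "z \<in> bowen_ball X phi n y \<epsilon>" "x \<in> bowen_ball X phi n y \<epsilon>"
            using zX FX that by (auto simp: bowen_ball_def dist_commute)
          then have "z \<in> bowen_ball X phi n x (2 * \<epsilon>)" using bowen_ball_triangle[of x n y \<epsilon> z \<epsilon>] by simp
          then show False using no that by blast
        qed
        have "z \<in> bowen_ball X phi n z (2 * \<epsilon>)" using zX e by (simp add: bowen_ball_def)
        then have "z \<notin> F" using no by auto
        moreover have "P (insert z F)"
          using F(1) z dj unfolding P_def disjoint_family_on_def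
          by (metis Int_commute finite_insert insert_iff insert_subset)
        ultimately show False using F(2)[of "insert z F"] FX(2) by simp
      qed
    qed
    then have "measure \<mu> (D N) \<le> measure \<mu> (\<Union>x\<in>F. bowen_ball X phi n x (2 * \<epsilon>))"
      using FX by (intro finite_measure_mono sets.finite_UN bs) auto
    then have "katok_R \<mu> X phi n (2 * \<epsilon>) \<delta> \<le> card F" using N FX by (intro katok_R_le) auto
    then have "real (katok_R \<mu> X phi n (2 * \<epsilon>) \<delta>) \<le> exp (real n * b')" using bound[OF F(1)] by linarith
    moreover have "1 \<le> katok_R \<mu> X phi n (2 * \<epsilon>) \<delta>" using \<delta> e by (intro katok_R_pos[OF \<mu>]) auto
    ultimately have "ln (real (katok_R \<mu> X phi n (2 * \<epsilon>) \<delta>)) \<le> real n * b'"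
      by (metis exp_gt_zero ln_exp ln_le_cancel_iff of_nat_1 of_nat_le_iff less_le_trans zero_less_one)
    then show ?thesis using n by (simp add: divide_le_eq mult.commute)
  qed
  then have "\<forall>\<^sub>F n in sequentially. ereal (ln (real (katok_R \<mu> X phi n (2 * \<epsilon>) \<delta>)) / real n) \<le> ereal b'"
    unfolding eventually_sequentially by (intro exI[of _ "max N 1"]) simp
  then have "limsup (\<lambda>n. ereal (ln (real (katok_R \<mu> X phi n (2 * \<epsilon>) \<delta>)) / real n)) \<le> ereal b'"
    by (rule Limsup_bounded)
  moreover have "katok_lower \<mu> X phi (2 * \<epsilon>) \<delta> \<le> limsup (\<lambda>n. ereal (ln (real (katok_R \<mu> X phi n (2 * \<epsilon>) \<delta>)) / real n))"
    unfolding katok_lower_def by (rule Liminf_le_Limsup) simp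
  ultimately show ?thesis unfolding \<delta>_def b'_def by (rule order_trans[rotated])
qed

end

section \<open>Entropy of partitions\<close>

text \<open>Fekete's lemma.\<close>

lemma subadditive_tendsto_Inf:
  fixes a :: "nat \<Rightarrow> real"
  assumes sub: "\<And>m n. a (m + n) \<le> a m + a n" and nonneg: "\<And>n. 0 \<le> a n"
  shows "\<exists>l. (\<lambda>n. a n / real n) \<longlonglongrightarrow> l"
proof -
  define l where "l = (INF n\<in>{1..}. a n / real n)"
  have bdd: "bdd_below ((\<lambda>n. a n / real n) ` {1..})"
    by (rule bdd_belowI2[of _ 0]) (simp add: nonneg)
  have ge: "l \<le> a n / real n" if "1 \<le> n" for n
    unfolding l_def using that by (intro cINF_lower bdd) auto
  \<comment> \<open>The summand \<open>a 0\<close> takes care of \<open>k = 0\<close>, since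
    \<open>a 0\<close> is only known to be nonnegative.\<close>
  have mult: "a (m * k) \<le> real k * a m + a 0" for m k
  proof (induction k)
    case (Suc k)
    have "a (m * Suc k) \<le> a m + a (m * k)" using sub[of m "m * k"] by simp
    then show ?case using Suc by (simp add: algebra_simps)
  qed simp
  have "(\<lambda>n. a n / real n) \<longlonglongrightarrow> l"
  proof (rule LIMSEQ_I)
    fix e :: real assume e: "0 < e"
    have "(INF n\<in>{1..}. a n / real n) < l + e / 2" using e by (simp add: l_def)
    then obtain m where m: "1 \<le> m" "a m / real m < l + e / 2"
      using cINF_less_iff[OF _ bdd, of "l + e / 2"] by auto
    define K where "K = a 0 + (\<Sum>r<m. a r)"
    have K: "a 0 + a r \<le> K" if "r < m" for r
      unfolding K_def using that nonneg by (intro add_left_mono member_le_sum) auto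
    obtain n0 :: nat where n0: "2 * K / e < real n0" using reals_Archimedean2 by blast
    show "\<exists>n0. \<forall>n\<ge>n0. norm (a n / real n - l) < e"
    proof (intro exI[of _ "Suc n0"] allI impI)
      fix n assume n: "Suc n0 \<le> n"
      define k where "k = n div m"
      have "a n \<le> a (m * k) + a (n mod m)" using sub[of "m * k" "n mod m"] by (simp add: k_def)
      also have "\<dots> \<le> real k * a m + K"
      proof -
        have "n mod m < m" using m(1) by simp
        from K[OF this] mult[of m k] show ?thesis by linarith
      qed
      also have "real k * a m \<le> real n * (a m / real m)"
      proof -
        have "real k * real m \<le> real n" by (simp add: k_def flip: of_nat_mult)
        then have "real k \<le> real n / real m" using m(1) by (simp add: field_simps)
        then have "real k * a m \<le> real n / real m * a m" using nonneg by (intro mult_right_mono)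
        then show ?thesis by simp
      qed
      finally have "a n \<le> real n * (a m / real m) + K" by simp
      then have "a n / real n \<le> a m / real m + K / real n" using n by (simp add: field_simps)
      moreover have "K / real n < e / 2"
      proof -
        have "2 * K / e < real n" using n0 n by linarith
        then show ?thesis using e n by (simp add: field_simps)
      qed
      ultimately have "a n / real n < l + e" using m(2) by linarith
      moreover have "l \<le> a n / real n" using ge n by simp
      ultimately show "norm (a n / real n - l) < e" using e by simp
    qed
  qed
  then show ?thesis by blast
qed

text \<open>Shannon entropy, with natural logarithm, of a finite-valued observable. With observables
  in place of families of cells, joins become pairs and coarsenings become compositions.\<close>

definition label_entropy :: "'a measure \<Rightarrow> ('a \<Rightarrow> 'b) \<Rightarrow> real" where
  "label_entropy M f = - (\<Sum>y\<in>f ` space M. measure M (f -` {y} \<inter> space M) * ln (measure M (f -` {y} \<inter> space M)))"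

lemma (in prob_space) information_space_exp: "information_space M (exp 1)"
  by unfold_locales simp

lemma (in prob_space) label_entropy_eq:
  assumes "simple_function M f"
  shows "entropy (exp 1) (count_space (f ` space M)) f = label_entropy M f"
proof -
  interpret I: information_space M "exp 1" by (rule information_space_exp)
  show ?thesis
    using I.entropy_simple_distributed[OF simple_distributedI[OF assms measure_nonneg refl]]
    by (simp add: label_entropy_def log_def)
qed

lemma (in prob_space) label_entropy_Pair:
  assumes f: "simple_function M f" and g: "simple_function M g"
  shows "label_entropy M (\<lambda>x. (f x, g x)) \<le> label_entropy M f + label_entropy M g"
proof -
  interpret I: information_space M "exp 1" by (rule information_space_exp)
  show ?thesis
    using I.entropy_chain_rule[OF f g] I.conditional_entropy_less_eq_entropy[OF g f]
    by (simp add: label_entropy_eq f g simple_function_Pair)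
qed

lemma label_entropy_cong:
  assumes "\<And>x. x \<in> space M \<Longrightarrow> f x = g x"
  shows "label_entropy M f = label_entropy M g"
proof -
  have "f ` space M = g ` space M" "\<And>y. f -` {y} \<inter> space M = g -` {y} \<inter> space M" using assms by auto
  then show ?thesis by (simp add: label_entropy_def)
qed

lemma (in prob_space) label_entropy_function:
  assumes f: "simple_function M f" and g: "\<And>x. x \<in> space M \<Longrightarrow> g x = F (f x)"
  shows "label_entropy M g \<le> label_entropy M f"
proof -
  interpret I: information_space M "exp 1" by (rule information_space_exp)
  have "label_entropy M g = label_entropy M (F \<circ> f)" using g by (intro label_entropy_cong) simp
  also have "\<dots> \<le> label_entropy M f"
    using I.entropy_data_processing[OF f, of F]
    by (simp only: label_entropy_eq[OF f] label_entropy_eq[OF simple_function_compose[OF f, of F]])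
  finally show ?thesis .
qed

lemma (in prob_space) label_entropy_nonneg: "0 \<le> label_entropy M f"
  unfolding label_entropy_def
  by (simp add: sum_nonpos mult_nonneg_nonpos prob_le_1 ln_le_zero_iff less_le)
    (smt (verit) ln_le_zero_iff measure_nonneg mult_nonneg_nonpos prob_le_1 sum_nonpos mult_eq_0_iff)

lemma Gibbs_inequality:
  fixes p q :: "'b \<Rightarrow> real"
  assumes "finite S" "\<And>y. y \<in> S \<Longrightarrow> 0 \<le> p y" "(\<Sum>y\<in>S. p y) = 1"
    and q: "\<And>y. y \<in> S \<Longrightarrow> 0 < q y" "(\<Sum>y\<in>S. q y) \<le> 1"
  shows "- (\<Sum>y\<in>S. p y * ln (p y)) \<le> (\<Sum>y\<in>S. p y * (- ln (q y)))"
proof -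
  have "p y * (- ln (p y)) \<le> p y * (- ln (q y)) + (q y - p y)" if y: "y \<in> S" for y
  proof (cases "p y = 0")
    case False
    then have p: "0 < p y" using assms(2)[OF y] by simp
    have "p y * ln (q y / p y) \<le> p y * (q y / p y - 1)"
      using p q(1)[OF y] by (intro mult_left_mono ln_le_minus_one) auto
    moreover have "p y * (q y / p y - 1) = q y - p y" using p by (simp add: field_simps)
    ultimately show ?thesis using p q(1)[OF y] by (simp add: ln_div right_diff_distrib)
  qed (use q(1)[OF y] in auto)
  then have "(\<Sum>y\<in>S. p y * (- ln (p y))) \<le> (\<Sum>y\<in>S. p y * (- ln (q y)) + (q y - p y))" by (rule sum_mono)
  also have "\<dots> = (\<Sum>y\<in>S. p y * (- ln (q y))) + ((\<Sum>y\<in>S. q y) - (\<Sum>y\<in>S. p y))"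
    by (simp only: sum.distrib sum_subtractf)
  finally show ?thesis using assms(3) q(2) by (simp add: sum_negf)
qed

context lipschitz_flow
begin

section \<open>Itineraries under the time-one map\<close>

definition itinerary :: "('a \<Rightarrow> 'b) \<Rightarrow> nat \<Rightarrow> 'a \<Rightarrow> 'b list" where
  "itinerary f n x = map (\<lambda>j. f (phi x (real j))) [0..<n]"

lemma itinerary_eq_iff:
  "itinerary f n x = itinerary g n y \<longleftrightarrow> (\<forall>j<n. f (phi x (real j)) = g (phi y (real j)))"
  by (auto simp: itinerary_def)

lemma phi_measurable_ergodic:
  assumes "\<mu> \<in> ergodic_measures X phi" shows "(\<lambda>x. phi x t) \<in> measurable \<mu> \<mu>"
  using phi_measurable measurable_cong_sets[of \<mu> BX \<mu> BX] ergodic_measuresD(2)[OF assms] by blast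

lemma simple_function_phi:
  assumes "\<mu> \<in> ergodic_measures X phi" "simple_function \<mu> f"
  shows "simple_function \<mu> (\<lambda>x. f (phi x t))"
  unfolding simple_function_def
proof (intro conjI ballI)
  note sp = ergodic_measuresD(3)[OF assms(1)]
  have "(\<lambda>x. f (phi x t)) ` space \<mu> \<subseteq> f ` space \<mu>" using phi_in by (auto simp: sp)
  then show "finite ((\<lambda>x. f (phi x t)) ` space \<mu>)" using simple_functionD(1)[OF assms(2)] finite_subset by blast
  fix y
  have "(\<lambda>x. f (phi x t)) -` {y} \<inter> space \<mu> = (\<lambda>x. phi x t) -` (f -` {y} \<inter> space \<mu>) \<inter> space \<mu>"
    using phi_in by (auto simp: sp)
  also have "\<dots> \<in> sets \<mu>"
    by (intro measurable_sets[OF phi_measurable_ergodic[OF assms(1)]] simple_functionD(2)[OF assms(2)])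
  finally show "(\<lambda>x. f (phi x t)) -` {y} \<inter> space \<mu> \<in> sets \<mu>" .
qed

lemma label_entropy_phi:
  assumes "\<mu> \<in> ergodic_measures X phi" "simple_function \<mu> f"
  shows "label_entropy \<mu> (\<lambda>x. f (phi x t)) = label_entropy \<mu> f"
proof -
  note sp = ergodic_measuresD(3)[OF assms(1)]
  have "(\<lambda>x. f (phi x t)) ` space \<mu> = f ` space \<mu>"
  proof
    show "(\<lambda>x. f (phi x t)) ` space \<mu> \<subseteq> f ` space \<mu>" using phi_in by (auto simp: sp)
    show "f ` space \<mu> \<subseteq> (\<lambda>x. f (phi x t)) ` space \<mu>"
    proof
      fix v assume "v \<in> f ` space \<mu>"
      then obtain x where "x \<in> X" "v = f x" by (auto simp: sp)
      then show "v \<in> (\<lambda>x. f (phi x t)) ` space \<mu>"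
        by (intro image_eqI[of _ _ "phi x (- t)"]) (auto simp: sp phi_phi phi_in)
    qed
  qed
  moreover have "measure \<mu> ((\<lambda>x. f (phi x t)) -` {y} \<inter> space \<mu>) = measure \<mu> (f -` {y} \<inter> space \<mu>)" for y
  proof -
    have "(\<lambda>x. f (phi x t)) -` {y} \<inter> space \<mu> = {x\<in>X. phi x t \<in> f -` {y} \<inter> space \<mu>}"
      using phi_in by (auto simp: sp)
    then show ?thesis
      using ergodic_measuresD(4)[OF assms(1), of "f -` {y} \<inter> space \<mu>" t] simple_functionD(2)[OF assms(2), of "{y}"]
        ergodic_measuresD(2)[OF assms(1)] by simp
  qed
  ultimately show ?thesis by (simp add: label_entropy_def)
qed

lemma simple_function_map:
  assumes "\<mu> \<in> ergodic_measures X phi" "simple_function \<mu> f"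
  shows "simple_function \<mu> (\<lambda>x. map (\<lambda>t. f (phi x (c t))) ts)"
proof (induction ts)
  case (Cons t ts)
  have "simple_function \<mu> ((\<lambda>(a, b). a # b) \<circ> (\<lambda>x. (f (phi x (c t)), map (\<lambda>t. f (phi x (c t))) ts)))"
    by (intro simple_function_compose simple_function_Pair Cons simple_function_phi[OF assms])
  then show ?case by (simp add: comp_def)
qed simp

lemma simple_function_itinerary:
  assumes "\<mu> \<in> ergodic_measures X phi" "simple_function \<mu> f"
  shows "simple_function \<mu> (itinerary f n)"
  using simple_function_map[OF assms, of real "[0..<n]"] by (simp add: itinerary_def[abs_def])

lemma label_entropy_itinerary_add:
  assumes \<mu>: "\<mu> \<in> ergodic_measures X phi" and f: "simple_function \<mu> f"
  shows "label_entropy \<mu> (itinerary f (m + n)) \<le> label_entropy \<mu> (itinerary f m) + label_entropy \<mu> (itinerary f n)"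
proof -
  interpret prob_space \<mu> by (rule ergodic_measuresD(1)[OF \<mu>])
  note s = simple_function_itinerary[OF \<mu> f]
  have s2: "simple_function \<mu> (\<lambda>x. itinerary f n (phi x (real m)))" by (rule simple_function_phi[OF \<mu> s])
  have "label_entropy \<mu> (itinerary f (m + n)) \<le> label_entropy \<mu> (\<lambda>x. (itinerary f m x, itinerary f n (phi x (real m))))"
  proof (rule label_entropy_function[where F="\<lambda>(a, b). a @ b"])
    show "simple_function \<mu> (\<lambda>x. (itinerary f m x, itinerary f n (phi x (real m))))" by (intro simple_function_Pair s s2)
    fix x assume "x \<in> space \<mu>"
    then have x: "x \<in> X" by (simp add: ergodic_measuresD(3)[OF \<mu>])
    show "itinerary f (m + n) x = (case (itinerary f m x, itinerary f n (phi x (real m))) of (a, b) \<Rightarrow> a @ b)"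
      using x by (intro nth_equalityI) (auto simp: itinerary_def nth_append phi_phi)
  qed
  also have "\<dots> \<le> label_entropy \<mu> (itinerary f m) + label_entropy \<mu> (\<lambda>x. itinerary f n (phi x (real m)))"
    by (rule label_entropy_Pair[OF s s2])
  also have "label_entropy \<mu> (\<lambda>x. itinerary f n (phi x (real m))) = label_entropy \<mu> (itinerary f n)"
    by (rule label_entropy_phi[OF \<mu> s])
  finally show ?thesis .
qed

lemma label_entropy_itinerary_le:
  assumes \<mu>: "\<mu> \<in> ergodic_measures X phi" and f: "simple_function \<mu> f"
  shows "label_entropy \<mu> (itinerary f n) \<le> real n * label_entropy \<mu> f"
proof (induction n)
  case 0
  have "(\<lambda>x. []) ` space \<mu> = {[] :: 'b list}"
    using prob_space.not_empty[OF ergodic_measuresD(1)[OF \<mu>]] by auto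
  moreover have "measure \<mu> (space \<mu>) = 1" by (rule prob_space.prob_space[OF ergodic_measuresD(1)[OF \<mu>]])
  ultimately show ?case by (simp add: itinerary_def[abs_def] label_entropy_def)
next
  case (Suc n)
  have "label_entropy \<mu> (itinerary f (n + 1)) \<le> label_entropy \<mu> (itinerary f n) + label_entropy \<mu> (itinerary f 1)"
    by (rule label_entropy_itinerary_add[OF \<mu> f])
  moreover have "label_entropy \<mu> (itinerary f 1) \<le> label_entropy \<mu> f"
    by (rule prob_space.label_entropy_function[OF ergodic_measuresD(1)[OF \<mu>] f, where F="\<lambda>v. [v]"])
       (simp add: itinerary_def ergodic_measuresD(3)[OF \<mu>])
  ultimately show ?case using Suc by (simp add: algebra_simps)
qed

definition cell_of :: "'a set set \<Rightarrow> 'a \<Rightarrow> 'a set" where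
  "cell_of P x = (THE A. A \<in> P \<and> x \<in> A)"

lemma cell_of_eq:
  assumes "borel_partition X P" "A \<in> P" "x \<in> A" shows "cell_of P x = A"
  unfolding cell_of_def using assms unfolding borel_partition_def disjoint_def by (intro the_equality) auto

lemma cell_of_in:
  assumes "borel_partition X P" "x \<in> X" shows "cell_of P x \<in> P" "x \<in> cell_of P x"
proof -
  obtain A where "A \<in> P" "x \<in> A" using assms by (auto simp: borel_partition_def)
  then show "cell_of P x \<in> P" "x \<in> cell_of P x" using cell_of_eq[OF assms(1)] by auto
qed

lemma cell_of_simple:
  assumes \<mu>: "\<mu> \<in> ergodic_measures X phi" and P: "borel_partition X P"
  shows "simple_function \<mu> (cell_of P)"
  unfolding simple_function_def
proof (intro conjI ballI)
  note sp = ergodic_measuresD(3)[OF \<mu>]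
  have sub: "cell_of P ` space \<mu> \<subseteq> P" using cell_of_in(1)[OF P] by (auto simp: sp)
  then show "finite (cell_of P ` space \<mu>)" using P finite_subset by (auto simp: borel_partition_def)
  fix A assume "A \<in> cell_of P ` space \<mu>"
  then have A: "A \<in> P" using sub by auto
  have "cell_of P -` {A} \<inter> space \<mu> = A"
    using cell_of_eq[OF P A] cell_of_in(2)[OF P] A P by (auto simp: sp borel_partition_def)
  then show "cell_of P -` {A} \<inter> space \<mu> \<in> sets \<mu>"
    using A P ergodic_measuresD(2)[OF \<mu>] by (simp add: borel_partition_def)
qed

text \<open>The nonempty members of the join of a partition are exactly the fibres of the itinerary
  map. The join may also contain the empty set, which contributes nothing to the entropy.\<close>

lemma join_family_itinerary:
  assumes P: "borel_partition X P"
  shows "\<And>x. x \<in> X \<Longrightarrow> itinerary (cell_of P) n -` {itinerary (cell_of P) n x} \<inter> X \<in> join_family X phi P n"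
    and "\<And>A x. A \<in> join_family X phi P n \<Longrightarrow> x \<in> A \<Longrightarrow> A = itinerary (cell_of P) n -` {itinerary (cell_of P) n x} \<inter> X"
proof -
  show "itinerary (cell_of P) n -` {itinerary (cell_of P) n x} \<inter> X \<in> join_family X phi P n" if x: "x \<in> X" for x
  proof -
    have "itinerary (cell_of P) n -` {itinerary (cell_of P) n x} \<inter> X
        = X \<inter> (\<Inter>j<n. {y. phi y (real j) \<in> cell_of P (phi x (real j))})"
    proof -
      have "cell_of P (phi y t) = cell_of P (phi x t) \<longleftrightarrow> phi y t \<in> cell_of P (phi x t)" if "y \<in> X" for y t
        using cell_of_eq[OF P cell_of_in(1)[OF P phi_in[OF x]]] cell_of_in(2)[OF P phi_in[OF that]] by metis
      then show ?thesis by (auto simp: itinerary_eq_iff)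
    qed
    then show ?thesis unfolding join_family_def using cell_of_in(1)[OF P phi_in[OF x]]
      by (intro CollectI exI[of _ "\<lambda>j. cell_of P (phi x (real j))"]) simp
  qed
  show "A = itinerary (cell_of P) n -` {itinerary (cell_of P) n x} \<inter> X"
    if A: "A \<in> join_family X phi P n" "x \<in> A" for A x
  proof -
    obtain As where As: "A = X \<inter> (\<Inter>j<n. {x. phi x (real j) \<in> As j})" "\<forall>j<n. As j \<in> P"
      using A by (auto simp: join_family_def)
    have eq: "cell_of P (phi y (real j)) = As j \<longleftrightarrow> phi y (real j) \<in> As j" if "j < n" "y \<in> X" for j y
      using cell_of_eq[OF P] cell_of_in(2)[OF P phi_in[OF that(2)]] As(2) that(1) by metis
    have "x \<in> X" "\<And>j. j < n \<Longrightarrow> cell_of P (phi x (real j)) = As j" using As(1) A(2) eq by auto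
    then have "(\<forall>j<n. cell_of P (phi y (real j)) = cell_of P (phi x (real j))) \<longleftrightarrow> (\<forall>j<n. phi y (real j) \<in> As j)"
      if "y \<in> X" for y using eq[OF _ that] by metis
    then show ?thesis unfolding As(1) by (auto simp: itinerary_eq_iff)
  qed
qed

lemma disjoint_join_family:
  assumes P: "borel_partition X P"
  shows "disjoint (join_family X phi P n)"
  unfolding disjoint_def
proof (intro ballI impI)
  fix A B assume AB: "A \<in> join_family X phi P n" "B \<in> join_family X phi P n" "A \<noteq> B"
  show "A \<inter> B = {}"
  proof (rule ccontr)
    assume "A \<inter> B \<noteq> {}"
    then obtain x where "x \<in> A" "x \<in> B" by blast
    then show False using join_family_itinerary(2)[OF P AB(1)] join_family_itinerary(2)[OF P AB(2)] AB(3) by metis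
  qed
qed

lemma join_family_sets:
  assumes \<mu>: "\<mu> \<in> ergodic_measures X phi" and P: "borel_partition X P" and A: "A \<in> join_family X phi P n"
  shows "A \<in> sets \<mu>"
proof (cases "A = {}")
  case False
  then obtain x where "x \<in> A" by blast
  from join_family_itinerary(2)[OF P A this]
  show ?thesis
    using simple_functionD(2)[OF simple_function_itinerary[OF \<mu> cell_of_simple[OF \<mu> P]]] ergodic_measuresD(3)[OF \<mu>] by metis
qed simp

lemma part_entropy_join_family:
  assumes \<mu>: "\<mu> \<in> ergodic_measures X phi" and P: "borel_partition X P"
  shows "part_entropy \<mu> (join_family X phi P n) = label_entropy \<mu> (itinerary (cell_of P) n)"
proof -
  note sp = ergodic_measuresD(3)[OF \<mu>]
  let ?J = "join_family X phi P n" and ?f = "itinerary (cell_of P) n"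
  let ?c = "\<lambda>l. ?f -` {l} \<inter> X"
  let ?h = "\<lambda>A. measure \<mu> A * ln (measure \<mu> A)"
  have fin: "finite ?J" using P by (intro finite_join_family) (simp add: borel_partition_def)
  have sub: "?c ` (?f ` X) \<subseteq> ?J" using join_family_itinerary(1)[OF P] by auto
  have "A = {}" if "A \<in> ?J - ?c ` (?f ` X)" for A
  proof (rule ccontr)
    assume "A \<noteq> {}"
    then obtain x where x: "x \<in> A" by blast
    then have "x \<in> X" using that by (auto simp: join_family_def)
    then show False using join_family_itinerary(2)[OF P _ x, of n] that by blast
  qed
  then have "\<forall>A\<in>?J - ?c ` (?f ` X). ?h A = 0" by fastforce
  then have "(\<Sum>A\<in>?J. ?h A) = (\<Sum>A\<in>?c ` (?f ` X). ?h A)"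
    using fin sub by (intro sum.mono_neutral_right)
  also have "\<dots> = (\<Sum>l\<in>?f ` X. ?h (?c l))"
    by (rule sum.reindex_cong[of ?c]) (auto simp: inj_on_def)
  finally show ?thesis by (simp add: part_entropy_def label_entropy_def sp)
qed

lemma ent_part_tendsto:
  assumes \<mu>: "\<mu> \<in> ergodic_measures X phi" and P: "borel_partition X P"
  shows "(\<lambda>n. label_entropy \<mu> (itinerary (cell_of P) n) / real n) \<longlonglongrightarrow> ent_part \<mu> X phi P"
proof -
  interpret prob_space \<mu> by (rule ergodic_measuresD(1)[OF \<mu>])
  have "\<exists>l. (\<lambda>n. label_entropy \<mu> (itinerary (cell_of P) n) / real n) \<longlonglongrightarrow> l"
    by (intro subadditive_tendsto_Inf label_entropy_itinerary_add[OF \<mu> cell_of_simple[OF \<mu> P]] label_entropy_nonneg)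
  then obtain l where l: "(\<lambda>n. label_entropy \<mu> (itinerary (cell_of P) n) / real n) \<longlonglongrightarrow> l" by blast
  then have "ent_part \<mu> X phi P = l"
    unfolding ent_part_def part_entropy_join_family[OF \<mu> P] by (rule limI)
  then show ?thesis using l by simp
qed

text \<open>Markov's inequality for the information function: cells lighter than
  \<open>exp (- n * b')\<close> carry mass below \<open>1 / (1 + d)\<close>, because each unit of
  their mass contributes at least \<open>n * b'\<close> to the entropy. The heavy cells number at
  most \<open>exp (n * b')\<close>, and each lies in one Bowen ball.\<close>

lemma katok_lower_le_ent_part:
  assumes \<mu>: "\<mu> \<in> ergodic_measures X phi" and P: "borel_partition X P" and diam: "\<forall>A\<in>P. diameter A \<le> \<epsilon>"
    and e: "0 < \<epsilon>" and d: "0 < d" and b: "0 < b" "ent_part \<mu> X phi P < b"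
  shows "katok_lower \<mu> X phi (2 * \<epsilon>) (d / (2 * (1 + d))) \<le> ereal (b * (1 + d))"
proof -
  interpret prob_space \<mu> by (rule ergodic_measuresD(1)[OF \<mu>])
  note sp = ergodic_measuresD(3)[OF \<mu>]
  define \<delta> where "\<delta> = d / (2 * (1 + d))"
  have \<delta>: "0 < \<delta>" "\<delta> < 1" "\<delta> < 1 - 1 / (1 + d)" using d by (auto simp: \<delta>_def field_simps add_pos_pos)
  define b' where "b' = b * (1 + d)"
  have b': "0 < b'" using b d by (simp add: b'_def)
  have "\<forall>\<^sub>F n in sequentially. label_entropy \<mu> (itinerary (cell_of P) n) / real n < b"
    using ent_part_tendsto[OF \<mu> P] b(2) by (rule order_tendstoD)
  then have "\<forall>\<^sub>F n in sequentially. ereal (ln (real (katok_R \<mu> X phi n (2 * \<epsilon>) \<delta>)) / real n) \<le> ereal b'"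
    using eventually_gt_at_top[of 0]
  proof eventually_elim
    case (elim n)
    let ?J = "join_family X phi P n"
    have fin: "finite ?J" using P by (intro finite_join_family) (simp add: borel_partition_def)
    note sets = join_family_sets[OF \<mu> P, of _ n]
    \<comment> \<open>The heavy cells; the estimate below bounds the mass of the others.\<close>
    define F where "F = {A\<in>?J. exp (- (real n * b')) \<le> measure \<mu> A}"
    have finF: "finite F" using fin by (simp add: F_def)
    have msum: "measure \<mu> (\<Union>G) = (\<Sum>A\<in>G. measure \<mu> A)" if "G \<subseteq> ?J" for G
    proof -
      have "disjoint_family_on (\<lambda>A. A) G"
        using disjoint_join_family[OF P, of n] that unfolding disjoint_family_on_def disjoint_def by blast
      then show ?thesis
        using finite_measure_finite_Union[of G "\<lambda>A. A"] that sets fin finite_subset by (auto simp: subset_eq)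
    qed
    have "real n * b' * measure \<mu> (\<Union>(?J - F)) = (\<Sum>A\<in>?J - F. measure \<mu> A * (real n * b'))"
      by (subst msum) (auto simp: sum_distrib_left mult.commute)
    also have "\<dots> \<le> (\<Sum>A\<in>?J - F. - (measure \<mu> A * ln (measure \<mu> A)))"
    proof (rule sum_mono)
      fix A assume A: "A \<in> ?J - F"
      show "measure \<mu> A * (real n * b') \<le> - (measure \<mu> A * ln (measure \<mu> A))"
      proof (cases "measure \<mu> A = 0")
        case False
        then have pos: "0 < measure \<mu> A" by (simp add: less_le)
        have "measure \<mu> A < exp (- (real n * b'))" using A by (auto simp: F_def)
        then have "ln (measure \<mu> A) < - (real n * b')" using pos by (metis ln_less_cancel_iff exp_gt_zero ln_exp)
        then have "measure \<mu> A * (real n * b') \<le> measure \<mu> A * (- ln (measure \<mu> A))"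
          using pos by (intro mult_left_mono) auto
        then show ?thesis by simp
      qed simp
    qed
    also have "\<dots> \<le> (\<Sum>A\<in>?J. - (measure \<mu> A * ln (measure \<mu> A)))"
    proof (rule sum_mono2[OF fin])
      fix A
      have "ln (measure \<mu> A) \<le> 0 \<or> measure \<mu> A = 0"
        using prob_le_1[of A] measure_nonneg[of \<mu> A] by (auto simp: ln_le_zero_iff less_le)
      then show "0 \<le> - (measure \<mu> A * ln (measure \<mu> A))"
        by (auto simp: mult_nonneg_nonpos)
    qed auto
    also have "\<dots> = label_entropy \<mu> (itinerary (cell_of P) n)"
      using part_entropy_join_family[OF \<mu> P, of n] by (simp add: part_entropy_def sum_negf)
    also have "\<dots> < real n * b" using elim by (simp add: divide_less_eq mult.commute)
    finally have "b' * measure \<mu> (\<Union>(?J - F)) < b" using elim(2) by (simp add: mult.assoc)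
    then have small: "measure \<mu> (\<Union>(?J - F)) < 1 / (1 + d)"
    proof -
      have "b * ((1 + d) * measure \<mu> (\<Union>(?J - F))) < b * 1"
        using \<open>b' * measure \<mu> (\<Union>(?J - F)) < b\<close> by (simp add: b'_def mult.assoc)
      then have "(1 + d) * measure \<mu> (\<Union>(?J - F)) < 1" using b(1) by (simp only: mult_less_cancel_left_pos)
      then show ?thesis using d by (simp add: field_simps)
    qed
    have "measure \<mu> (\<Union>F) + measure \<mu> (\<Union>(?J - F)) = measure \<mu> (\<Union>?J)"
      using msum[of F] msum[of "?J - F"] msum[of ?J] sum.subset_diff[of F ?J "measure \<mu>"] fin by (auto simp: F_def)
    moreover have "\<Union>?J = X" using P by (intro join_family_cover) (simp add: borel_partition_def)
    ultimately have "\<delta> < measure \<mu> (\<Union>F)" using small \<delta>(3) prob_space sp by simp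
    then have "katok_R \<mu> X phi n (2 * \<epsilon>) \<delta> \<le> card F"
    proof (intro katok_R_le_family[OF _ e finF _ _ \<mu>])
      show "A \<subseteq> X \<and> diameter A \<le> \<epsilon>" if "A \<in> P" for A
        using diam that P sets.sets_into_space[of A BX] unfolding borel_partition_def by simp
    qed (simp_all add: F_def)
    moreover have "real (card F) * exp (- (real n * b')) \<le> 1"
    proof -
      have "real (card F) * exp (- (real n * b')) = (\<Sum>A\<in>F. exp (- (real n * b')))" by simp
      also have "\<dots> \<le> (\<Sum>A\<in>F. measure \<mu> A)" by (intro sum_mono) (auto simp: F_def)
      also have "\<dots> = measure \<mu> (\<Union>F)" by (rule msum[symmetric]) (auto simp: F_def)
      finally show ?thesis using prob_le_1[of "\<Union>F"] by linarith
    qed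
    then have "real (card F) \<le> exp (real n * b')" by (simp add: exp_minus field_simps)
    ultimately have "real (katok_R \<mu> X phi n (2 * \<epsilon>) \<delta>) \<le> exp (real n * b')" by linarith
    moreover have "1 \<le> katok_R \<mu> X phi n (2 * \<epsilon>) \<delta>" using \<delta> e by (intro katok_R_pos[OF \<mu>]) auto
    ultimately have "ln (real (katok_R \<mu> X phi n (2 * \<epsilon>) \<delta>)) \<le> real n * b'"
      by (metis exp_gt_zero ln_exp ln_le_cancel_iff of_nat_1 of_nat_le_iff less_le_trans zero_less_one)
    then show ?case using elim(2) by (simp add: divide_le_eq mult.commute)
  qed
  then have "limsup (\<lambda>n. ereal (ln (real (katok_R \<mu> X phi n (2 * \<epsilon>) \<delta>)) / real n)) \<le> ereal b'"
    by (rule Limsup_bounded)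
  moreover have "katok_lower \<mu> X phi (2 * \<epsilon>) \<delta> \<le> limsup (\<lambda>n. ereal (ln (real (katok_R \<mu> X phi n (2 * \<epsilon>) \<delta>)) / real n))"
    unfolding katok_lower_def by (rule Liminf_le_Limsup) simp
  ultimately show ?thesis unfolding \<delta>_def b'_def by (rule order_trans[rotated])
qed

section \<open>Partitions of small entropy from markers\<close>

lemma measurable_selection:
  assumes "finite E" "\<And>y. y \<in> E \<Longrightarrow> V y \<in> sets BX"
  shows "\<exists>sel. (\<forall>x\<in>(\<Union>y\<in>E. V y). sel x \<in> E \<and> x \<in> V (sel x)) \<and> (\<forall>y. {x\<in>X. sel x = y} \<in> sets BX)"
  using assms
proof (induction E rule: finite_induct)
  case empty
  have "{x\<in>X. undefined = y} \<in> sets BX" for y :: 'b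
    using sets.top[of BX] by (cases "undefined = y") auto
  then show ?case by (intro exI[of _ "\<lambda>_. undefined"]) auto
next
  case (insert z E)
  then obtain sel where sel: "\<And>x. x \<in> (\<Union>y\<in>E. V y) \<Longrightarrow> sel x \<in> E \<and> x \<in> V (sel x)"
    "\<And>y. {x\<in>X. sel x = y} \<in> sets BX" by auto
  let ?s = "\<lambda>x. if x \<in> V z then z else sel x"
  have Vz: "V z \<in> sets BX" using insert by auto
  have "{x\<in>X. ?s x = y} = ({x\<in>X. sel x = y} - V z) \<union> (if y = z then V z else {})" for y
    using sets.sets_into_space[OF Vz] by auto
  then have "{x\<in>X. ?s x = y} \<in> sets BX" for y using sel(2)[of y] Vz by (auto intro!: sets.Un sets.Diff)
  moreover have "?s x \<in> insert z E \<and> x \<in> V (?s x)" if "x \<in> (\<Union>y\<in>insert z E. V y)" for x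
    using that sel(1)[of x] by auto
  ultimately show ?case by (intro exI[of _ ?s]) blast
qed

lemma simple_function_from_fibres:
  assumes \<mu>: "\<mu> \<in> ergodic_measures X phi" and "finite (f ` X)" "\<And>y. {x\<in>X. f x = y} \<in> sets BX"
  shows "simple_function \<mu> f"
  unfolding simple_function_def
proof (intro conjI ballI)
  show "finite (f ` space \<mu>)" using assms(2) ergodic_measuresD(3)[OF \<mu>] by simp
  fix y
  have "f -` {y} \<inter> space \<mu> = {x\<in>X. f x = y}" using ergodic_measuresD(3)[OF \<mu>] by auto
  then show "f -` {y} \<inter> space \<mu> \<in> sets \<mu>" using assms(3) ergodic_measuresD(2)[OF \<mu>] by simp
qed

text \<open>The cells are the fibres of the labelling \<open>f\<close>. The constant
  \<open>C\<close> disappears on division by \<open>n\<close>, so labels that depend on a bounded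
  stretch of the past are admissible.\<close>

lemma partition_from_labels:
  assumes \<mu>: "\<mu> \<in> ergodic_measures X phi" and f: "simple_function \<mu> f"
    and close: "\<And>x y. x \<in> X \<Longrightarrow> y \<in> X \<Longrightarrow> f x = f y \<Longrightarrow> dist x y \<le> \<epsilon>"
    and le: "\<And>n. label_entropy \<mu> (itinerary f n) \<le> real n * h + C"
  shows "\<exists>P. borel_partition X P \<and> (\<forall>A\<in>P. diameter A \<le> \<epsilon>) \<and> ent_part \<mu> X phi P \<le> h"
proof -
  note sp = ergodic_measuresD(3)[OF \<mu>]
  define G where "G v = {x\<in>X. f x = v}" for v
  define P where "P = G ` (f ` X)"
  have Gs: "G v \<in> sets BX" for v
  proof -
    have "G v = f -` {v} \<inter> space \<mu>" by (auto simp: G_def sp)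
    then show ?thesis using simple_functionD(2)[OF f] ergodic_measuresD(2)[OF \<mu>] by simp
  qed
  have P: "borel_partition X P"
    unfolding borel_partition_def
  proof (intro conjI ballI)
    show "finite P" using simple_functionD(1)[OF f] by (simp add: P_def sp)
    show "A \<in> sets BX" if "A \<in> P" for A using that Gs by (auto simp: P_def)
    show "A \<noteq> {}" if "A \<in> P" for A using that by (auto simp: P_def G_def)
    show "disjoint P" by (auto simp: disjoint_def P_def G_def)
    show "\<Union>P = X" by (auto simp: P_def G_def)
  qed
  have "diameter A \<le> \<epsilon>" if A: "A \<in> P" for A
  proof -
    obtain x0 where x0: "x0 \<in> X" "A = G (f x0)" using A by (auto simp: P_def)
    have "A \<noteq> {}" "\<And>x y. x \<in> A \<Longrightarrow> y \<in> A \<Longrightarrow> dist x y \<le> \<epsilon>" using x0 close by (auto simp: G_def)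
    then show ?thesis by (auto simp: diameter_def intro!: cSUP_least)
  qed
  moreover have "ent_part \<mu> X phi P \<le> h"
  proof (rule LIMSEQ_le)
    show "(\<lambda>n. label_entropy \<mu> (itinerary (cell_of P) n) / real n) \<longlonglongrightarrow> ent_part \<mu> X phi P"
      by (rule ent_part_tendsto[OF \<mu> P])
    have "(\<lambda>n. h + C / real n) \<longlonglongrightarrow> h + 0" by (intro tendsto_intros lim_const_over_n)
    then show "(\<lambda>n. h + C / real n) \<longlonglongrightarrow> h" by simp
    show "\<exists>N. \<forall>n\<ge>N. label_entropy \<mu> (itinerary (cell_of P) n) / real n \<le> h + C / real n"
    proof (intro exI[of _ 1] allI impI)
      fix n :: nat assume n: "1 \<le> n"
      have cell: "cell_of P x = G (f x)" if "x \<in> X" for x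
        using that by (intro cell_of_eq[OF P]) (auto simp: P_def G_def)
      have "label_entropy \<mu> (itinerary (cell_of P) n) \<le> label_entropy \<mu> (itinerary f n)"
        by (rule prob_space.label_entropy_function[OF ergodic_measuresD(1)[OF \<mu>] simple_function_itinerary[OF \<mu> f], where F="map G"])
          (auto simp: itinerary_def sp cell phi_in)
      also have "\<dots> \<le> real n * h + C" by (rule le)
      finally show "label_entropy \<mu> (itinerary (cell_of P) n) / real n \<le> h + C / real n" using n by (simp add: field_simps)
    qed
  qed
  ultimately show ?thesis using P by blast
qed

text \<open>Naming the type costs at most \<open>ln 3\<close>; beyond that each type pays for its
  alphabet only as often as it occurs. A large alphabet is therefore affordable for a rare
  type.\<close>

lemma label_entropy_three_types:
  assumes \<mu>: "\<mu> \<in> ergodic_measures X phi" and f: "simple_function \<mu> f"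
    and fst: "\<And>x. x \<in> X \<Longrightarrow> fst (f x) \<in> {0, 1, 2::nat}"
    and c0: "card {v\<in>f ` X. fst v = 0} \<le> 1" and c1: "card {v\<in>f ` X. fst v = 1} \<le> M"
    and c2: "card {v\<in>f ` X. fst v = 2} \<le> K" and MK: "1 \<le> M" "1 \<le> K"
  shows "label_entropy \<mu> f \<le> ln 3 + measure \<mu> {x\<in>X. fst (f x) = 1} * ln M + measure \<mu> {x\<in>X. fst (f x) = 2} * ln K"
proof -
  interpret prob_space \<mu> by (rule ergodic_measuresD(1)[OF \<mu>])
  note sp = ergodic_measuresD(3)[OF \<mu>]
  define S where "S = f ` X"
  have fin: "finite S" using simple_functionD(1)[OF f] by (simp add: S_def sp)
  define p where "p v = measure \<mu> (f -` {v} \<inter> space \<mu>)" for v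
  have sets: "f -` {v} \<inter> space \<mu> \<in> sets \<mu>" for v by (rule simple_functionD(2)[OF f])
  have psum: "(\<Sum>v\<in>{v\<in>S. Q v}. p v) = measure \<mu> {x\<in>X. Q (f x)}" for Q
  proof -
    have "{x\<in>X. Q (f x)} = (\<Union>v\<in>{v\<in>S. Q v}. f -` {v} \<inter> space \<mu>)" by (auto simp: S_def sp)
    moreover have "measure \<mu> (\<Union>v\<in>{v\<in>S. Q v}. f -` {v} \<inter> space \<mu>) = (\<Sum>v\<in>{v\<in>S. Q v}. p v)"
      unfolding p_def using fin sets by (intro finite_measure_finite_Union) (auto simp: disjoint_family_on_def)
    ultimately show ?thesis by simp
  qed
  define w where "w v = (if fst v = 0 then 1 else if fst v = 1 then real M else real K)" for v :: "nat \<times> 'b"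
  have wpos: "1 \<le> w v" for v using MK by (simp add: w_def)
  \<comment> \<open>The comparison weights for the Gibbs inequality: one third for each type, spread
    evenly over at most \<open>w v\<close> labels.\<close>
  define q where "q v = 1 / (3 * w v)" for v
  have split: "(\<Sum>v\<in>S. g v) = (\<Sum>v\<in>{v\<in>S. fst v = 0}. g v) + (\<Sum>v\<in>{v\<in>S. fst v = 1}. g v) + (\<Sum>v\<in>{v\<in>S. fst v = 2}. g v)"
    for g :: "nat \<times> 'b \<Rightarrow> real"
  proof -
    have "fst v = 0 \<or> fst v = 1 \<or> fst v = 2" if v: "v \<in> S" for v
    proof -
      obtain x where "x \<in> X" "v = f x" using v by (auto simp: S_def)
      then show ?thesis using fst[of x] by auto
    qed
    then have "S = {v\<in>S. fst v = 0} \<union> {v\<in>S. fst v = 1} \<union> {v\<in>S. fst v = 2}" by blast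
    then have "(\<Sum>v\<in>S. g v) = (\<Sum>v\<in>{v\<in>S. fst v = 0} \<union> {v\<in>S. fst v = 1} \<union> {v\<in>S. fst v = 2}. g v)" by simp
    also have "\<dots> = (\<Sum>v\<in>{v\<in>S. fst v = 0} \<union> {v\<in>S. fst v = 1}. g v) + (\<Sum>v\<in>{v\<in>S. fst v = 2}. g v)"
      using fin by (intro sum.union_disjoint) auto
    also have "(\<Sum>v\<in>{v\<in>S. fst v = 0} \<union> {v\<in>S. fst v = 1}. g v) = (\<Sum>v\<in>{v\<in>S. fst v = 0}. g v) + (\<Sum>v\<in>{v\<in>S. fst v = 1}. g v)"
      using fin by (intro sum.union_disjoint) auto
    finally show ?thesis .
  qed
  have "label_entropy \<mu> f = - (\<Sum>v\<in>S. p v * ln (p v))" by (simp add: label_entropy_def p_def S_def sp)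
  also have "\<dots> \<le> (\<Sum>v\<in>S. p v * (- ln (q v)))"
  proof (rule Gibbs_inequality[OF fin])
    show "0 \<le> p v" for v by (simp add: p_def)
    show "(\<Sum>v\<in>S. p v) = 1" using psum[of "\<lambda>_. True"] prob_space sp by simp
    show "0 < q v" for v using wpos[of v] by (simp add: q_def)
    have "(\<Sum>v\<in>{v\<in>S. fst v = i}. q v) \<le> 1 / 3" if "i \<in> {0, 1, 2}" for i
    proof -
      have "(\<Sum>v\<in>{v\<in>S. fst v = i}. q v) = real (card {v\<in>S. fst v = i}) * (1 / (3 * w (i, undefined)))"
        by (simp add: q_def w_def)
      also have "real (card {v\<in>S. fst v = i}) \<le> w (i, undefined)"
        using that c0 c1 c2 by (auto simp: w_def S_def)
      finally show ?thesis using wpos[of "(i, undefined)"] by (simp add: mult_right_mono field_simps)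
    qed
    from this[of 0] this[of 1] this[of 2] show "(\<Sum>v\<in>S. q v) \<le> 1" unfolding split by simp
  qed
  also have "\<dots> = (\<Sum>v\<in>S. p v * ln 3 + p v * ln (w v))"
  proof (intro sum.cong refl)
    fix v
    have "0 < w v" using wpos[of v] by linarith
    then have "- ln (q v) = ln 3 + ln (w v)" by (simp add: q_def ln_div ln_mult_pos)
    then show "p v * (- ln (q v)) = p v * ln 3 + p v * ln (w v)" by (simp add: distrib_left)
  qed
  also have "\<dots> = ln 3 + (\<Sum>v\<in>S. p v * ln (w v))"
    using psum[of "\<lambda>_. True"] prob_space sp by (simp add: sum.distrib sum_distrib_right[symmetric])
  also have "(\<Sum>v\<in>S. p v * ln (w v)) = (\<Sum>v\<in>{v\<in>S. fst v = 1}. p v) * ln M + (\<Sum>v\<in>{v\<in>S. fst v = 2}. p v) * ln K"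
    unfolding split sum_distrib_right by (simp add: w_def)
  finally show ?thesis unfolding psum by simp
qed

text \<open>The labels below record block starts together with the code of the block, a default label on the
  part not covered by blocks, and nothing elsewhere; they determine the partition element of the
  current point by looking back at most \<open>N\<close> steps.\<close>

lemma entropy_from_markers:
  assumes \<mu>: "\<mu> \<in> ergodic_measures X phi" and e: "0 < \<epsilon>" and c: "span_rate X phi (\<epsilon> / 2) < ereal c"
    and markers: "\<And>\<kappa>. 0 < \<kappa> \<Longrightarrow> \<exists>A\<in>sets BX. measure \<mu> A \<le> \<kappa> \<and>
       (\<exists>m. 1 - \<kappa> \<le> measure \<mu> (\<Union>k<m. {x\<in>X. phi x (- real k) \<in> A}))"
  shows "\<exists>P. borel_partition X P \<and> (\<forall>A\<in>P. diameter A \<le> \<epsilon>) \<and> ent_part \<mu> X phi P \<le> c + ln 3 + 1"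
proof -
  interpret prob_space \<mu> by (rule ergodic_measuresD(1)[OF \<mu>])
  note sp = ergodic_measuresD(3)[OF \<mu>] and st = ergodic_measuresD(2)[OF \<mu>]
  have e2: "0 < \<epsilon> / 2" using e by simp
  have c0: "0 \<le> c" using span_rate_nonneg[OF e2] c by (metis ereal_less_eq(5) less_imp_le order_trans)
  from span_rate_less[OF c] obtain N0 where N0: "\<And>n. N0 \<le> n \<Longrightarrow> ln (real (span_num X phi (real n) (\<epsilon> / 2))) \<le> real n * c"
    by (auto simp: eventually_sequentially)
  define N where "N = Suc N0"
  have N: "0 < N" "ln (real (span_num X phi (real N) (\<epsilon> / 2))) \<le> real N * c" using N0[of N] by (auto simp: N_def simp del: of_nat_Suc)
  obtain E where E: "finite E" "E \<subseteq> X" "card E = span_num X phi (real N) (\<epsilon> / 2)"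
    "X = (\<Union>y\<in>E. bowen_ball X phi N y (\<epsilon> / 2))" using span_cover[OF e2] by metis
  obtain C where C: "finite C" "C \<subseteq> X" "X = (\<Union>y\<in>C. bowen_ball X phi 1 y (\<epsilon> / 2))"
    using finite_bowen_cover[OF e2, of 1] by metis
  have cards: "1 \<le> card E" "1 \<le> card C"
  proof -
    have "E \<noteq> {}" "C \<noteq> {}" using X_nonempty E(4) C(3) by auto
    then show "1 \<le> card E" "1 \<le> card C" using E(1) C(1) by (auto simp: Suc_leI card_gt_0_iff)
  qed
  obtain code where code: "\<And>x. x \<in> X \<Longrightarrow> code x \<in> E \<and> x \<in> bowen_ball X phi N (code x) (\<epsilon> / 2)"
    "\<And>y. {x\<in>X. code x = y} \<in> sets BX"
  proof -
    have "\<exists>sel. (\<forall>x\<in>(\<Union>y\<in>E. bowen_ball X phi N y (\<epsilon> / 2)). sel x \<in> E \<and> x \<in> bowen_ball X phi N (sel x) (\<epsilon> / 2)) \<and> (\<forall>y. {x\<in>X. sel x = y} \<in> sets BX)"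
      using E(2) by (intro measurable_selection[OF E(1)] bowen_ball_sets) auto
    then show thesis unfolding E(4)[symmetric] using that by blast
  qed
  obtain dflt where dflt: "\<And>x. x \<in> X \<Longrightarrow> dflt x \<in> C \<and> x \<in> bowen_ball X phi 1 (dflt x) (\<epsilon> / 2)"
    "\<And>y. {x\<in>X. dflt x = y} \<in> sets BX"
  proof -
    have "\<exists>sel. (\<forall>x\<in>(\<Union>y\<in>C. bowen_ball X phi 1 y (\<epsilon> / 2)). sel x \<in> C \<and> x \<in> bowen_ball X phi 1 (sel x) (\<epsilon> / 2)) \<and> (\<forall>y. {x\<in>X. sel x = y} \<in> sets BX)"
      using C(2) by (intro measurable_selection[OF C(1)] bowen_ball_sets) auto
    then show thesis unfolding C(3)[symmetric] using that by blast
  qed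
  \<comment> \<open>Makes the total price of the marker set and of the part not covered by blocks at
    most 1 in the final bound.\<close>
  define \<kappa> where "\<kappa> = 1 / (real N * c + ln (card C) + 1)"
  have den: "0 < real N * c + ln (card C) + 1" using c0 cards by (intro add_nonneg_pos add_nonneg_nonneg) auto
  then have \<kappa>: "0 < \<kappa>" by (simp add: \<kappa>_def)
  obtain A m where A: "A \<in> sets BX" "measure \<mu> A \<le> \<kappa>"
    and m: "1 - \<kappa> \<le> measure \<mu> (\<Union>k<m. {x\<in>X. phi x (- real k) \<in> A})" using markers[OF \<kappa>] by blast
  define V where "V k = {x\<in>X. phi x (- real k) \<in> A}" for k :: nat
  have Vs: "V k \<in> sets BX" for k unfolding V_def by (rule preimage_sets[OF A(1)])
  have Vshift: "phi x (- real r) \<in> V k \<longleftrightarrow> x \<in> V (r + k)" if "x \<in> X" for x r k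
    using that by (simp add: V_def phi_phi phi_in diff_diff_eq add.commute)
  \<comment> \<open>Each visit to \<open>A\<close> restarts the counting. Block starts are the
    points whose latest visit is a multiple of \<open>N\<close> steps old, with ages below
    \<open>m\<close> only.\<close>
  define B where "B = (\<Union>k\<in>{k. k < m \<and> N dvd k}. V k - (\<Union>i<k. V i))"
  have Bs: "B \<in> sets BX" unfolding B_def by (intro sets.finite_UN sets.Diff Vs) auto
  have BX: "B \<subseteq> X" by (auto simp: B_def V_def)
  define D where "D = X - (\<Union>r<N. {x\<in>X. phi x (- real r) \<in> B})"
  have Ds: "D \<in> sets BX" unfolding D_def
    using sets.top[of BX] by (intro sets.Diff sets.finite_UN preimage_sets[OF Bs]) auto
  have BD: "B \<inter> D = {}" using N(1) BX by (auto simp: D_def)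
  have "D \<inter> (\<Union>k<m. V k) = {}"
  proof (rule ccontr)
    assume "D \<inter> (\<Union>k<m. V k) \<noteq> {}"
    then obtain x k' where x: "x \<in> D" "k' < m" "x \<in> V k'" by auto
    then have xX: "x \<in> X" by (simp add: D_def)
    define k where "k = (LEAST k. x \<in> V k)"
    have k: "x \<in> V k" "k \<le> k'" "\<And>i. i < k \<Longrightarrow> x \<notin> V i"
      unfolding k_def using x(3) by (auto intro: LeastI Least_le dest: not_less_Least)
    \<comment> \<open>A point whose latest visit is \<open>k < m\<close> steps old is covered: going
      back \<open>k mod N\<close> steps leads to a block start. Hence \<open>D\<close> misses the
      sets \<open>V k\<close> with \<open>k < m\<close>, whose union has almost full
      measure.\<close>
    define r where "r = k mod N"
    have r: "r < N" "r \<le> k" "N dvd (k - r)" using N(1) by (auto simp: r_def dvd_minus_mod)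
    have "phi x (- real r) \<in> V (k - r)" "\<And>i. i < k - r \<Longrightarrow> phi x (- real r) \<notin> V i"
      using Vshift[OF xX] k r(2) by auto
    then have "phi x (- real r) \<in> B" unfolding B_def using r k(2) x(2) by (intro UN_I[of "k - r"]) auto
    then show False using x(1) r(1) xX by (auto simp: D_def)
  qed
  then have "D \<subseteq> space \<mu> - (\<Union>k<m. V k)" by (auto simp: D_def sp)
  then have "measure \<mu> D \<le> measure \<mu> (space \<mu> - (\<Union>k<m. V k))"
    using Vs st sets.top[of \<mu>] by (intro finite_measure_mono sets.Diff sets.finite_UN) auto
  also have "\<dots> = 1 - measure \<mu> (\<Union>k<m. V k)" using Vs st by (intro prob_compl) auto
  finally have mD: "measure \<mu> D \<le> \<kappa>" using m by (simp add: V_def)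
  have mB: "measure \<mu> B \<le> 1 / real N + \<kappa>"
  proof -
    \<comment> \<open>A start outside \<open>A\<close> comes at least \<open>N\<close> steps after
      the latest visit, so another start fewer than \<open>N\<close> steps earlier would count from
      the same visit, and their distance would be a multiple of \<open>N\<close>. Thus
      \<open>N\<close> translates of \<open>B - A\<close> are disjoint; starts inside
      \<open>A\<close> are charged to \<open>A\<close>.\<close>
    define S where "S j = {x\<in>X. phi x (real j) \<in> B - A}" for j :: nat
    have BA: "B - A \<in> sets BX" using Bs A(1) by auto
    have Ss: "S j \<in> sets \<mu>" for j unfolding S_def using preimage_sets[OF BA] st by simp
    have disj: "S i \<inter> S j = {}" if ij: "i < j" "j < N" for i j
    proof (rule ccontr)
      assume "S i \<inter> S j \<noteq> {}"
      then obtain x where x: "x \<in> X" "phi x (real i) \<in> B" "phi x (real j) \<in> B" "phi x (real j) \<notin> A"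
        by (auto simp: S_def)
      define z where "z = phi x (real j)"
      have zX: "z \<in> X" using x(1) by (simp add: z_def phi_in)
      have y: "phi z (- real (j - i)) = phi x (real i)" using x(1) ij by (simp add: z_def phi_phi)
      obtain k where k: "N dvd k" "z \<in> V k" "\<And>i. i < k \<Longrightarrow> z \<notin> V i" using x(3) by (auto simp: B_def z_def)
      obtain l where l: "N dvd l" "phi x (real i) \<in> V l" "\<And>i'. i' < l \<Longrightarrow> phi x (real i) \<notin> V i'" using x(2) by (auto simp: B_def)
      have "z \<notin> V 0" using x(4) zX by (simp add: V_def z_def)
      then have "k \<noteq> 0" using k(2) by metis
      then have kN: "N \<le> k" using k(1) by (simp add: dvd_imp_le)
      have lv: "phi x (real i) \<in> V i' \<longleftrightarrow> z \<in> V (j - i + i')" for i' using Vshift[OF zX, of "j - i" i'] y by simp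
      have "z \<in> V (j - i + l)" using l(2) lv by simp
      then have "k \<le> j - i + l" using k(3) not_le by blast
      moreover have "phi x (real i) \<in> V (k - (j - i))" using lv k(2) kN ij by simp
      then have "l \<le> k - (j - i)" using l(3) not_le by blast
      ultimately have "k = l + (j - i)" using kN ij by linarith
      then have "N dvd (j - i)" using k(1) l(1) by (simp add: dvd_add_right_iff)
      then show False using ij by (auto dest: dvd_imp_le)
    qed
    have "real N * measure \<mu> (B - A) = (\<Sum>j<N. measure \<mu> (S j))"
      unfolding S_def using ergodic_measuresD(4)[OF \<mu> BA] by simp
    also have "\<dots> = measure \<mu> (\<Union>j<N. S j)"
    proof (rule finite_measure_finite_Union[symmetric])
      show "disjoint_family_on S {..<N}"
        unfolding disjoint_family_on_def using disj by (metis Int_commute lessThan_iff nat_neq_iff)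
    qed (use Ss in auto)
    also have "\<dots> \<le> 1" by (rule prob_le_1)
    finally have "measure \<mu> (B - A) \<le> 1 / real N" using N(1) by (simp add: field_simps)
    moreover have "measure \<mu> B \<le> measure \<mu> (B - A) + measure \<mu> A"
    proof -
      have s: "B - A \<in> sets \<mu>" "A \<in> sets \<mu>" using BA A(1) st by simp_all
      have "measure \<mu> B \<le> measure \<mu> (B - A \<union> A)" using sets.Un[OF s] by (intro finite_measure_mono) auto
      also have "\<dots> \<le> measure \<mu> (B - A) + measure \<mu> A" using s by (rule measure_Un_le)
      finally show ?thesis .
    qed
    ultimately show ?thesis using A(2) by linarith
  qed
  \<comment> \<open>Type 1 marks block starts, type 2 the uncovered part, type 0 all other points,
    which share a single silent label.\<close>
  define \<rho> where "\<rho> x = (if x \<in> B then (1::nat, code x) else if x \<in> D then (2, dflt x) else (0, undefined))" for x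
  have \<rho>s: "simple_function \<mu> \<rho>"
  proof (rule simple_function_from_fibres[OF \<mu>])
    have "\<rho> ` X \<subseteq> {1} \<times> E \<union> {2} \<times> C \<union> {(0, undefined)}" using code(1) dflt(1) by (auto simp: \<rho>_def)
    then show "finite (\<rho> ` X)" by (rule finite_subset) (use E C in auto)
    fix v :: "nat \<times> 'a"
    have "{x\<in>X. \<rho> x = v} = (if fst v = 1 then B \<inter> {x\<in>X. code x = snd v} else {}) \<union>
        (if fst v = 2 then (D - B) \<inter> {x\<in>X. dflt x = snd v} else {}) \<union> (if v = (0, undefined) then X - B - D else {})"
      using BX by (cases v) (auto simp: \<rho>_def D_def)
    moreover have "X \<in> sets BX" using sets.top[of BX] by simp
    ultimately show "{x\<in>X. \<rho> x = v} \<in> sets BX" using Bs Ds code(2)[of "snd v"] dflt(2)[of "snd v"] by auto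
  qed
  \<comment> \<open>\<open>w r\<close> is the label seen \<open>r\<close> steps ago. The most recent
    block start within \<open>N\<close> steps names a spanning orbit, which is followed for
    \<open>r\<close> steps; without one, the present label itself names a nearby point.\<close>
  define decode where "decode w = (if \<exists>r<N. fst (w r) = 1 then
      (let r = (LEAST r. r < N \<and> fst (w r) = 1) in phi (snd (w r)) (real r)) else snd (w 0))" for w :: "nat \<Rightarrow> nat \<times> 'a"
  have decode_cong: "decode w = decode w'" if "\<And>r. r < N \<Longrightarrow> w r = w' r" for w w'
  proof -
    have eq: "(\<lambda>r. r < N \<and> fst (w r) = 1) = (\<lambda>r. r < N \<and> fst (w' r) = 1)" using that by auto
    show ?thesis
    proof (cases "\<exists>r<N. fst (w r) = 1")
      case True
      then have "(LEAST r. r < N \<and> fst (w r) = 1) < N" using LeastI_ex[of "\<lambda>r. r < N \<and> fst (w r) = 1"] by blast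
      moreover have "\<exists>r<N. fst (w' r) = 1" using True that by auto
      ultimately show ?thesis using True that eq by (simp add: decode_def Let_def)
    next
      case False
      moreover have "\<not> (\<exists>r<N. fst (w' r) = 1)" using False that by auto
      ultimately have "decode w = snd (w 0)" "decode w' = snd (w' 0)" unfolding decode_def by (simp_all only: if_False)
      then show ?thesis using that[OF N(1)] by simp
    qed
  qed
  define f where "f x = decode (\<lambda>r. \<rho> (phi x (- real r)))" for x
  have near: "dist (f x) x < \<epsilon> / 2" if x: "x \<in> X" for x
  proof (cases "\<exists>r<N. fst (\<rho> (phi x (- real r))) = 1")
    case True
    define r where "r = (LEAST r. r < N \<and> fst (\<rho> (phi x (- real r))) = 1)"
    have r: "r < N" "fst (\<rho> (phi x (- real r))) = 1"
      unfolding r_def using LeastI_ex[of "\<lambda>r. r < N \<and> fst (\<rho> (phi x (- real r))) = 1"] True by blast+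
    let ?y = "phi x (- real r)"
    have yX: "?y \<in> X" using x by (rule phi_in)
    have "?y \<in> B" using r(2) by (auto simp: \<rho>_def split: if_splits)
    then have "f x = phi (code ?y) (real r)" using True unfolding f_def decode_def Let_def r_def[symmetric] by (simp add: \<rho>_def)
    moreover have "dist (phi (code ?y) (real r)) (phi ?y (real r)) < \<epsilon> / 2"
      using code(1)[OF yX] r(1) by (simp add: bowen_ball_def)
    ultimately show ?thesis using x by (simp add: phi_phi)
  next
    case False
    then have nB: "phi x (- real r) \<notin> B" if "r < N" for r using that by (auto simp: \<rho>_def)
    then have "x \<in> D" using x by (auto simp: D_def)
    moreover have "x \<notin> B" using nB[OF N(1)] x by simp
    moreover have "f x = snd (\<rho> (phi x (- real 0)))" unfolding f_def decode_def using False by (rule if_not_P)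
    ultimately have "f x = dflt x" using x by (simp add: \<rho>_def)
    moreover have "dist (dflt x) x < \<epsilon> / 2"
      using dflt(1)[OF x] C(2) x by (auto simp: bowen_ball_def)
    ultimately show ?thesis by simp
  qed
  have fs: "simple_function \<mu> f"
  proof -
    have "f x = ((\<lambda>l. decode (\<lambda>r. l ! r)) \<circ> (\<lambda>x. map (\<lambda>r. \<rho> (phi x (- real r))) [0..<N])) x" for x
      unfolding f_def comp_def by (rule decode_cong) simp
    then have "f = (\<lambda>l. decode (\<lambda>r. l ! r)) \<circ> (\<lambda>x. map (\<lambda>r. \<rho> (phi x (- real r))) [0..<N])" by blast
    then show ?thesis using simple_function_compose[OF simple_function_map[OF \<mu> \<rho>s, of "\<lambda>r. - real r" "[0..<N]"]] by simp
  qed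
  define h where "h = label_entropy \<mu> \<rho>"
  \<comment> \<open>By invariance the itinerary may start at time \<open>N\<close>, so that all
    labels looked up in the past are among the \<open>n + N\<close> recorded ones. The extra
    \<open>N\<close> symbols add only a bounded term.\<close>
  have "label_entropy \<mu> (itinerary f n) \<le> real n * h + real N * h" for n
  proof -
    have "label_entropy \<mu> (itinerary f n) = label_entropy \<mu> (\<lambda>x. itinerary f n (phi x (real N)))"
      by (rule label_entropy_phi[symmetric, OF \<mu> simple_function_itinerary[OF \<mu> fs]])
    also have "\<dots> \<le> label_entropy \<mu> (itinerary \<rho> (n + N))"
    proof (rule label_entropy_function[OF simple_function_itinerary[OF \<mu> \<rho>s],
          where F="\<lambda>l. map (\<lambda>j. decode (\<lambda>r. l ! (N + j - r))) [0..<n]"])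
      fix x assume "x \<in> space \<mu>"
      then have x: "x \<in> X" by (simp add: sp)
      have "f (phi (phi x (real N)) (real j)) = decode (\<lambda>r. itinerary \<rho> (n + N) x ! (N + j - r))" if "j < n" for j
        unfolding f_def
      proof (rule decode_cong)
        fix r assume r: "r < N"
        have "real (N + j - r) = real N + real j - real r" using r by simp
        then show "\<rho> (phi (phi (phi x (real N)) (real j)) (- real r)) = itinerary \<rho> (n + N) x ! (N + j - r)"
          using x r that by (simp add: itinerary_def phi_phi phi_in algebra_simps)
      qed
      then have "map (\<lambda>j. f (phi (phi x (real N)) (real j))) [0..<n] = map (\<lambda>j. decode (\<lambda>r. itinerary \<rho> (n + N) x ! (N + j - r))) [0..<n]"
        by (intro map_cong) auto
      then show "itinerary f n (phi x (real N)) = map (\<lambda>j. decode (\<lambda>r. itinerary \<rho> (n + N) x ! (N + j - r))) [0..<n]"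
        by (simp only: itinerary_def[of f])
    qed
    also have "\<dots> \<le> real (n + N) * h" unfolding h_def by (rule label_entropy_itinerary_le[OF \<mu> \<rho>s])
    finally show ?thesis by (simp add: algebra_simps)
  qed
  moreover have "dist x y \<le> \<epsilon>" if "x \<in> X" "y \<in> X" "f x = f y" for x y
    using near[OF that(1)] near[OF that(2)] that(3) dist_triangle3[of x y "f x"] by simp
  ultimately obtain P where P: "borel_partition X P" "\<forall>A\<in>P. diameter A \<le> \<epsilon>" "ent_part \<mu> X phi P \<le> h"
    using partition_from_labels[OF \<mu> fs, of \<epsilon> h "real N * h"] by blast
  have "h \<le> ln 3 + measure \<mu> {x\<in>X. fst (\<rho> x) = 1} * ln (card E) + measure \<mu> {x\<in>X. fst (\<rho> x) = 2} * ln (card C)"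
    unfolding h_def
  proof (rule label_entropy_three_types[OF \<mu> \<rho>s])
    show "fst (\<rho> x) \<in> {0, 1, 2}" for x by (auto simp: \<rho>_def)
    have "{v\<in>\<rho> ` X. fst v = 0} \<subseteq> {(0, undefined)}" by (auto simp: \<rho>_def split: if_splits)
    from card_mono[OF _ this] show "card {v\<in>\<rho> ` X. fst v = 0} \<le> 1" by simp
    have "{v\<in>\<rho> ` X. fst v = 1} \<subseteq> Pair 1 ` E" using code(1) by (auto simp: \<rho>_def split: if_splits)
    from card_mono[OF _ this] show "card {v\<in>\<rho> ` X. fst v = 1} \<le> card E"
      using E(1) card_image_le[of E "Pair (1::nat)"] by force
    have "{v\<in>\<rho> ` X. fst v = 2} \<subseteq> Pair 2 ` C" using dflt(1) by (auto simp: \<rho>_def split: if_splits)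
    from card_mono[OF _ this] show "card {v\<in>\<rho> ` X. fst v = 2} \<le> card C"
      using C(1) card_image_le[of C "Pair (2::nat)"] by force
  qed (use cards in auto)
  moreover have "{x\<in>X. fst (\<rho> x) = 1} = B" "{x\<in>X. fst (\<rho> x) = 2} = D"
    using BX BD by (auto simp: \<rho>_def D_def split: if_splits)
  ultimately have "h \<le> ln 3 + measure \<mu> B * ln (card E) + measure \<mu> D * ln (card C)" by simp
  \<comment> \<open>At most \<open>exp (N * c)\<close> spanning orbits, chosen among with frequency
    about \<open>1 / N\<close>, amount to \<open>c\<close> per step.\<close>
  also have "measure \<mu> B * ln (card E) \<le> (1 / real N + \<kappa>) * (real N * c)"
    using mB N(2) E(3) cards \<kappa> by (intro mult_mono) auto
  also have "measure \<mu> D * ln (card C) \<le> \<kappa> * ln (card C)" using mD cards by (intro mult_right_mono) auto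
  finally have "h \<le> ln 3 + c + \<kappa> * (real N * c + ln (card C))" using N(1) by (simp add: algebra_simps)
  moreover have "\<kappa> * (real N * c + ln (card C)) \<le> 1" using den by (simp add: \<kappa>_def field_simps)
  ultimately have "h \<le> c + ln 3 + 1" by simp
  then show ?thesis using P by (meson order_trans)
qed

section \<open>Existence of marker sets\<close>

lemma compact_sets: "compact A \<Longrightarrow> A \<subseteq> X \<Longrightarrow> A \<in> sets BX"
  unfolding sets_restrict_space by (intro image_eqI[of _ _ A] borel_compact) auto

text \<open>From two-sided visits to visits in the past: the points with a past visit form a set
  \<open>W\<close> whose translates \<open>Z j\<close> increase, all have the mass of
  \<open>W\<close>, and exhaust the points with any visit. Hence \<open>W\<close> has full measure,
  and finitely many past times nearly exhaust it.\<close>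

lemma sweep_imp_markers:
  assumes \<mu>: "\<mu> \<in> ergodic_measures X phi" and A: "A \<in> sets BX"
    and full: "measure \<mu> {x\<in>X. \<exists>n::int. phi x (real_of_int n) \<in> A} = 1" and \<kappa>: "0 < \<kappa>"
  shows "\<exists>m. 1 - \<kappa> \<le> measure \<mu> (\<Union>k<m. {x\<in>X. phi x (- real k) \<in> A})"
proof -
  interpret prob_space \<mu> by (rule ergodic_measuresD(1)[OF \<mu>])
  note sp = ergodic_measuresD(3)[OF \<mu>] and st = ergodic_measuresD(2)[OF \<mu>]
  define V where "V k = {x\<in>X. phi x (- real k) \<in> A}" for k :: nat
  have Vs: "V k \<in> sets BX" for k unfolding V_def by (rule preimage_sets[OF A])
  define W where "W = (\<Union>k. V k)"
  have Ws: "W \<in> sets BX" unfolding W_def using Vs by auto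
  define Z where "Z j = {x\<in>X. phi x (real j) \<in> W}" for j :: nat
  have Zs: "Z j \<in> sets BX" for j unfolding Z_def by (rule preimage_sets[OF Ws])
  have Zm: "measure \<mu> (Z j) = measure \<mu> W" for j unfolding Z_def by (rule ergodic_measuresD(4)[OF \<mu> Ws])
  have Zmem: "x \<in> Z j \<longleftrightarrow> (\<exists>k. phi x (real j - real k) \<in> A)" if "x \<in> X" for x j
    using that by (simp add: Z_def W_def V_def phi_phi phi_in)
  have "incseq Z"
  proof (rule incseq_SucI, rule subsetI)
    fix j x assume x: "x \<in> Z j"
    then have xX: "x \<in> X" by (simp add: Z_def)
    then obtain k where "phi x (real j - real k) \<in> A" using x Zmem by blast
    then have "phi x (real (Suc j) - real (Suc k)) \<in> A" by simp
    then show "x \<in> Z (Suc j)" using Zmem[OF xX] by blast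
  qed
  then have "(\<lambda>j. measure \<mu> (Z j)) \<longlonglongrightarrow> measure \<mu> (\<Union>j. Z j)"
    using Zs st by (intro finite_Lim_measure_incseq) auto
  moreover have "(\<Union>j. Z j) = {x\<in>X. \<exists>n::int. phi x (real_of_int n) \<in> A}"
  proof (intro set_eqI iffI)
    fix x assume "x \<in> (\<Union>j. Z j)"
    then obtain j where j: "x \<in> Z j" by blast
    then have xX: "x \<in> X" by (simp add: Z_def)
    then obtain k where "phi x (real j - real k) \<in> A" using j Zmem by blast
    then have "phi x (real_of_int (int j - int k)) \<in> A" by simp
    then show "x \<in> {x\<in>X. \<exists>n::int. phi x (real_of_int n) \<in> A}" using xX by blast
  next
    fix x assume "x \<in> {x\<in>X. \<exists>n::int. phi x (real_of_int n) \<in> A}"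
    then obtain n :: int where n: "x \<in> X" "phi x (real_of_int n) \<in> A" by blast
    have "real_of_int n = real (nat n) - real (nat (- n))" by (cases "0 \<le> n") auto
    then have "x \<in> Z (nat n)" using n Zmem[OF n(1), of "nat n"] by metis
    then show "x \<in> (\<Union>j. Z j)" by blast
  qed
  ultimately have "(\<lambda>j::nat. measure \<mu> W) \<longlonglongrightarrow> 1" using full Zm by simp
  then have W1: "measure \<mu> W = 1" by (simp add: LIMSEQ_const_iff)
  define Y where "Y m = (\<Union>k<m. V k)" for m
  have "(\<lambda>m. measure \<mu> (Y m)) \<longlonglongrightarrow> measure \<mu> (\<Union>m. Y m)"
  proof (rule finite_Lim_measure_incseq)
    show "range Y \<subseteq> sets \<mu>" using Vs st by (auto simp: Y_def intro!: sets.finite_UN)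
    show "incseq Y" unfolding Y_def by (intro incseq_SucI UN_mono) auto
  qed
  moreover have "(\<Union>m. Y m) = W" by (auto simp: Y_def W_def)
  ultimately have "\<forall>\<^sub>F m in sequentially. 1 - \<kappa> < measure \<mu> (Y m)" using W1 \<kappa> by (intro order_tendstoD(1)[of _ 1]) auto
  then obtain m where "1 - \<kappa> < measure \<mu> (Y m)" by (auto simp: eventually_sequentially)
  then show ?thesis unfolding Y_def V_def by (intro exI[of _ m]) simp
qed

lemma support_point:
  assumes \<mu>: "\<mu> \<in> ergodic_measures X phi"
  shows "\<exists>x0\<in>X. \<forall>r>0. 0 < measure \<mu> (X \<inter> ball x0 r)"
proof (rule ccontr)
  interpret prob_space \<mu> by (rule ergodic_measuresD(1)[OF \<mu>])
  note sp = ergodic_measuresD(3)[OF \<mu>] and st = ergodic_measuresD(2)[OF \<mu>]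
  assume "\<not> ?thesis"
  then have "\<forall>x\<in>X. \<exists>r>0. measure \<mu> (X \<inter> ball x r) = 0"
    using measure_nonneg[of \<mu>] by (meson antisym not_less)
  then obtain r where r: "\<And>x. x \<in> X \<Longrightarrow> 0 < r x" "\<And>x. x \<in> X \<Longrightarrow> measure \<mu> (X \<inter> ball x (r x)) = 0" by metis
  have "X \<subseteq> (\<Union>x\<in>X. ball x (r x))" using r(1) by force
  then obtain E where E: "E \<subseteq> X" "finite E" "X \<subseteq> (\<Union>x\<in>E. ball x (r x))"
    using compactE_image[OF compact_X, of X "\<lambda>x. ball x (r x)"] by (metis open_ball)
  have bs: "X \<inter> ball x s \<in> sets \<mu>" for x s using openin_sets[of "X \<inter> ball x s"] st by auto
  have "measure \<mu> X \<le> measure \<mu> (\<Union>x\<in>E. X \<inter> ball x (r x))"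
    using E bs by (intro finite_measure_mono sets.finite_UN) auto
  also have "\<dots> \<le> (\<Sum>x\<in>E. measure \<mu> (X \<inter> ball x (r x)))"
    using E bs by (intro finite_measure_subadditive_finite) auto
  also have "\<dots> = 0" using r(2) E(1) by (intro sum.neutral) auto
  finally show False using prob_space sp by simp
qed

lemma decreasing_small:
  assumes \<mu>: "\<mu> \<in> ergodic_measures X phi" and A: "\<And>i. A i \<in> sets BX" "decseq A"
    and z: "measure \<mu> (\<Inter>i. A i) = 0" and \<kappa>: "0 < \<kappa>"
  shows "\<exists>i::nat. measure \<mu> (A i) \<le> \<kappa>"
proof -
  interpret prob_space \<mu> by (rule ergodic_measuresD(1)[OF \<mu>])
  have "(\<lambda>i. measure \<mu> (A i)) \<longlonglongrightarrow> measure \<mu> (\<Inter>i. A i)"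
    using A ergodic_measuresD(2)[OF \<mu>] by (intro finite_Lim_measure_decseq) auto
  then have "\<forall>\<^sub>F i in sequentially. measure \<mu> (A i) < \<kappa>" using z \<kappa> by (intro order_tendstoD(2)) auto
  then obtain i where "measure \<mu> (A i) < \<kappa>" by (auto simp: eventually_sequentially)
  then show ?thesis by (intro exI[of _ i]) simp
qed

text \<open>Infinitely many disjoint translates of equal mass do not fit into a probability
  space.\<close>

lemma disjoint_translates_null:
  assumes \<mu>: "\<mu> \<in> ergodic_measures X phi" and A: "A \<in> sets BX"
    and disj: "\<And>i j. i < j \<Longrightarrow> {x\<in>X. phi x (- (real i * s)) \<in> A} \<inter> {x\<in>X. phi x (- (real j * s)) \<in> A} = {}"
  shows "measure \<mu> A = 0"
proof (rule ccontr)
  interpret prob_space \<mu> by (rule ergodic_measuresD(1)[OF \<mu>])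
  assume "measure \<mu> A \<noteq> 0"
  then have pos: "0 < measure \<mu> A" by (simp add: less_le)
  obtain n :: nat where n: "1 < real n * measure \<mu> A" using reals_Archimedean3[OF pos] by blast
  define S where "S j = {x\<in>X. phi x (- (real j * s)) \<in> A}" for j :: nat
  have Ss: "S j \<in> sets \<mu>" for j unfolding S_def using preimage_sets[OF A] ergodic_measuresD(2)[OF \<mu>] by simp
  have "real n * measure \<mu> A = (\<Sum>j<n. measure \<mu> (S j))"
    unfolding S_def using ergodic_measuresD(4)[OF \<mu> A] by simp
  also have "\<dots> = measure \<mu> (\<Union>j<n. S j)"
  proof (rule finite_measure_finite_Union[symmetric])
    show "disjoint_family_on S {..<n}"
      unfolding disjoint_family_on_def
    proof (intro ballI impI)
      fix i j :: nat assume "i \<noteq> j"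
      then show "S i \<inter> S j = {}" using disj[of i j] disj[of j i] unfolding S_def by (cases "i < j") auto
    qed
  qed (use Ss in auto)
  also have "\<dots> \<le> 1" by (rule prob_le_1)
  finally show False using n by simp
qed

text \<open>Since the time-one map need not be ergodic, a small set need not sweep out everything;
  the flow direction has to be used. The test object is the unit arc of the orbit of a support point
  \<open>x0\<close>. If it is null, thin tubes around it are markers. If not, the measure lives on
  the orbit of \<open>x0\<close>, which must be closed, and the time-one map acts there as a
  rotation: a rational one gives the periodic alternative, an irrational one admits short arcs as
  markers.\<close>

lemma markers_or_periodic:
  assumes \<mu>: "\<mu> \<in> ergodic_measures X phi"
  shows "(\<forall>\<kappa>>0. \<exists>A\<in>sets BX. measure \<mu> A \<le> \<kappa> \<and> (\<exists>m. 1 - \<kappa> \<le> measure \<mu> (\<Union>k<m. {x\<in>X. phi x (- real k) \<in> A}))) \<or>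
     (\<exists>Y\<in>sets BX. \<exists>q>0. measure \<mu> Y = 1 \<and> (\<forall>x\<in>Y. phi x (real q) = x))"
proof -
  interpret prob_space \<mu> by (rule ergodic_measuresD(1)[OF \<mu>])
  note sp = ergodic_measuresD(3)[OF \<mu>] and st = ergodic_measuresD(2)[OF \<mu>]
  obtain x0 where x0: "x0 \<in> X" "\<And>r. 0 < r \<Longrightarrow> 0 < measure \<mu> (X \<inter> ball x0 r)" using support_point[OF \<mu>] by blast
  have arc: "compact (phi x0 ` {a..b})" "phi x0 ` {a..b} \<subseteq> X" for a b
    using x0(1) by (auto intro!: compact_continuous_image continuous_phi_time phi_in)
  have arcs: "phi x0 ` {a..b} \<in> sets BX" for a b by (rule compact_sets[OF arc])
  define Seg where "Seg = phi x0 ` {0..1}"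
  show ?thesis
  proof (cases "measure \<mu> Seg = 0")
    case True
    have "\<exists>A\<in>sets BX. measure \<mu> A \<le> \<kappa> \<and> (\<exists>m. 1 - \<kappa> \<le> measure \<mu> (\<Union>k<m. {x\<in>X. phi x (- real k) \<in> A}))" if \<kappa>: "0 < \<kappa>" for \<kappa>
    proof -
      \<comment> \<open>The ball is thickened by one unit of flow time, so integer times meet
        \<open>A i\<close> exactly when the flow orbit meets the ball. The sweep is thus
        flow-invariant and ergodicity applies. The sets decrease to a subset of the null
        arc.\<close>
      define A where "A i = (\<lambda>(x, t). phi x t) ` ((X \<inter> cball x0 (1 / real (Suc i))) \<times> {0..1})" for i
      have AX: "A i \<subseteq> X" for i using phi_in by (auto simp: A_def)
      have As: "A i \<in> sets BX" for i
      proof (rule compact_sets[OF _ AX])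
        show "compact (A i)" unfolding A_def
          by (intro compact_continuous_image continuous_on_subset[OF continuous_on_flow] compact_Times
              compact_Int_closed compact_X) auto
      qed
      have Amem: "z \<in> A i \<longleftrightarrow> (\<exists>s\<in>{0..1}. dist x0 (phi z (- s)) \<le> 1 / real (Suc i))" if z: "z \<in> X" for z i
      proof
        assume "z \<in> A i"
        then obtain x s where "x \<in> X" "dist x0 x \<le> 1 / real (Suc i)" "s \<in> {0..1}" "z = phi x s" by (auto simp: A_def)
        then show "\<exists>s\<in>{0..1}. dist x0 (phi z (- s)) \<le> 1 / real (Suc i)" by (intro bexI[of _ s]) (auto simp: phi_phi)
      next
        assume "\<exists>s\<in>{0..1}. dist x0 (phi z (- s)) \<le> 1 / real (Suc i)"
        then obtain s where "s \<in> {0..1}" "dist x0 (phi z (- s)) \<le> 1 / real (Suc i)" by blast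
        then show "z \<in> A i" unfolding A_def using z by (intro image_eqI[of _ _ "(phi z (- s), s)"]) (auto simp: phi_phi phi_in)
      qed
      have dec: "decseq A"
      proof (rule decseq_SucI, rule subsetI)
        fix i z assume z: "z \<in> A (Suc i)"
        have "1 / real (Suc (Suc i)) \<le> 1 / real (Suc i)" by (simp add: frac_le)
        then show "z \<in> A i" using z AX Amem by (meson order_trans subsetD)
      qed
      have "(\<Inter>i. A i) \<subseteq> Seg"
      proof
        fix z assume z: "z \<in> (\<Inter>i. A i)"
        then have zX: "z \<in> X" using AX by blast
        have "continuous_on {0..1} (\<lambda>s. dist x0 (phi z (- s)))"
          by (intro continuous_intros continuous_on_compose2[OF continuous_phi_time[OF zX, of UNIV]]) auto
        then obtain s where s: "s \<in> {0..1}" "\<And>s'. s' \<in> {0..1} \<Longrightarrow> dist x0 (phi z (- s)) \<le> dist x0 (phi z (- s'))"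
          using continuous_attains_inf[of "{0..1::real}" "\<lambda>s. dist x0 (phi z (- s))"] by auto
        have "dist x0 (phi z (- s)) \<le> 1 / real (Suc i)" for i
          using z Amem[OF zX, of i] s(2) order_trans by blast
        then have "\<not> 0 < dist x0 (phi z (- s))" by (metis nat_approx_posE not_le)
        then have "x0 = phi z (- s)" by simp
        then have "z = phi x0 s" using zX by (simp add: phi_phi)
        then show "z \<in> Seg" using s(1) by (simp add: Seg_def)
      qed
      then have "measure \<mu> (\<Inter>i. A i) \<le> measure \<mu> Seg"
        using arcs st by (intro finite_measure_mono) (auto simp: Seg_def)
      then have "measure \<mu> (\<Inter>i. A i) = 0" using True measure_nonneg[of \<mu> "\<Inter>i. A i"] by linarith
      then obtain i where i: "measure \<mu> (A i) \<le> \<kappa>" using decreasing_small[OF \<mu> As dec _ \<kappa>] by blast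
      define Z where "Z = {x\<in>X. \<exists>n::int. phi x (real_of_int n) \<in> A i}"
      have Zmem: "x \<in> Z \<longleftrightarrow> (\<exists>t. dist x0 (phi x t) \<le> 1 / real (Suc i))" if x: "x \<in> X" for x
      proof
        assume "x \<in> Z"
        then obtain n :: int where "phi x (real_of_int n) \<in> A i" by (auto simp: Z_def)
        then obtain s where "dist x0 (phi (phi x (real_of_int n)) (- s)) \<le> 1 / real (Suc i)"
          using Amem[OF phi_in[OF x]] by blast
        then show "\<exists>t. dist x0 (phi x t) \<le> 1 / real (Suc i)" using x by (auto simp: phi_phi)
      next
        assume "\<exists>t. dist x0 (phi x t) \<le> 1 / real (Suc i)"
        then obtain t where t: "dist x0 (phi x t) \<le> 1 / real (Suc i)" by blast
        have "real_of_int \<lceil>t\<rceil> - t \<in> {0..1}" by simp linarith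
        moreover have "dist x0 (phi (phi x (real_of_int \<lceil>t\<rceil>)) (- (real_of_int \<lceil>t\<rceil> - t))) \<le> 1 / real (Suc i)"
          using t x by (simp add: phi_phi)
        ultimately have "phi x (real_of_int \<lceil>t\<rceil>) \<in> A i" using Amem[OF phi_in[OF x]] by blast
        then show "x \<in> Z" using x by (auto simp: Z_def)
      qed
      have Zs: "Z \<in> sets BX"
      proof -
        have "Z = (\<Union>n::int. {x\<in>X. phi x (real_of_int n) \<in> A i})" by (auto simp: Z_def)
        then show ?thesis using preimage_sets[OF As] by (auto intro!: sets.countable_UN)
      qed
      have "measure \<mu> Z = 0 \<or> measure \<mu> Z = 1"
      proof (rule ergodic_measuresD(5)[OF \<mu> Zs])
        fix t
        have "phi x t \<in> Z \<longleftrightarrow> x \<in> Z" if x: "x \<in> X" for x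
        proof -
          have "(\<exists>s. dist x0 (phi x (s + t)) \<le> 1 / real (Suc i)) \<longleftrightarrow> (\<exists>s. dist x0 (phi x s) \<le> 1 / real (Suc i))"
            by (metis diff_add_cancel)
          then show ?thesis using Zmem[OF x] Zmem[OF phi_in[OF x]] x by (simp add: phi_phi)
        qed
        then show "{x\<in>X. phi x t \<in> Z} = Z" by (auto simp: Z_def)
      qed
      moreover have "0 < measure \<mu> Z"
      proof -
        have "X \<inter> ball x0 (1 / real (Suc i)) \<subseteq> Z"
        proof
          fix x assume x: "x \<in> X \<inter> ball x0 (1 / real (Suc i))"
          then have "dist x0 (phi x 0) \<le> 1 / real (Suc i)" by simp
          then show "x \<in> Z" using x Zmem by blast
        qed
        then have "measure \<mu> (X \<inter> ball x0 (1 / real (Suc i))) \<le> measure \<mu> Z" using Zs st by (intro finite_measure_mono) auto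
        then show ?thesis using x0(2)[of "1 / real (Suc i)"] by simp
      qed
      ultimately have "measure \<mu> Z = 1" by simp
      then show ?thesis using sweep_imp_markers[OF \<mu> As[of i] _ \<kappa>] As[of i] i unfolding Z_def by blast
    qed
    then show ?thesis by blast
  next
    case False
    define Orb where "Orb = range (phi x0)"
    have OrbX: "Orb \<subseteq> X" using x0(1) phi_in by (auto simp: Orb_def)
    have Os: "Orb \<in> sets BX"
    proof -
      have "Orb = (\<Union>n::nat. phi x0 ` {- real n..real n})"
      proof
        show "Orb \<subseteq> (\<Union>n::nat. phi x0 ` {- real n..real n})"
        proof
          fix z assume "z \<in> Orb"
          then obtain t where t: "z = phi x0 t" by (auto simp: Orb_def)
          obtain n :: nat where "\<bar>t\<bar> < real n" using reals_Archimedean2 by blast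
          then have "t \<in> {- real n..real n}" by auto
          then show "z \<in> (\<Union>n::nat. phi x0 ` {- real n..real n})" using t by blast
        qed
      qed (auto simp: Orb_def)
      then show ?thesis using arcs by (auto intro!: sets.countable_UN)
    qed
    have "measure \<mu> Orb = 0 \<or> measure \<mu> Orb = 1"
    proof (rule ergodic_measuresD(5)[OF \<mu> Os])
      fix t
      show "{x\<in>X. phi x t \<in> Orb} = Orb"
      proof (intro set_eqI iffI)
        fix x assume "x \<in> {x\<in>X. phi x t \<in> Orb}"
        then obtain s where x: "x \<in> X" "phi x t = phi x0 s" by (auto simp: Orb_def)
        have "x = phi (phi x t) (- t)" using x(1) by (simp add: phi_phi)
        then have "x = phi x0 (- t + s)" unfolding x(2) using x0(1) by (simp add: phi_phi)
        then show "x \<in> Orb" by (auto simp: Orb_def)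
      next
        fix x assume "x \<in> Orb"
        then show "x \<in> {x\<in>X. phi x t \<in> Orb}" using x0(1) OrbX by (auto simp: Orb_def phi_phi phi_in)
      qed
    qed
    moreover have "measure \<mu> Seg \<le> measure \<mu> Orb"
      using Os st by (intro finite_measure_mono) (auto simp: Seg_def Orb_def)
    ultimately have O1: "measure \<mu> Orb = 1" using False measure_nonneg[of \<mu> Seg] by linarith
    have "\<exists>p>0. phi x0 p = x0"
    proof (rule ccontr)
      assume no: "\<not> (\<exists>p>0. phi x0 p = x0)"
      \<comment> \<open>Without a return time, unit arcs moved by distinct multiples of 2 are
        disjoint: an overlap would give a return time of at least 1. Step 1 would let end points
        meet.\<close>
      have "measure \<mu> Seg = 0"
      proof (rule disjoint_translates_null[OF \<mu>, where s=2])
        show "Seg \<in> sets BX" unfolding Seg_def by (rule arcs)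
        fix i j :: nat assume ij: "i < j"
        show "{x\<in>X. phi x (- (real i * 2)) \<in> Seg} \<inter> {x\<in>X. phi x (- (real j * 2)) \<in> Seg} = {}"
        proof (rule ccontr)
          assume "\<not> ?thesis"
          then obtain x where x: "x \<in> X" "phi x (- (real i * 2)) \<in> Seg" "phi x (- (real j * 2)) \<in> Seg" by blast
          obtain a where a: "a \<in> {0..1}" "phi x (- (real i * 2)) = phi x0 a" using x(2) unfolding Seg_def by blast
          obtain b where b: "b \<in> {0..1}" "phi x (- (real j * 2)) = phi x0 b" using x(3) unfolding Seg_def by blast
          note ab = a(1) b(1) and eq = a(2) b(2)
          have "phi (phi x (- (real i * 2))) (real i * 2) = phi (phi x (- (real j * 2))) (real j * 2)" using x by (simp add: phi_phi)
          then have "phi x0 (real i * 2 + a) = phi x0 (real j * 2 + b)" using eq x0(1) by (simp add: phi_phi)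
          then have "phi (phi x0 (real i * 2 + a)) (- (real i * 2 + a)) = phi (phi x0 (real j * 2 + b)) (- (real i * 2 + a))" by simp
          then have "x0 = phi x0 (- (real i * 2 + a) + (real j * 2 + b))" using x0(1) by (simp add: phi_phi)
          moreover have "real i + 1 \<le> real j" using ij by simp
          then have "0 < - (real i * 2 + a) + (real j * 2 + b)" using ab by simp
          ultimately show False using no by metis
        qed
      qed
      then show False using False by simp
    qed
    then obtain p where p: "0 < p" "phi x0 p = x0" by blast
    \<comment> \<open>The group of return times of \<open>x0\<close>; the position on the orbit
      depends on time modulo \<open>G\<close> only.\<close>
    define G where "G = {t. phi x0 t = x0}"
    have Gadd: "s + t \<in> G" if "s \<in> G" "t \<in> G" for s t
    proof -
      have "phi (phi x0 t) s = x0" using that by (simp add: G_def)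
      then show ?thesis using x0(1) by (simp add: G_def phi_phi)
    qed
    have Gneg: "- t \<in> G" if "t \<in> G" for t
    proof -
      have "phi (phi x0 t) (- t) = phi x0 (- t)" using that by (simp add: G_def)
      then show ?thesis using x0(1) by (simp add: G_def phi_phi)
    qed
    have Gnat: "real n * t \<in> G" if "t \<in> G" for n t
    proof (induction n)
      case 0
      then show ?case using x0(1) by (simp add: G_def)
    next
      case (Suc n)
      then show ?case using Gadd[OF that Suc] by (simp add: algebra_simps)
    qed
    have Gint: "real_of_int n * t \<in> G" if "t \<in> G" for n t
    proof (cases "0 \<le> n")
      case True
      then show ?thesis using Gnat[OF that, of "nat n"] by simp
    next
      case False
      then show ?thesis using Gneg[OF Gnat[OF that, of "nat (- n)"]] by simp
    qed
    have Geq: "phi x0 s = phi x0 t" if "s - t \<in> G" for s t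
    proof -
      have "phi (phi x0 (s - t)) t = phi x0 t" using that by (simp add: G_def)
      then show ?thesis using x0(1) by (simp add: phi_phi)
    qed
    show ?thesis
    proof (cases "\<exists>q>0. phi x0 (real q) = x0")
      case True
      then obtain q where q: "0 < q" "phi x0 (real q) = x0" by blast
      have "phi x (real q) = x" if x: "x \<in> Orb" for x
      proof -
        obtain t where t: "x = phi x0 t" using x by (auto simp: Orb_def)
        have "phi x (real q) = phi (phi x0 (real q)) t" using t x0(1) by (simp add: phi_phi add.commute)
        then show ?thesis using q t by simp
      qed
      then show ?thesis using Os O1 q(1) by blast
    next
      case noq: False
      have single: "measure \<mu> {x0} = 0"
      proof (rule disjoint_translates_null[OF \<mu>, where s=1])
        show "{x0} \<in> sets BX" using x0(1) by (intro compact_sets) auto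
        fix i j :: nat assume ij: "i < j"
        show "{x\<in>X. phi x (- (real i * 1)) \<in> {x0}} \<inter> {x\<in>X. phi x (- (real j * 1)) \<in> {x0}} = {}"
        proof (rule ccontr)
          assume "\<not> ?thesis"
          then obtain x where x: "x \<in> X" "phi x (- real i) = x0" "phi x (- real j) = x0" by auto
          have "phi x0 (real (j - i)) = phi (phi x (- real j)) (real (j - i))" using x(3) by simp
          also have "\<dots> = phi x (- real i)" using x(1) ij by (simp add: phi_phi)
          finally show False using noq x(2) ij by (metis zero_less_diff)
        qed
      qed
      have "\<exists>A\<in>sets BX. measure \<mu> A \<le> \<kappa> \<and> (\<exists>m. 1 - \<kappa> \<le> measure \<mu> (\<Union>k<m. {x\<in>X. phi x (- real k) \<in> A}))" if \<kappa>: "0 < \<kappa>" for \<kappa>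
      proof -
        \<comment> \<open>No positive integer is a return time here, so integer translates of
          \<open>x0\<close> are distinct and the point is null. Short arcs starting at
          \<open>x0\<close> shrink to it and become arbitrarily light.\<close>
        define A where "A i = phi x0 ` {0..1 / real (Suc i)}" for i
        have As: "A i \<in> sets BX" for i unfolding A_def by (rule arcs)
        have "decseq A"
        proof (rule decseq_SucI)
          fix i
          have "1 / real (Suc (Suc i)) \<le> 1 / real (Suc i)" by (simp add: frac_le)
          then show "A (Suc i) \<subseteq> A i" unfolding A_def by (intro image_mono) auto
        qed
        moreover have "(\<Inter>i. A i) \<subseteq> {x0}"
        proof
          fix z assume "z \<in> (\<Inter>i. A i)"
          then have "\<forall>i. \<exists>s. 0 \<le> s \<and> s \<le> 1 / real (Suc i) \<and> z = phi x0 s" by (fastforce simp: A_def)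
          then obtain s where s: "\<And>i. 0 \<le> s i" "\<And>i. s i \<le> 1 / real (Suc i)" "\<And>i. z = phi x0 (s i)" by metis
          have "s \<longlonglongrightarrow> 0"
          proof (rule tendsto_sandwich[of "\<lambda>_. 0" _ _ "\<lambda>i. 1 / real (Suc i)"])
            show "(\<lambda>i. 1 / real (Suc i)) \<longlonglongrightarrow> 0" by (rule LIMSEQ_Suc[OF lim_1_over_n])
          qed (use s in auto)
          then have "(\<lambda>i. phi x0 (s i)) \<longlonglongrightarrow> phi x0 0"
            using continuous_on_tendsto_compose[OF continuous_phi_time[OF x0(1), of UNIV]] by simp
          then have "(\<lambda>i::nat. z) \<longlonglongrightarrow> x0" using s(3) x0(1) by simp
          then show "z \<in> {x0}" by (simp add: LIMSEQ_const_iff)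
        qed
        then have "measure \<mu> (\<Inter>i. A i) \<le> measure \<mu> {x0}"
          using x0(1) st compact_sets[of "{x0}"] by (intro finite_measure_mono) auto
        then have "measure \<mu> (\<Inter>i. A i) = 0" using single measure_nonneg[of \<mu> "\<Inter>i. A i"] by linarith
        ultimately obtain i where i: "measure \<mu> (A i) \<le> \<kappa>" using decreasing_small[OF \<mu>, of A] As \<kappa> by blast
        define s where "s = 1 / real (Suc i)"
        have s: "0 < s" by (simp add: s_def)
        \<comment> \<open>\<open>R k\<close> is \<open>k\<close> reduced modulo the return time
          \<open>p\<close>. By the pigeonhole principle two values share a bin of length
          \<open>s\<close>, which gives \<open>q > 0\<close> with \<open>q - u \<in> G\<close> and
          \<open>u\<close> nonzero of modulus below \<open>s\<close>: running for \<open>q\<close>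
          steps moves along the orbit by less than the length of the arc.\<close>
        define R where "R k = real k - p * real_of_int \<lfloor>real k / p\<rfloor>" for k :: nat
        have R: "0 \<le> R k" "R k < p" for k
        proof -
          have "real_of_int \<lfloor>real k / p\<rfloor> \<le> real k / p" "real k / p < real_of_int \<lfloor>real k / p\<rfloor> + 1" by linarith+
          then have "real_of_int \<lfloor>real k / p\<rfloor> * p \<le> real k" "real k < (real_of_int \<lfloor>real k / p\<rfloor> + 1) * p"
            using p(1) by (simp_all only: pos_le_divide_eq pos_divide_less_eq)
          then show "0 \<le> R k" "R k < p" by (simp_all add: R_def algebra_simps)
        qed
        define c where "c k = nat \<lfloor>R k / s\<rfloor>" for k
        have "c k \<le> nat \<lfloor>p / s\<rfloor>" for k
          unfolding c_def using R[of k] s by (intro nat_mono floor_mono divide_right_mono) auto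
        then have "c ` {..Suc (nat \<lfloor>p / s\<rfloor>)} \<subseteq> {..nat \<lfloor>p / s\<rfloor>}" by auto
        from card_mono[OF _ this] have "\<not> inj_on c {..Suc (nat \<lfloor>p / s\<rfloor>)}"
          by (intro notI) (simp add: card_image)
        then obtain a b where ab: "a < b" "c a = c b" unfolding inj_on_def by (metis nat_neq_iff)
        define u where "u = R b - R a"
        have fl: "\<lfloor>R a / s\<rfloor> = \<lfloor>R b / s\<rfloor>" using ab(2) R s by (simp add: c_def eq_nat_nat_iff)
        have "\<bar>R b / s - R a / s\<bar> < 1" using fl by linarith
        then have "\<bar>u / s\<bar> < 1" by (simp add: u_def diff_divide_distrib)
        then have us: "\<bar>u\<bar> < s" using s by (simp add: abs_div field_simps)
        define q where "q = b - a"
        have q: "0 < q" "real q = real b - real a" using ab(1) by (auto simp: q_def)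
        have "real q - u = real_of_int (\<lfloor>real b / p\<rfloor> - \<lfloor>real a / p\<rfloor>) * p"
          by (simp add: q u_def R_def algebra_simps)
        moreover have "p \<in> G" using p(2) by (simp add: G_def)
        ultimately have quG: "real q - u \<in> G" using Gint by metis
        have u0: "u \<noteq> 0"
        proof
          assume "u = 0"
          then have "phi x0 (real q) = x0" using quG by (simp add: G_def)
          then show False using noq q(1) by blast
        qed
        have "\<exists>n::int. phi y (real_of_int n) \<in> A i" if y: "y \<in> Orb" for y
        proof -
          obtain t where t: "y = phi x0 t" using y by (auto simp: Orb_def)
          \<comment> \<open>Steps of size \<open>u\<close> are shorter than the arc and cannot jump
            over it. The direction of rounding follows the sign of \<open>u\<close>.\<close>
          obtain l :: int where l: "0 \<le> t - u * real_of_int l" "t - u * real_of_int l \<le> s"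
          proof (cases "0 < u")
            case True
            define l where "l = \<lfloor>t / u\<rfloor>"
            have "real_of_int l \<le> t / u" "t / u < real_of_int l + 1" unfolding l_def by linarith+
            then have "real_of_int l * u \<le> t" "t < (real_of_int l + 1) * u" using True by (auto simp: field_simps)
            then show thesis using us True by (intro that[of l]) (auto simp: algebra_simps)
          next
            case False
            then have un: "u < 0" using u0 by simp
            define l where "l = \<lceil>t / u\<rceil>"
            have "t / u \<le> real_of_int l" "real_of_int l - 1 < t / u" unfolding l_def by linarith+
            then have "real_of_int l * u \<le> t" "t < (real_of_int l - 1) * u" using un by (auto simp: field_simps)
            then show thesis using us un by (intro that[of l]) (auto simp: algebra_simps)
          qed
          have "phi y (real_of_int (- (int q * l))) = phi x0 (t - real q * real_of_int l)"
            using t x0(1) by (simp add: phi_phi)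
          also have "\<dots> = phi x0 (t - u * real_of_int l)"
          proof (rule Geq)
            have "t - real q * real_of_int l - (t - u * real_of_int l) = real_of_int (- l) * (real q - u)" by (simp add: algebra_simps)
            then show "t - real q * real_of_int l - (t - u * real_of_int l) \<in> G" using Gint[OF quG] by metis
          qed
          finally have "phi y (real_of_int (- (int q * l))) \<in> A i" unfolding A_def using l by (auto simp: s_def)
          then show ?thesis by blast
        qed
        then have sub: "Orb \<subseteq> {x\<in>X. \<exists>n::int. phi x (real_of_int n) \<in> A i}" using OrbX by auto
        have "{x\<in>X. \<exists>n::int. phi x (real_of_int n) \<in> A i} = (\<Union>n::int. {x\<in>X. phi x (real_of_int n) \<in> A i})" by auto
        then have "{x\<in>X. \<exists>n::int. phi x (real_of_int n) \<in> A i} \<in> sets \<mu>"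
          using preimage_sets[OF As] st by (auto intro!: sets.countable_UN)
        from finite_measure_mono[OF sub this] have "measure \<mu> {x\<in>X. \<exists>n::int. phi x (real_of_int n) \<in> A i} = 1"
          using O1 prob_le_1[of "{x\<in>X. \<exists>n::int. phi x (real_of_int n) \<in> A i}"] by linarith
        then show ?thesis using sweep_imp_markers[OF \<mu> As[of i] _ \<kappa>] As[of i] i by blast
      qed
      then show ?thesis by blast
    qed
  qed
qed

text \<open>On \<open>Y\<close> an itinerary of any length repeats its first \<open>q\<close>
  symbols, so the number of itineraries of positive mass stays bounded and the entropy vanishes for
  every labelling; one with small fibres is chosen.\<close>

lemma entropy_if_periodic:
  assumes \<mu>: "\<mu> \<in> ergodic_measures X phi" and e: "0 < \<epsilon>"
    and Y: "Y \<in> sets BX" "measure \<mu> Y = 1" "0 < q" "\<And>x. x \<in> Y \<Longrightarrow> phi x (real q) = x"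
  shows "\<exists>P. borel_partition X P \<and> (\<forall>A\<in>P. diameter A \<le> \<epsilon>) \<and> ent_part \<mu> X phi P \<le> 0"
proof -
  interpret prob_space \<mu> by (rule ergodic_measuresD(1)[OF \<mu>])
  note sp = ergodic_measuresD(3)[OF \<mu>] and st = ergodic_measuresD(2)[OF \<mu>]
  have e2: "0 < \<epsilon> / 2" using e by simp
  obtain C where C: "finite C" "C \<subseteq> X" "X = (\<Union>y\<in>C. bowen_ball X phi 1 y (\<epsilon> / 2))"
    using finite_bowen_cover[OF e2, of 1] by metis
  have "\<exists>sel. (\<forall>x\<in>(\<Union>y\<in>C. bowen_ball X phi 1 y (\<epsilon> / 2)). sel x \<in> C \<and> x \<in> bowen_ball X phi 1 (sel x) (\<epsilon> / 2)) \<and> (\<forall>y. {x\<in>X. sel x = y} \<in> sets BX)"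
    using C(2) by (intro measurable_selection[OF C(1)] bowen_ball_sets) auto
  then obtain f where f: "\<And>x. x \<in> X \<Longrightarrow> f x \<in> C \<and> x \<in> bowen_ball X phi 1 (f x) (\<epsilon> / 2)"
    "\<And>y. {x\<in>X. f x = y} \<in> sets BX" unfolding C(3)[symmetric] by blast
  have fs: "simple_function \<mu> f"
    using f C(1) by (intro simple_function_from_fibres[OF \<mu>]) (auto intro: finite_subset[of "f ` X" C])
  have near: "dist (f x) x < \<epsilon> / 2" if "x \<in> X" for x
    using f(1)[OF that] C(2) that by (auto simp: bowen_ball_def)
  have close: "dist x y \<le> \<epsilon>" if "x \<in> X" "y \<in> X" "f x = f y" for x y
    using near[OF that(1)] near[OF that(2)] that(3) dist_triangle3[of x y "f x"] by simp
  have YX: "Y \<subseteq> X" using sets.sets_into_space[OF Y(1)] by simp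
  let ?I = "itinerary f q ` X"
  have "label_entropy \<mu> (itinerary f n) \<le> ln (card ?I)" for n
  proof -
    interpret I: information_space \<mu> "exp 1" by (rule information_space_exp)
    note s = simple_function_itinerary[OF \<mu> fs, of n]
    let ?p = "\<lambda>l. measure \<mu> (itinerary f n -` {l} \<inter> space \<mu>)"
    have "itinerary f n ` space \<mu> \<inter> {l. ?p l \<noteq> 0} \<subseteq> (\<lambda>l. map (\<lambda>j. l ! (j mod q)) [0..<n]) ` ?I"
    proof
      fix l assume l: "l \<in> itinerary f n ` space \<mu> \<inter> {l. ?p l \<noteq> 0}"
      have "itinerary f n -` {l} \<inter> space \<mu> \<inter> Y \<noteq> {}"
      proof
        assume emp: "itinerary f n -` {l} \<inter> space \<mu> \<inter> Y = {}"
        have "measure \<mu> (itinerary f n -` {l} \<inter> space \<mu>) \<le> measure \<mu> (space \<mu> - Y)"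
          using emp Y(1) st by (intro finite_measure_mono) auto
        also have "\<dots> = 0" using prob_compl[of Y] Y st by simp
        finally show False using l by (simp add: measure_le_0_iff)
      qed
      then obtain x where x: "x \<in> Y" "itinerary f n x = l" by auto
      have xX: "x \<in> X" using x YX by auto
      have per: "phi x (real (j + k * q)) = phi x (real j)" for j k
      proof (induction k)
        case (Suc k)
        have "phi x (real (j + Suc k * q)) = phi (phi x (real q)) (real (j + k * q))"
          using xX by (simp add: phi_phi algebra_simps)
        then show ?case using Suc Y(4)[OF x(1)] by simp
      qed simp
      have "l = map (\<lambda>j. itinerary f q x ! (j mod q)) [0..<n]"
      proof (rule nth_equalityI)
        show "length l = length (map (\<lambda>j. itinerary f q x ! (j mod q)) [0..<n])" using x(2) by (auto simp: itinerary_def)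
        fix j assume "j < length l"
        then have j: "j < n" using x(2) by (auto simp: itinerary_def)
        have "phi x (real j) = phi x (real (j mod q))" using per[of "j mod q" "j div q"] by simp
        then show "l ! j = map (\<lambda>j. itinerary f q x ! (j mod q)) [0..<n] ! j"
          using j x(2) Y(3) by (auto simp: itinerary_def)
      qed
      then show "l \<in> (\<lambda>l. map (\<lambda>j. l ! (j mod q)) [0..<n]) ` ?I" using xX by auto
    qed
    moreover have fin: "finite ?I" using simple_functionD(1)[OF simple_function_itinerary[OF \<mu> fs, of q]] sp by simp
    ultimately have "card (itinerary f n ` space \<mu> \<inter> {l. ?p l \<noteq> 0}) \<le> card ?I"
      by (meson card_image_le card_mono finite_imageI order_trans)
    moreover have "label_entropy \<mu> (itinerary f n) \<le> log (exp 1) (card (itinerary f n ` space \<mu> \<inter> {l. ?p l \<noteq> 0}))"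
      using I.entropy_le_card_not_0[OF simple_distributedI[OF s measure_nonneg refl]] label_entropy_eq[OF s] by simp
    moreover have "1 \<le> card ?I" using fin X_nonempty by (simp add: Suc_leI card_gt_0_iff)
    moreover have "log (exp 1) (real k) \<le> ln (real (card ?I))" if "k \<le> card ?I" "1 \<le> card ?I" for k
      using that by (cases "k = 0") (auto simp: log_def)
    ultimately show ?thesis by (meson order_trans)
  qed
  then have "label_entropy \<mu> (itinerary f n) \<le> real n * 0 + ln (card ?I)" for n by simp
  from partition_from_labels[OF \<mu> fs close this] show ?thesis .
qed

lemma ent_part_INF_le:
  assumes \<mu>: "\<mu> \<in> ergodic_measures X phi" and e: "0 < \<epsilon>"
  shows "(INF P\<in>{P. borel_partition X P \<and> (\<forall>A\<in>P. diameter A \<le> \<epsilon>)}. ereal (ent_part \<mu> X phi P))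
           \<le> span_rate X phi (\<epsilon> / 2) + ereal (ln 3 + 1)"
proof -
  have "(INF P\<in>{P. borel_partition X P \<and> (\<forall>A\<in>P. diameter A \<le> \<epsilon>)}. ereal (ent_part \<mu> X phi P)) - ereal (ln 3 + 1)
      \<le> span_rate X phi (\<epsilon> / 2)"
  proof (rule ereal_le_of_real_bounds)
    fix c assume c: "span_rate X phi (\<epsilon> / 2) < ereal c"
    have e2: "0 < \<epsilon> / 2" using e by simp
    have c0: "0 \<le> c" using span_rate_nonneg[OF e2] c by (metis ereal_less_eq(5) less_imp_le order_trans)
    have "\<exists>P. borel_partition X P \<and> (\<forall>A\<in>P. diameter A \<le> \<epsilon>) \<and> ent_part \<mu> X phi P \<le> c + ln 3 + 1"
      using markers_or_periodic[OF \<mu>]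
    proof
      assume "\<forall>\<kappa>>0. \<exists>A\<in>sets BX. measure \<mu> A \<le> \<kappa> \<and> (\<exists>m. 1 - \<kappa> \<le> measure \<mu> (\<Union>k<m. {x\<in>X. phi x (- real k) \<in> A}))"
      then show ?thesis by (intro entropy_from_markers[OF \<mu> e c]) blast
    next
      assume "\<exists>Y\<in>sets BX. \<exists>q>0. measure \<mu> Y = 1 \<and> (\<forall>x\<in>Y. phi x (real q) = x)"
      then obtain P where "borel_partition X P" "\<forall>A\<in>P. diameter A \<le> \<epsilon>" "ent_part \<mu> X phi P \<le> 0"
        using entropy_if_periodic[OF \<mu> e] by metis
      moreover have "(0::real) \<le> c + ln 3 + 1" using c0 by simp
      ultimately show ?thesis by (meson order_trans)
    qed
    then obtain P where P: "borel_partition X P" "\<forall>A\<in>P. diameter A \<le> \<epsilon>" "ent_part \<mu> X phi P \<le> c + ln 3 + 1" by blast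
    then have "(INF P\<in>{P. borel_partition X P \<and> (\<forall>A\<in>P. diameter A \<le> \<epsilon>)}. ereal (ent_part \<mu> X phi P)) \<le> ereal (c + ln 3 + 1)"
      by (intro INF_lower2[of P]) auto
    then show "(INF P\<in>{P. borel_partition X P \<and> (\<forall>A\<in>P. diameter A \<le> \<epsilon>)}. ereal (ent_part \<mu> X phi P)) - ereal (ln 3 + 1) \<le> ereal c"
      by (simp add: ereal_minus_le add.assoc)
  qed
  then show ?thesis by (simp add: ereal_minus_le)
qed

end

section \<open>Metric mean dimension\<close>

lemma scaled_limsup_nonneg:
  assumes "\<And>\<epsilon>. 0 < \<epsilon> \<Longrightarrow> 0 \<le> g \<epsilon>"
  shows "0 \<le> scaled_limsup g"
proof -
  have "eventually (\<lambda>\<epsilon>. 0 \<le> g \<epsilon> / ereal (ln (1 / \<epsilon>))) (at_right 0)"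
    unfolding eventually_at_right_field
  proof (intro exI[of _ 1] conjI allI impI)
    fix \<epsilon> :: real assume \<epsilon>: "0 < \<epsilon>" "\<epsilon> < 1"
    then have "0 < ln (1 / \<epsilon>)" by (intro ln_gt_zero) (simp add: field_simps)
    then show "0 \<le> g \<epsilon> / ereal (ln (1 / \<epsilon>))" using assms[OF \<epsilon>(1)] by (simp add: zero_le_divide_ereal)
  qed simp
  then have "0 \<le> Liminf (at_right 0) (\<lambda>\<epsilon>. g \<epsilon> / ereal (ln (1 / \<epsilon>)))" by (rule Liminf_bounded)
  also have "\<dots> \<le> scaled_limsup g" unfolding scaled_limsup_def by (rule Liminf_le_Limsup) simp
  finally show ?thesis .
qed

text \<open>Rescaling \<open>\<epsilon>\<close> by \<open>c\<close> shifts
  \<open>ln (1 / \<epsilon>)\<close> by a constant, and constants vanish on division by it. Only the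
  factor \<open>k\<close> survives, so all comparisons may lose scale and additive terms
  freely.\<close>

lemma scaled_limsup_le:
  fixes f g :: "real \<Rightarrow> ereal"
  assumes c: "0 < c" and k: "1 \<le> k" and C: "0 \<le> C"
    and g0: "\<And>\<epsilon>. 0 < \<epsilon> \<Longrightarrow> 0 \<le> g \<epsilon>"
    and le: "\<And>\<epsilon>. 0 < \<epsilon> \<Longrightarrow> f (c * \<epsilon>) \<le> ereal k * g \<epsilon> + ereal C"
  shows "scaled_limsup f \<le> ereal k * scaled_limsup g"
proof -
  have Limsup0: "0 \<le> scaled_limsup g" by (rule scaled_limsup_nonneg[OF g0])
  show ?thesis
  proof (cases "scaled_limsup g = \<infinity>")
    case True
    then show ?thesis using k by simp
  next
    case False
    then obtain S where S: "scaled_limsup g = ereal S" "0 \<le> S" using Limsup0 by (cases "scaled_limsup g") auto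
    have "scaled_limsup f \<le> ereal (k * S)"
    proof (rule ereal_le_of_real_bounds)
      fix b assume "ereal (k * S) < ereal b"
      then have b: "k * S < b" by simp
      \<comment> \<open>The gap \<open>b - k * S\<close> is divided into three equal parts
        \<open>k * \<eta>\<close>: one for the upper limit of \<open>g\<close>, one for the
        constants, one left over.\<close>
      define \<eta> where "\<eta> = (b - k * S) / (3 * k)"
      have \<eta>: "0 < \<eta>" using b k by (simp add: \<eta>_def)
      have kb: "k * (S + \<eta>) + 2 * (k * \<eta>) = b" using k by (simp add: \<eta>_def field_simps)
      have "scaled_limsup g < ereal (S + \<eta>)" using S \<eta> by simp
      then have "eventually (\<lambda>\<epsilon>. g \<epsilon> / ereal (ln (1 / \<epsilon>)) < ereal (S + \<eta>)) (at_right 0)"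
        unfolding scaled_limsup_def by (rule Limsup_lessD)
      then obtain e1 where e1: "0 < e1" "\<And>\<epsilon>. 0 < \<epsilon> \<Longrightarrow> \<epsilon> < e1 \<Longrightarrow> g \<epsilon> / ereal (ln (1 / \<epsilon>)) < ereal (S + \<eta>)"
        unfolding eventually_at_right_field by blast
      \<comment> \<open>Once the logarithm exceeds \<open>K0\<close>, the terms from
        \<open>ln c\<close> and \<open>C\<close> are below \<open>k * \<eta>\<close> times the
        logarithm.\<close>
      define K0 where "K0 = (k * (S + \<eta>) * \<bar>ln c\<bar> + C) / (k * \<eta>) + 1"
      have K0: "0 < K0" using k S(2) \<eta> C by (auto simp: K0_def intro!: add_nonneg_pos divide_nonneg_pos add_nonneg_nonneg)
      define e0 where "e0 = min (c * min e1 (1/2)) (exp (- K0))"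
      have e0: "0 < e0" using c e1 by (simp add: e0_def)
      have "eventually (\<lambda>\<epsilon>. f \<epsilon> / ereal (ln (1 / \<epsilon>)) \<le> ereal b) (at_right 0)"
        unfolding eventually_at_right_field
      proof (intro exI[of _ e0] conjI allI impI e0)
        fix y assume y: "0 < y" "y < e0"
        define \<epsilon> where "\<epsilon> = y / c"
        have \<epsilon>: "0 < \<epsilon>" "\<epsilon> < e1" "\<epsilon> < 1 / 2" "y = c * \<epsilon>"
        proof -
          have "y < min e1 (1/2) * c" using y(2) by (simp add: e0_def mult.commute)
          then have "\<epsilon> < min e1 (1/2)" unfolding \<epsilon>_def using c by (simp only: pos_divide_less_eq)
          then show "\<epsilon> < e1" "\<epsilon> < 1 / 2" by simp_all
        qed (use y c in \<open>auto simp: \<epsilon>_def\<close>)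
        define l where "l = ln (1 / \<epsilon>)"
        define l' where "l' = ln (1 / y)"
        have l: "0 < l" unfolding l_def using \<epsilon> by (intro ln_gt_zero) (simp add: field_simps)
        have "ln y \<le> - K0"
        proof -
          have "ln y \<le> ln (exp (- K0))" using y by (intro ln_mono) (auto simp: e0_def)
          then show ?thesis by simp
        qed
        then have l': "K0 \<le> l'" using y by (simp add: l'_def ln_div)
        have ll: "l = l' + ln c" using y c by (simp add: l_def l'_def \<epsilon>_def ln_div)
        have "g \<epsilon> \<le> ereal ((S + \<eta>) * l)"
        proof -
          have "g \<epsilon> / ereal l < ereal (S + \<eta>)" using e1(2)[OF \<epsilon>(1,2)] by (simp add: l_def)
          then show ?thesis using l by (cases "g \<epsilon>") (auto simp: divide_less_eq)
        qed
        then have "ereal k * g \<epsilon> \<le> ereal k * ereal ((S + \<eta>) * l)" using k by (intro ereal_mult_left_mono) auto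
        then have "f y \<le> ereal (k * ((S + \<eta>) * l) + C)"
          using le[OF \<epsilon>(1)] \<epsilon>(4) order_trans[OF _ add_right_mono[of "ereal k * g \<epsilon>" _ "ereal C"]] by fastforce
        moreover have "k * ((S + \<eta>) * l) + C \<le> b * l'"
        proof -
          have "k * ((S + \<eta>) * l) \<le> k * (S + \<eta>) * l' + k * (S + \<eta>) * \<bar>ln c\<bar>"
            unfolding ll using k S(2) \<eta> by (simp add: algebra_simps) (smt (verit) mult_nonneg_nonneg mult_left_mono)
          moreover have "k * (S + \<eta>) * \<bar>ln c\<bar> + C \<le> k * \<eta> * l'"
          proof -
            have "(k * (S + \<eta>) * \<bar>ln c\<bar> + C) / (k * \<eta>) \<le> l'" using l' by (simp add: K0_def)
            then show ?thesis using k \<eta> by (simp add: divide_le_eq mult.commute)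
          qed
          moreover have "b * l' = k * (S + \<eta>) * l' + 2 * (k * \<eta> * l')" by (simp add: algebra_simps flip: kb)
          moreover have "0 \<le> k * \<eta> * l'" using k \<eta> K0 l' by auto
          ultimately show ?thesis by linarith
        qed
        ultimately have "f y \<le> ereal (b * l')" by (meson ereal_less_eq(3) order_trans)
        moreover have "0 < l'" using l' K0 by linarith
        ultimately have "f y / ereal l' \<le> ereal b" by (cases "f y") (auto simp: divide_le_eq)
        then show "f y / ereal (ln (1 / y)) \<le> ereal b" by (simp add: l'_def)
      qed
      then show "scaled_limsup f \<le> ereal b" unfolding scaled_limsup_def by (rule Limsup_bounded)
    qed
    then show ?thesis using S by simp
  qed
qed

lemma ereal_le_of_factors:
  fixes a b :: ereal
  assumes "0 \<le> b" "\<And>d. 0 < d \<Longrightarrow> a \<le> ereal (1 + d) * b"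
  shows "a \<le> b"
proof (cases b)
  case (real r)
  then have r: "0 \<le> r" using assms(1) by simp
  show ?thesis
  proof (rule ereal_le_of_real_bounds)
    fix c assume "b < ereal c"
    then have c: "r < c" using real by simp
    define d where "d = (c - r) / (r + 1)"
    have d: "0 < d" using c r by (simp add: d_def)
    have "(1 + d) * r \<le> c"
    proof -
      have "d * r \<le> d * (r + 1)" using d by simp
      also have "\<dots> = c - r" using r by (simp add: d_def)
      finally show ?thesis by (simp add: algebra_simps)
    qed
    then show "a \<le> ereal c" using assms(2)[OF d] real by (simp add: order_trans[of a "ereal ((1 + d) * r)"])
  qed
qed (use assms in auto)

context lipschitz_flow
begin

section \<open>Assembling the six formulas\<close>

lemma upper_mdim_eq: "upper_mdim X phi = scaled_limsup (span_rate X phi)"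
  by (simp add: upper_mdim_def scaled_limsup_def)

lemma span_rate_le_SUP:
  assumes e: "0 < \<epsilon>" and k: "0 < k"
    and Q: "\<And>\<mu>. \<mu> \<in> ergodic_measures X phi \<Longrightarrow> katok_lower \<mu> X phi (r * \<epsilon>) \<delta> \<le> ereal k * Q \<mu>"
    and r: "0 < r" and \<delta>: "0 < \<delta>" "\<delta> < 1"
  shows "span_rate X phi (8 * L\<^sup>2 * (r * \<epsilon>)) \<le> ereal k * (SUP \<mu>\<in>ergodic_measures X phi. Q \<mu>)"
proof (rule dense_le)
  fix y assume "y < span_rate X phi (8 * L\<^sup>2 * (r * \<epsilon>))"
  then obtain c where c: "y < ereal c" "ereal c < span_rate X phi (8 * L\<^sup>2 * (r * \<epsilon>))" using ereal_dense2 by blast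
  have "0 < r * \<epsilon>" using e r by simp
  from ergodic_measure_katok_ge[OF this c(2)] obtain \<mu> where \<mu>: "\<mu> \<in> ergodic_measures X phi"
    "ereal c \<le> katok_lower \<mu> X phi (r * \<epsilon>) \<delta>" using \<delta> by blast
  have "ereal c \<le> ereal k * Q \<mu>" using \<mu> Q by (meson order_trans)
  also have "\<dots> \<le> ereal k * (SUP \<mu>\<in>ergodic_measures X phi. Q \<mu>)"
    using k \<mu>(1) by (intro ereal_mult_left_mono SUP_upper) auto
  finally show "y \<le> ereal k * (SUP \<mu>\<in>ergodic_measures X phi. Q \<mu>)" using c(1) by simp
qed

text \<open>Existence is a by-product of the lower bound: spanning rates are nonnegative, so the
  construction applies with threshold \<open>- 1\<close>. Nonnegativity of the suprema rests on
  it.\<close>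

lemma ergodic_measures_nonempty: "ergodic_measures X phi \<noteq> {}"
proof -
  have "0 < 8 * L\<^sup>2 * 1" using L_ge_1 by simp
  then have "0 \<le> span_rate X phi (8 * L\<^sup>2 * 1)" by (rule span_rate_nonneg)
  moreover have "ereal (- 1) < 0" by simp
  ultimately have "ereal (- 1) < span_rate X phi (8 * L\<^sup>2 * 1)" by (rule less_le_trans[rotated])
  from ergodic_measure_katok_ge[OF zero_less_one this] show ?thesis by blast
qed

text \<open>The loss of scale disappears in the scaled limit. The factor \<open>1 + d\<close> is the
  price of Markov's inequality; \<open>d = 0\<close> is used for the Katok and Shapira
  entropies.\<close>

lemma mdim_le:
  assumes Q0: "\<And>\<epsilon> \<mu>. 0 < \<epsilon> \<Longrightarrow> \<mu> \<in> ergodic_measures X phi \<Longrightarrow> 0 \<le> Q \<epsilon> \<mu>"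
    and r: "0 < r" and \<delta>: "0 < \<delta>" "\<delta> < 1" and d: "0 \<le> d"
    and Q: "\<And>\<epsilon> \<mu>. 0 < \<epsilon> \<Longrightarrow> \<mu> \<in> ergodic_measures X phi \<Longrightarrow> katok_lower \<mu> X phi (r * \<epsilon>) \<delta> \<le> ereal (1 + d) * Q \<epsilon> \<mu>"
  shows "upper_mdim X phi \<le> ereal (1 + d) * scaled_limsup (\<lambda>\<epsilon>. SUP \<mu>\<in>ergodic_measures X phi. Q \<epsilon> \<mu>)"
  unfolding upper_mdim_eq
proof (rule scaled_limsup_le[where c="8 * L\<^sup>2 * r" and C=0])
  show "0 < 8 * L\<^sup>2 * r" using L_ge_1 r by simp
  fix \<epsilon> :: real assume e: "0 < \<epsilon>"
  obtain \<mu> where \<mu>: "\<mu> \<in> ergodic_measures X phi" using ergodic_measures_nonempty by blast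
  show "0 \<le> (SUP \<mu>\<in>ergodic_measures X phi. Q \<epsilon> \<mu>)" using Q0[OF e \<mu>] \<mu> by (intro SUP_upper2[of \<mu>]) auto
  have "span_rate X phi (8 * L\<^sup>2 * (r * \<epsilon>)) \<le> ereal (1 + d) * (SUP \<mu>\<in>ergodic_measures X phi. Q \<epsilon> \<mu>)"
    using d by (intro span_rate_le_SUP[OF e _ Q[OF e] r \<delta>]) auto
  then show "span_rate X phi (8 * L\<^sup>2 * r * \<epsilon>) \<le> ereal (1 + d) * (SUP \<mu>\<in>ergodic_measures X phi. Q \<epsilon> \<mu>) + ereal 0"
    by (simp add: mult.assoc)
qed (use d in auto)

lemma le_mdim:
  assumes r: "0 < r" and C: "0 \<le> C"
    and Q: "\<And>\<epsilon> \<mu>. 0 < \<epsilon> \<Longrightarrow> \<mu> \<in> ergodic_measures X phi \<Longrightarrow> Q \<epsilon> \<mu> \<le> span_rate X phi (\<epsilon> / r) + ereal C"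
  shows "scaled_limsup (\<lambda>\<epsilon>. SUP \<mu>\<in>ergodic_measures X phi. Q \<epsilon> \<mu>) \<le> upper_mdim X phi"
proof -
  have "scaled_limsup (\<lambda>\<epsilon>. SUP \<mu>\<in>ergodic_measures X phi. Q \<epsilon> \<mu>) \<le> ereal 1 * scaled_limsup (span_rate X phi)"
  proof (rule scaled_limsup_le[OF r _ C])
    fix \<epsilon> :: real assume e: "0 < \<epsilon>"
    show "0 \<le> span_rate X phi \<epsilon>" by (rule span_rate_nonneg[OF e])
    have "Q (r * \<epsilon>) \<mu> \<le> span_rate X phi \<epsilon> + ereal C" if "\<mu> \<in> ergodic_measures X phi" for \<mu>
      using Q[of "r * \<epsilon>" \<mu>] that e r by simp
    then show "(SUP \<mu>\<in>ergodic_measures X phi. Q (r * \<epsilon>) \<mu>) \<le> ereal 1 * span_rate X phi \<epsilon> + ereal C"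
      by (intro SUP_least) simp
  qed simp
  then show ?thesis by (simp add: upper_mdim_eq)
qed

lemma katok_lower_nonneg:
  assumes "\<mu> \<in> ergodic_measures X phi" "0 < \<epsilon>" "0 \<le> \<delta>" "\<delta> < 1"
  shows "0 \<le> katok_lower \<mu> X phi \<epsilon> \<delta>"
  unfolding katok_lower_def
proof (intro Liminf_bounded always_eventually allI)
  fix n
  show "0 \<le> ereal (ln (real (katok_R \<mu> X phi n \<epsilon> \<delta>)) / real n)"
    using katok_R_pos[OF assms, of n] by simp
qed

lemma katok_lower_le_upper: "katok_lower \<mu> X phi \<epsilon> \<delta> \<le> katok_upper \<mu> X phi \<epsilon> \<delta>"
  unfolding katok_lower_def katok_upper_def by (rule Liminf_le_Limsup) simp

lemma shapira_lower_le_upper: "shapira_lower \<mu> X phi U \<delta> \<le> shapira_upper \<mu> X phi U \<delta>"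
  unfolding shapira_lower_def shapira_upper_def by (rule Liminf_le_Limsup) simp

lemma mdim_katok_lower:
  assumes "0 < \<delta>" "\<delta> < 1"
  shows "upper_mdim X phi = scaled_limsup (\<lambda>\<epsilon>. SUP \<mu>\<in>ergodic_measures X phi. katok_lower \<mu> X phi \<epsilon> \<delta>)"
proof (rule antisym)
  show "upper_mdim X phi \<le> scaled_limsup (\<lambda>\<epsilon>. SUP \<mu>\<in>ergodic_measures X phi. katok_lower \<mu> X phi \<epsilon> \<delta>)"
    using mdim_le[where Q="\<lambda>\<epsilon> \<mu>. katok_lower \<mu> X phi \<epsilon> \<delta>" and r=1 and d=0 and \<delta>=\<delta>] assms by (simp add: katok_lower_nonneg)
  show "scaled_limsup (\<lambda>\<epsilon>. SUP \<mu>\<in>ergodic_measures X phi. katok_lower \<mu> X phi \<epsilon> \<delta>) \<le> upper_mdim X phi"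
    using order_trans[OF katok_lower_le_upper katok_upper_le[OF _ _ assms(2)]]
    by (intro le_mdim[where r=1 and C=0]) auto
qed

lemma mdim_katok_upper:
  assumes "0 < \<delta>" "\<delta> < 1"
  shows "upper_mdim X phi = scaled_limsup (\<lambda>\<epsilon>. SUP \<mu>\<in>ergodic_measures X phi. katok_upper \<mu> X phi \<epsilon> \<delta>)"
proof (rule antisym)
  show "upper_mdim X phi \<le> scaled_limsup (\<lambda>\<epsilon>. SUP \<mu>\<in>ergodic_measures X phi. katok_upper \<mu> X phi \<epsilon> \<delta>)"
    using mdim_le[where Q="\<lambda>\<epsilon> \<mu>. katok_upper \<mu> X phi \<epsilon> \<delta>" and r=1 and d=0 and \<delta>=\<delta>] assms
      order_trans[OF katok_lower_nonneg katok_lower_le_upper] by (simp add: katok_lower_le_upper)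
  show "scaled_limsup (\<lambda>\<epsilon>. SUP \<mu>\<in>ergodic_measures X phi. katok_upper \<mu> X phi \<epsilon> \<delta>) \<le> upper_mdim X phi"
    using katok_upper_le[OF _ _ assms(2)] by (intro le_mdim[where r=1 and C=0]) auto
qed

text \<open>\<open>S\<close> stands for either Shapira entropy: the lower bound is proved for the
  smaller and the upper bound for the larger of the two, so both formulas follow at once.\<close>

lemma mdim_shapira:
  assumes \<delta>: "0 < \<delta>" "\<delta> < 1"
    and S: "\<And>\<mu> U. shapira_lower \<mu> X phi U \<delta> \<le> S \<mu> U" "\<And>\<mu> U. S \<mu> U \<le> shapira_upper \<mu> X phi U \<delta>"
  shows "upper_mdim X phi = scaled_limsup (\<lambda>\<epsilon>. SUP \<mu>\<in>ergodic_measures X phi.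
        INF U\<in>{U. open_cover X U \<and> (\<forall>V\<in>U. diameter V \<le> \<epsilon>)}. S \<mu> U)"
proof (rule antisym)
  let ?Q = "\<lambda>\<epsilon> \<mu>. INF U\<in>{U. open_cover X U \<and> (\<forall>V\<in>U. diameter V \<le> \<epsilon>)}. S \<mu> U"
  have ge: "katok_lower \<mu> X phi (2 * \<epsilon>) (\<delta> / 2) \<le> ?Q \<epsilon> \<mu>" if "0 < \<epsilon>" "\<mu> \<in> ergodic_measures X phi" for \<epsilon> \<mu>
    using shapira_lower_ge[OF that(2,1) \<delta>] S(1) by (intro INF_greatest) (auto intro: order_trans)
  have "0 \<le> ?Q \<epsilon> \<mu>" if "0 < \<epsilon>" "\<mu> \<in> ergodic_measures X phi" for \<epsilon> \<mu>
    using ge[OF that] katok_lower_nonneg[OF that(2), of "2 * \<epsilon>" "\<delta> / 2"] that(1) \<delta> by (intro order_trans[OF _ ge[OF that]]) auto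
  then show "upper_mdim X phi \<le> scaled_limsup (\<lambda>\<epsilon>. SUP \<mu>\<in>ergodic_measures X phi. ?Q \<epsilon> \<mu>)"
    using mdim_le[where Q="?Q" and r=2 and d=0 and \<delta>="\<delta> / 2"] \<delta> ge by simp
  show "scaled_limsup (\<lambda>\<epsilon>. SUP \<mu>\<in>ergodic_measures X phi. ?Q \<epsilon> \<mu>) \<le> upper_mdim X phi"
  proof (rule le_mdim[where r=4 and C=0])
    fix \<epsilon> :: real and \<mu> assume e: "0 < \<epsilon>" and \<mu>: "\<mu> \<in> ergodic_measures X phi"
    obtain U where U: "open_cover X U" "\<forall>V\<in>U. diameter V \<le> \<epsilon>" "shapira_upper \<mu> X phi U \<delta> \<le> span_rate X phi (\<epsilon> / 4)"
      using shapira_upper_le[OF \<mu> e \<delta>(2)] by blast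
    have "?Q \<epsilon> \<mu> \<le> S \<mu> U" using U by (intro INF_lower) auto
    also have "\<dots> \<le> span_rate X phi (\<epsilon> / 4)" using S(2) U(3) order_trans by blast
    finally show "?Q \<epsilon> \<mu> \<le> span_rate X phi (\<epsilon> / 4) + ereal 0" by simp
  qed auto
qed

lemma mdim_BK:
  "upper_mdim X phi = scaled_limsup (\<lambda>\<epsilon>. SUP \<mu>\<in>ergodic_measures X phi. upper_BK \<mu> X phi \<epsilon>)"
proof (rule antisym)
  have BK0: "0 \<le> upper_BK \<mu> X phi \<epsilon>" for \<mu> \<epsilon> by (simp add: upper_BK_def)
  let ?R = "scaled_limsup (\<lambda>\<epsilon>. SUP \<mu>\<in>ergodic_measures X phi. upper_BK \<mu> X phi \<epsilon>)"
  have fac: "upper_mdim X phi \<le> ereal (1 + d) * ?R" if d: "0 < d" for d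
  proof (rule mdim_le[where r=2 and \<delta>="d / (2 * (1 + d))"])
    fix \<epsilon> :: real and \<mu> assume e: "0 < \<epsilon>" and \<mu>: "\<mu> \<in> ergodic_measures X phi"
    show "katok_lower \<mu> X phi (2 * \<epsilon>) (d / (2 * (1 + d))) \<le> ereal (1 + d) * upper_BK \<mu> X phi \<epsilon>"
    proof (rule ereal_le_of_real_bounds)
      fix c assume c: "ereal (1 + d) * upper_BK \<mu> X phi \<epsilon> < ereal c"
      have "upper_BK \<mu> X phi \<epsilon> < ereal (c / (1 + d))"
        using c d BK0[of \<mu> \<epsilon>] by (cases "upper_BK \<mu> X phi \<epsilon>") (auto simp: field_simps)
      moreover from this have "0 < c / (1 + d)" using BK0[of \<mu> \<epsilon>] by (metis ereal_less(2) le_less_trans)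
      ultimately show "katok_lower \<mu> X phi (2 * \<epsilon>) (d / (2 * (1 + d))) \<le> ereal c"
        using katok_lower_le_BK[OF \<mu> e d, of "c / (1 + d)"] d by simp
    qed
  qed (use d BK0 in \<open>auto simp: field_simps\<close>)
  obtain \<mu> where \<mu>: "\<mu> \<in> ergodic_measures X phi" using ergodic_measures_nonempty by blast
  show "upper_mdim X phi \<le> ?R"
  proof (rule ereal_le_of_factors[OF _ fac])
    show "0 \<le> ?R" using \<mu> BK0 by (intro scaled_limsup_nonneg SUP_upper2[of \<mu>]) auto
  qed
  show "?R \<le> upper_mdim X phi"
    using upper_BK_le by (intro le_mdim[where r=2 and C=0]) auto
qed

lemma ent_part_nonneg:
  assumes "\<mu> \<in> ergodic_measures X phi" "borel_partition X P"
  shows "0 \<le> ent_part \<mu> X phi P"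
  by (intro LIMSEQ_le_const[OF ent_part_tendsto[OF assms]] exI[of _ 0] allI impI divide_nonneg_nonneg
      prob_space.label_entropy_nonneg[OF ergodic_measuresD(1)[OF assms(1)]]) simp

lemma mdim_ent:
  "upper_mdim X phi = scaled_limsup (\<lambda>\<epsilon>. SUP \<mu>\<in>ergodic_measures X phi.
     INF P\<in>{P. borel_partition X P \<and> (\<forall>A\<in>P. diameter A \<le> \<epsilon>)}. ereal (ent_part \<mu> X phi P))"
proof (rule antisym)
  let ?Q = "\<lambda>\<epsilon> \<mu>. INF P\<in>{P. borel_partition X P \<and> (\<forall>A\<in>P. diameter A \<le> \<epsilon>)}. ereal (ent_part \<mu> X phi P)"
  let ?R = "scaled_limsup (\<lambda>\<epsilon>. SUP \<mu>\<in>ergodic_measures X phi. ?Q \<epsilon> \<mu>)"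
  have Q0: "0 \<le> ?Q \<epsilon> \<mu>" if "\<mu> \<in> ergodic_measures X phi" for \<epsilon> \<mu>
    using ent_part_nonneg[OF that] by (intro INF_greatest) auto
  have fac: "upper_mdim X phi \<le> ereal (1 + d) * ?R" if d: "0 < d" for d
  proof (rule mdim_le[where r=2 and \<delta>="d / (2 * (1 + d))"])
    fix \<epsilon> :: real and \<mu> assume e: "0 < \<epsilon>" and \<mu>: "\<mu> \<in> ergodic_measures X phi"
    show "0 \<le> ?Q \<epsilon> \<mu>" by (rule Q0[OF \<mu>])
    show "katok_lower \<mu> X phi (2 * \<epsilon>) (d / (2 * (1 + d))) \<le> ereal (1 + d) * ?Q \<epsilon> \<mu>"
    proof (rule ereal_le_of_real_bounds)
      fix c assume c: "ereal (1 + d) * ?Q \<epsilon> \<mu> < ereal c"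
      have "?Q \<epsilon> \<mu> < ereal (c / (1 + d))"
        using c d Q0[OF \<mu>, of \<epsilon>] by (cases "?Q \<epsilon> \<mu>") (auto simp: field_simps)
      then obtain P where P: "borel_partition X P" "\<forall>A\<in>P. diameter A \<le> \<epsilon>" "ent_part \<mu> X phi P < c / (1 + d)"
        by (auto simp: INF_less_iff)
      then have "0 < c / (1 + d)" using ent_part_nonneg[OF \<mu> P(1)] by linarith
      then show "katok_lower \<mu> X phi (2 * \<epsilon>) (d / (2 * (1 + d))) \<le> ereal c"
        using katok_lower_le_ent_part[OF \<mu> P(1,2) e d _ P(3)] d by simp
    qed
  qed (use d in \<open>auto simp: field_simps\<close>)
  obtain \<mu> where \<mu>: "\<mu> \<in> ergodic_measures X phi" using ergodic_measures_nonempty by blast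
  have "0 \<le> ?R"
  proof (rule scaled_limsup_nonneg)
    fix \<epsilon> :: real
    show "0 \<le> (SUP \<mu>\<in>ergodic_measures X phi. ?Q \<epsilon> \<mu>)" by (rule order_trans[OF Q0[OF \<mu>] SUP_upper[OF \<mu>, of "?Q \<epsilon>"]])
  qed
  then show "upper_mdim X phi \<le> ?R"
    using fac by (rule ereal_le_of_factors[where a="upper_mdim X phi" and b="?R"])
  show "?R \<le> upper_mdim X phi"
    using ent_part_INF_le by (intro le_mdim[where r=2 and C="ln 3 + 1"]) auto
qed

end

theorem theorem1p3:
  fixes X :: "'a::metric_space set" and phi :: "'a \<Rightarrow> real \<Rightarrow> 'a" and \<delta> :: real
  assumes "compact X" and "X \<noteq> {}"
    and "is_flow X phi" and "uniformly_lipschitz_flow X phi"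
    and "0 < \<delta>" and "\<delta> < 1"
  shows
    "upper_mdim X phi = scaled_limsup (\<lambda>\<epsilon>. SUP \<mu>\<in>ergodic_measures X phi.
        INF P\<in>{P. borel_partition X P \<and> (\<forall>A\<in>P. diameter A \<le> \<epsilon>)}. ereal (ent_part \<mu> X phi P))
   \<and> upper_mdim X phi = scaled_limsup (\<lambda>\<epsilon>. SUP \<mu>\<in>ergodic_measures X phi.
        INF U\<in>{U. open_cover X U \<and> (\<forall>V\<in>U. diameter V \<le> \<epsilon>)}. shapira_lower \<mu> X phi U \<delta>)
   \<and> upper_mdim X phi = scaled_limsup (\<lambda>\<epsilon>. SUP \<mu>\<in>ergodic_measures X phi.
        INF U\<in>{U. open_cover X U \<and> (\<forall>V\<in>U. diameter V \<le> \<epsilon>)}. shapira_upper \<mu> X phi U \<delta>)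
   \<and> upper_mdim X phi = scaled_limsup (\<lambda>\<epsilon>. SUP \<mu>\<in>ergodic_measures X phi. upper_BK \<mu> X phi \<epsilon>)
   \<and> upper_mdim X phi = scaled_limsup (\<lambda>\<epsilon>. SUP \<mu>\<in>ergodic_measures X phi. katok_lower \<mu> X phi \<epsilon> \<delta>)
   \<and> upper_mdim X phi = scaled_limsup (\<lambda>\<epsilon>. SUP \<mu>\<in>ergodic_measures X phi. katok_upper \<mu> X phi \<epsilon> \<delta>)"
proof -
  have "(0::real) < 1" by simp
  then obtain K where K: "0 < K" "\<And>\<epsilon> x y s. 0 < \<epsilon> \<Longrightarrow> x \<in> X \<Longrightarrow> y \<in> X \<Longrightarrow> dist x y \<le> \<epsilon> / K \<Longrightarrow> s \<in> {0..1} \<Longrightarrow>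
      dist (phi x s) (phi y s) < \<epsilon>"
    using assms(4) unfolding uniformly_lipschitz_flow_def by metis
  \<comment> \<open>Enlarging the constant only strengthens the closeness required of the two
    points, so \<open>max K 1\<close> is again admissible.\<close>
  interpret lipschitz_flow X phi "max K 1"
  proof
    fix \<epsilon> s :: real and x y
    assume *: "0 < \<epsilon>" "x \<in> X" "y \<in> X" "dist x y \<le> \<epsilon> / max K 1" "0 \<le> s" "s \<le> 1"
    have "\<epsilon> / max K 1 \<le> \<epsilon> / K" using * K(1) by (intro divide_left_mono) auto
    then show "dist (phi x s) (phi y s) < \<epsilon>" using * by (intro K(2)) auto
  qed (use assms in auto)
  show ?thesis
    using mdim_ent mdim_shapira[OF assms(5,6), of "\<lambda>\<mu> U. shapira_lower \<mu> X phi U \<delta>"]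
      mdim_shapira[OF assms(5,6), of "\<lambda>\<mu> U. shapira_upper \<mu> X phi U \<delta>"]
      mdim_BK mdim_katok_lower[OF assms(5,6)] mdim_katok_upper[OF assms(5,6)] shapira_lower_le_upper
    by simp
qed

end
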